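(* Let $P(\lambda)=\sum_{i=0}^k\lambda^iA_i$ be an $n\times n$ matrix polynomial of degree $k$ with $A_i\in\mathbb{C}^{n\times n}$, let $r$ be an integer with $0<r<kn$, and let $p=\min\{r,k\}$. Let $\mathcal{X}$ be the collection of all $(p+1)n\times(r+1)$ block Toeplitz-like matrices $X$ of the following form: for some $x_0,\dots,x_r\in\mathbb{C}^n$ with $x_0\neq0$ and some $\gamma_1,\dots,\gamma_r>0$, the $n\times1$ block of $X$ in block row $i$ and column $j$ ($0\leqslant i\leqslant p$, $0\leqslant j\leqslant r$) is $$\left(\prod_{l=j-i+1}^{j}\gamma_l\right)x_{j-i}\ \text{ if } j\geqslant i,\qquad 0\ \text{ if } j<i,$$ where an empty product is $1$. Then for $s=2$ or $F$, $$\delta_s(P,0,r+1)=\inf_{X\in\mathcal{X}}\left\|\begin{bmatrix}A_0&\cdots&A_p\end{bmatrix}XX^\dagger\right\|_s,$$ and in general, for $\lambda_0\in\mathbb{C}$, $$\delta_s(P,\lambda_0,r+1)=\inf_{X\in\mathcal{X}}\left\|\begin{bmatrix}P(\lambda_0)&P'(\lambda_0)&\cdots&\frac{1}{p!}P^p(\lambda_0)\end{bmatrix}X\,(M(\lambda_0;r)X)^\dagger\right\|_s.$$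
   Context: $Y^\dagger$ is the Moore–Penrose pseudoinverse of $Y$; $P^i$ is the $i$-th derivative of $P$; $\|\cdot\|_2$ and $\|\cdot\|_F$ are the spectral and Frobenius norms. For $r\leqslant k$ the matrices in $\mathcal{X}$ are $$X=\begin{bmatrix}x_0&x_1&x_2&\cdots&x_r\\0&\gamma_1x_0&\gamma_2x_1&\cdots&\gamma_rx_{r-1}\\0&0&\gamma_1\gamma_2x_0&\cdots&\gamma_{r-1}\gamma_rx_{r-2}\\\vdots&\vdots&\vdots&&\vdots\\0&0&0&\cdots&\gamma_1\cdots\gamma_rx_0\end{bmatrix};$$ for $r>k$ only the first $k+1$ block rows of this array are kept. $M(\lambda_0;r)=H(\lambda_0)\otimes I_n$, where $H(\lambda_0)$ is the $(k+1)\times(p+1)$ matrix with $(i,j)$ entry $\left.\frac{1}{(j-1)!}\frac{d^{j-1}\lambda^{i-1}}{d\lambda^{j-1}}\right|_{\lambda=\lambda_0}$. For $\Delta P(\lambda)=\sum_{i=0}^k\lambda^i\Delta A_i$, put $|||\Delta P|||_F=\left(\sum_{i=0}^k\|\Delta A_i\|_F^2\right)^{1/2}$ and $|||\Delta P|||_2=\|[\Delta A_0\ \cdots\ \Delta A_k]\|_2$. For $s=2$ or $F$, $\delta_s(P,\lambda_0,r+1)$ is the infimum of $|||\Delta P|||_s$ over all $\Delta P(\lambda)=\sum_{i=0}^k\lambda^i\Delta A_i$, $\Delta A_i\in\mathbb{C}^{n\times n}$ (any of which may be zero), such that $P+\Delta P$ has an elementary divisor $(\lambda-\lambda_0)^j$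 with $j\geqslant r+1$. Elementary divisors are defined via the Smith form: $P(\lambda)=E(\lambda)D(\lambda)F(\lambda)$ with $E,F$ matrix polynomials with nonzero constant determinants and $D=\mathrm{diag}(d_1,\dots,d_t,0,\dots,0)$, $d_i$ monic, $d_{i-1}\mid d_i$; if $d_i(\lambda)=\prod_j(\lambda-\lambda_{ij})^{c_{ij}}$ with distinct $\lambda_{ij}$ and $c_{ij}\geqslant1$, the factors $(\lambda-\lambda_{ij})^{c_{ij}}$ are the elementary divisors. *)

theory Defs
  imports
    "HOL-Analysis.L2_Norm"
    "Jordan_Normal_Form.Determinant"
    "Jordan_Normal_Form.Schur_Decomposition"
begin

definition vec_norm2 :: "complex vec \<Rightarrow> real" where
  "vec_norm2 v = L2_set (\<lambda>i. cmod (v $ i)) {..<dim_vec v}"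

definition spectral_norm :: "complex mat \<Rightarrow> real" where
  "spectral_norm A =
     Sup {vec_norm2 (A *\<^sub>v v) | v. v \<in> carrier_vec (dim_col A) \<and> vec_norm2 v \<le> 1}"

definition frobenius_norm :: "complex mat \<Rightarrow> real" where
  "frobenius_norm A = sqrt (\<Sum>i<dim_row A. \<Sum>j<dim_col A. (cmod (A $$ (i, j)))\<^sup>2)"

datatype norm_kind = Spectral | Frobenius

fun mat_norm :: "norm_kind \<Rightarrow> complex mat \<Rightarrow> real" where
  "mat_norm Spectral A = spectral_norm A"
| "mat_norm Frobenius A = frobenius_norm A"

text \<open>Every complex matrix satisfies the four Penrose equations with exactly one \<open>B\<close>, so
  the description in \<open>pinv\<close> is well defined.\<close>

definition is_pinv :: "complex mat \<Rightarrow> complex mat \<Rightarrow> bool" where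
  "is_pinv A B \<longleftrightarrow>
     B \<in> carrier_mat (dim_col A) (dim_row A) \<and>
     A * B * A = A \<and> B * A * B = B \<and>
     mat_adjoint (A * B) = A * B \<and> mat_adjoint (B * A) = B * A"

definition pinv :: "complex mat \<Rightarrow> complex mat" where
  "pinv A = (THE B. is_pinv A B)"

text \<open>The \<open>n \<times> m n\<close> matrix \<open>[B 0, \<dots>, B (m - 1)]\<close> with blocks of size \<open>n \<times> n\<close>.\<close>

definition block_row :: "nat \<Rightarrow> nat \<Rightarrow> (nat \<Rightarrow> complex mat) \<Rightarrow> complex mat" where
  "block_row n m B = mat n (m * n) (\<lambda>(a, b). B (b div n) $$ (a, b mod n))"

definition kronecker :: "complex mat \<Rightarrow> complex mat \<Rightarrow> complex mat" where
  "kronecker A B = mat (dim_row A * dim_row B) (dim_col A * dim_col B)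
     (\<lambda>(a, b). A $$ (a div dim_row B, b div dim_col B) * B $$ (a mod dim_row B, b mod dim_col B))"

text \<open>A matrix polynomial is a matrix with polynomial entries; \<open>matrix_poly n k A\<close> is
  \<open>\<Sum>l\<le>k. \<lambda>\<^sup>l A\<^sub>l\<close>.\<close>

definition matrix_poly :: "nat \<Rightarrow> nat \<Rightarrow> (nat \<Rightarrow> complex mat) \<Rightarrow> complex poly mat" where
  "matrix_poly n k A = mat n n (\<lambda>(a, b). \<Sum>l\<le>k. monom (A l $$ (a, b)) l)"

definition eval_mp :: "complex poly mat \<Rightarrow> complex \<Rightarrow> complex mat" where
  "eval_mp P z = map_mat (\<lambda>q. poly q z) P"

definition deriv_mp :: "nat \<Rightarrow> complex poly mat \<Rightarrow> complex poly mat" where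
  "deriv_mp i P = map_mat (pderiv ^^ i) P"

definition unimodular :: "nat \<Rightarrow> complex poly mat \<Rightarrow> bool" where
  "unimodular n E \<longleftrightarrow> E \<in> carrier_mat n n \<and> (\<exists>c. c \<noteq> 0 \<and> det E = [:c:])"

text \<open>\<open>ds\<close> lists the nonzero diagonal entries \<open>d\<^sub>1, \<dots>, d\<^sub>t\<close> of the Smith form.\<close>

definition smith_form :: "complex poly mat \<Rightarrow> complex poly list \<Rightarrow> bool" where
  "smith_form P ds \<longleftrightarrow>
     length ds \<le> dim_row P \<and>
     (\<forall>d \<in> set ds. lead_coeff d = 1) \<and>
     (\<forall>i. Suc i < length ds \<longrightarrow> ds ! i dvd ds ! Suc i) \<and>
     (\<exists>E F. unimodular (dim_row P) E \<and> unimodular (dim_row P) F \<and>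
        P = E * mat_diag (dim_row P) (\<lambda>i. if i < length ds then ds ! i else 0) * F)"

definition elementary_divisors :: "complex poly mat \<Rightarrow> complex poly set" where
  "elementary_divisors P =
     {[:- z, 1:] ^ order z d | z d. \<exists>ds. smith_form P ds \<and> d \<in> set ds \<and> order z d \<ge> 1}"

text \<open>\<open>pert_norm s n k \<Delta>A\<close> is the norm \<open>|||\<Delta>P|||\<^sub>s\<close> of \<open>\<Delta>P = \<Sum>i\<le>k. \<lambda>\<^sup>i \<Delta>A\<^sub>i\<close>.\<close>

fun pert_norm :: "norm_kind \<Rightarrow> nat \<Rightarrow> nat \<Rightarrow> (nat \<Rightarrow> complex mat) \<Rightarrow> real" where
  "pert_norm Frobenius n k dA = sqrt (\<Sum>i\<le>k. (frobenius_norm (dA i))\<^sup>2)"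
| "pert_norm Spectral n k dA = spectral_norm (block_row n (k + 1) dA)"

text \<open>\<open>k\<close> bounds the degree of the perturbations. The perturbed polynomial may have
  smaller degree and may be singular.\<close>

definition dist_ed :: "norm_kind \<Rightarrow> nat \<Rightarrow> complex poly mat \<Rightarrow> complex \<Rightarrow> nat \<Rightarrow> real" where
  "dist_ed s k P z m =
     Inf {pert_norm s (dim_row P) k dA | dA.
            (\<forall>i\<le>k. dA i \<in> carrier_mat (dim_row P) (dim_row P)) \<and>
            (\<exists>j\<ge>m. [:- z, 1:] ^ j \<in> elementary_divisors (P + matrix_poly (dim_row P) k dA))}"

definition toeplitz_like ::
  "nat \<Rightarrow> nat \<Rightarrow> nat \<Rightarrow> (nat \<Rightarrow> real) \<Rightarrow> (nat \<Rightarrow> complex vec) \<Rightarrow> complex mat" where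
  "toeplitz_like n p r \<gamma> x = mat ((p + 1) * n) (r + 1) (\<lambda>(a, j).
     let i = a div n in
     if i \<le> j then complex_of_real (\<Prod>l = j - i + 1..j. \<gamma> l) * (x (j - i) $ (a mod n)) else 0)"

definition toeplitz_set :: "nat \<Rightarrow> nat \<Rightarrow> nat \<Rightarrow> complex mat set" where
  "toeplitz_set n p r = {toeplitz_like n p r \<gamma> x | \<gamma> x.
     (\<forall>i\<le>r. x i \<in> carrier_vec n) \<and> x 0 \<noteq> 0\<^sub>v n \<and> (\<forall>l\<in>{1..r}. \<gamma> l > 0)}"

text \<open>With 0-based indices, entry \<open>(i, j)\<close> of \<open>H\<close> is the \<open>j\<close>-th derivative of \<open>\<lambda>\<^sup>i\<close> at
  \<open>z\<close>, divided by \<open>j!\<close>.\<close>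

definition H_mat :: "nat \<Rightarrow> nat \<Rightarrow> complex \<Rightarrow> complex mat" where
  "H_mat k p z = mat (k + 1) (p + 1) (\<lambda>(i, j). poly ((pderiv ^^ j) (monom 1 i)) z / fact j)"

definition M_mat :: "nat \<Rightarrow> nat \<Rightarrow> nat \<Rightarrow> complex \<Rightarrow> complex mat" where
  "M_mat n k p z = kronecker (H_mat k p z) (1\<^sub>m n)"

end

theory Submission
  imports Defs "HOL-Computational_Algebra.Fundamental_Theorem_Algebra"
begin

text \<open>
  Fix \<open>z\<close> and \<open>M = M_mat n k p z\<close>, and write \<open>R = [A\<^sub>0, \<dots>, A\<^sub>k]\<close> for the coefficient row of \<open>P\<close>, so that \<open>R M\<close>
  is the row of Taylor coefficients of \<open>P\<close> at \<open>z\<close>.  If a matrix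
  polynomial \<open>Q\<close> has the elementary divisor \<open>(\<lambda> - z)\<^sup>j\<close> with \<open>j \<ge> r + 1\<close>, then it has a root vector of
  order \<open>r + 1\<close>: a polynomial vector \<open>y\<close> with \<open>y(z) \<noteq> 0\<close> such that \<open>(\<lambda> - z)\<^sup>r\<^sup>+\<^sup>1\<close> divides \<open>Q y\<close>
  (\<open>elementary_divisor_imp_chain\<close>).  In terms of Taylor coefficients at \<open>z\<close> this is the linear system
  \<open>[C\<^sub>0, \<dots>, C\<^sub>k] M X = 0\<close>, where the \<open>C\<^sub>i\<close> are the coefficients of \<open>Q\<close> and the matrix \<open>X\<close> of the
  given Toeplitz form is built from the Taylor coefficients of \<open>y\<close>; the numbers \<open>\<gamma>\<^sub>l\<close> only rescale \<open>y\<close> and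
  the columns (\<open>toeplitz_product_zero_iff\<close>).

  For fixed \<open>X\<close> and \<open>Y = M X\<close> let \<open>\<Pi> = Y Y\<^sup>\<dagger>\<close>, the orthogonal projection onto the range of \<open>Y\<close>.
  The perturbation \<open>- R \<Pi>\<close> satisfies \<open>(R - R \<Pi>) Y = 0\<close>.  Conversely \<open>(R + D) Y = 0\<close> implies
  \<open>R \<Pi> = - D \<Pi>\<close>, and multiplication by an orthogonal projection increases neither norm
  (\<open>mat_norm_mult_projection\<close>).  So the least norm of a perturbation with a root vector given by \<open>X\<close> is the
  norm of \<open>R M X (M X)\<^sup>\<dagger>\<close>, and the infimum over \<open>X\<close> is the distance from \<open>P\<close> to the polynomials that
  have a root vector of order \<open>r + 1\<close> at \<open>z\<close>.

  For regular polynomials a root vector gives back an elementary divisor, by the Smith form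
  (\<open>chain_imp_elementary_divisor\<close>).  A singular polynomial, however, has root vectors of every order and
  need not have any elementary divisor.  What remains is that the infimum does not see the difference: every
  singular polynomial of degree at most \<open>k\<close> is a limit of polynomials of degree at most \<open>k\<close> that have the
  elementary divisor \<open>(\<lambda> - z)\<^sup>k\<^sup>n\<close>; this is where \<open>r < k n\<close> enters (\<open>singular_matrix_poly_limit\<close>).

  This is first proved for pencils \<open>\<alpha> A + \<beta> B\<close>, by induction on the size
  (\<open>singular_pencil_single_block_limit\<close>).  If \<open>A x = 0\<close> and \<open>B x \<noteq> 0\<close>, then in bases that start with \<open>x\<close>
  and \<open>B x\<close> the pencil is block triangular with corner entry \<open>\<beta>\<close> and a smaller singular pencil, to which
  the induction hypothesis applies; the corner contributes the missing factor \<open>\<beta>\<close> of the determinant.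
  The same is done with row vectors, and if neither is possible, then an arbitrarily small perturbation that
  keeps the pencil singular makes the second one possible.  A matrix polynomial is treated through its
  companion pencil.  The perturbed pencil is not a companion pencil any more, but it is close to one, and
  solving a linear system that is invertible at the companion pencil recovers from it a matrix polynomial
  close to the given one with the same spectral structure (\<open>singular_coeffs_limit\<close>).

  For \<open>z = 0\<close> the matrix \<open>M\<close> is a coordinate embedding and can be dropped from the formula
  (\<open>pinv_embedding_mult\<close>, \<open>mat_norm_mult_embedding\<close>).
\<close>

section \<open>Spectral and Frobenius norms\<close>

lemma mult_mat_vec_entry:
  assumes "A \<in> carrier_mat n m" "v \<in> carrier_vec m" "i < n"
  shows "(A *\<^sub>v v) $ i = (\<Sum>j<m. A $$ (i, j) * v $ j)"
  using assms by (auto simp: scalar_prod_def atLeast0LessThan intro!: sum.cong)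

lemma mult_mat_entry:
  assumes "A \<in> carrier_mat n m" "B \<in> carrier_mat m l" "i < n" "j < l"
  shows "(A * B) $$ (i, j) = (\<Sum>a<m. A $$ (i, a) * B $$ (a, j))"
  using assms by (auto simp: scalar_prod_def atLeast0LessThan intro!: sum.cong)

text \<open>The entrywise sum norm only measures smallness: it is submultiplicative, and it bounds the spectral and the
  Frobenius norm as well as each single entry.\<close>

definition mat_l1 :: "complex mat \<Rightarrow> real" where
  "mat_l1 A = (\<Sum>i<dim_row A. \<Sum>j<dim_col A. cmod (A $$ (i, j)))"

lemma mat_l1_nonneg: "0 \<le> mat_l1 A"
  by (auto simp: mat_l1_def intro!: sum_nonneg)

lemma cmod_entry_le_mat_l1:
  assumes "i < dim_row A" "j < dim_col A"
  shows "cmod (A $$ (i, j)) \<le> mat_l1 A"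
proof -
  have "cmod (A $$ (i, j)) \<le> (\<Sum>b<dim_col A. cmod (A $$ (i, b)))"
    using assms by (intro member_le_sum) auto
  also have "\<dots> \<le> mat_l1 A"
    unfolding mat_l1_def using assms
    by (intro member_le_sum[of i _ "\<lambda>i. \<Sum>b<dim_col A. cmod (A $$ (i, b))"]) (auto intro: sum_nonneg)
  finally show ?thesis .
qed

lemma mat_l1_mult:
  assumes "A \<in> carrier_mat n m" "B \<in> carrier_mat m l"
  shows "mat_l1 (A * B) \<le> mat_l1 A * mat_l1 B"
proof -
  have d: "dim_row A = n" "dim_col A = m" "dim_row B = m" "dim_col B = l" using assms by auto
  have "mat_l1 (A * B) = (\<Sum>i<n. \<Sum>j<l. cmod (\<Sum>a<m. A $$ (i, a) * B $$ (a, j)))"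
    unfolding mat_l1_def using assms
    by (auto intro!: sum.cong simp: mult_mat_entry[OF assms] simp del: index_mult_mat(1))
  also have "\<dots> \<le> (\<Sum>i<n. \<Sum>j<l. \<Sum>a<m. cmod (A $$ (i, a)) * cmod (B $$ (a, j)))"
    by (intro sum_mono order.trans[OF norm_sum]) (auto simp: norm_mult)
  also have "\<dots> = (\<Sum>i<n. \<Sum>a<m. cmod (A $$ (i, a)) * (\<Sum>j<l. cmod (B $$ (a, j))))"
    by (subst sum.swap) (simp add: sum_distrib_left)
  also have "\<dots> \<le> (\<Sum>i<n. \<Sum>a<m. cmod (A $$ (i, a)) * mat_l1 B)"
  proof (intro sum_mono mult_left_mono)
    fix a assume "a \<in> {..<m}"
    then show "(\<Sum>j<l. cmod (B $$ (a, j))) \<le> mat_l1 B"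
      unfolding mat_l1_def d
      by (intro member_le_sum[of a _ "\<lambda>a. \<Sum>j<l. cmod (B $$ (a, j))"]) (auto intro: sum_nonneg)
  qed auto
  also have "\<dots> = mat_l1 A * mat_l1 B"
    by (simp add: mat_l1_def[of A] d sum_distrib_right)
  finally show ?thesis .
qed

lemma mat_l1_add:
  assumes "A \<in> carrier_mat n m" "B \<in> carrier_mat n m"
  shows "mat_l1 (A + B) \<le> mat_l1 A + mat_l1 B"
proof -
  have "mat_l1 (A + B) = (\<Sum>i<n. \<Sum>j<m. cmod (A $$ (i, j) + B $$ (i, j)))"
    unfolding mat_l1_def using assms by (auto intro!: sum.cong)
  also have "\<dots> \<le> (\<Sum>i<n. \<Sum>j<m. cmod (A $$ (i, j)) + cmod (B $$ (i, j)))"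
    by (intro sum_mono norm_triangle_ineq)
  also have "\<dots> = mat_l1 A + mat_l1 B"
    using assms by (simp add: mat_l1_def sum.distrib)
  finally show ?thesis .
qed

lemma vec_norm2_nonneg: "0 \<le> vec_norm2 v"
  by (simp add: vec_norm2_def L2_set_nonneg)

lemma vec_norm2_sq: "(vec_norm2 v)\<^sup>2 = (\<Sum>i<dim_vec v. (cmod (v $ i))\<^sup>2)"
  by (simp add: vec_norm2_def L2_set_def sum_nonneg)

lemma vec_norm2_add:
  assumes "v \<in> carrier_vec n" "w \<in> carrier_vec n"
  shows "vec_norm2 (v + w) \<le> vec_norm2 v + vec_norm2 w"
proof -
  have "vec_norm2 (v + w) = L2_set (\<lambda>i. cmod (v $ i + w $ i)) {..<n}"
    unfolding vec_norm2_def using assms by (auto intro!: L2_set_cong)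
  also have "\<dots> \<le> L2_set (\<lambda>i. cmod (v $ i) + cmod (w $ i)) {..<n}"
    by (intro L2_set_mono norm_triangle_ineq) auto
  also have "\<dots> \<le> L2_set (\<lambda>i. cmod (v $ i)) {..<n} + L2_set (\<lambda>i. cmod (w $ i)) {..<n}"
    by (rule L2_set_triangle_ineq)
  finally show ?thesis unfolding vec_norm2_def using assms by auto
qed

lemma vec_norm2_mult_le:
  assumes "A \<in> carrier_mat n m" "v \<in> carrier_vec m"
  shows "vec_norm2 (A *\<^sub>v v) \<le> mat_l1 A * vec_norm2 v"
proof -
  have "vec_norm2 (A *\<^sub>v v) \<le> (\<Sum>i<n. cmod ((A *\<^sub>v v) $ i))"
    unfolding vec_norm2_def using assms
    by (intro order.trans[OF L2_set_le_sum]) auto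
  also have "\<dots> \<le> (\<Sum>i<n. \<Sum>j<m. cmod (A $$ (i, j)) * cmod (v $ j))"
    by (intro sum_mono) (auto simp: mult_mat_vec_entry[OF assms] norm_mult[symmetric] norm_sum)
  also have "\<dots> \<le> (\<Sum>i<n. \<Sum>j<m. cmod (A $$ (i, j)) * vec_norm2 v)"
    using assms by (intro sum_mono mult_left_mono)
      (auto simp: vec_norm2_def intro!: member_le_L2_set[of _ _ "\<lambda>j. cmod (v $ j)", simplified])
  also have "\<dots> = mat_l1 A * vec_norm2 v"
    using assms by (simp add: mat_l1_def sum_distrib_right)
  finally show ?thesis .
qed

lemma spectral_norm_bdd:
  "bdd_above {vec_norm2 (A *\<^sub>v v) | v. v \<in> carrier_vec (dim_col A) \<and> vec_norm2 v \<le> 1}"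
proof (rule bdd_aboveI)
  fix x assume "x \<in> {vec_norm2 (A *\<^sub>v v) | v. v \<in> carrier_vec (dim_col A) \<and> vec_norm2 v \<le> 1}"
  then obtain v where v: "x = vec_norm2 (A *\<^sub>v v)" "v \<in> carrier_vec (dim_col A)" "vec_norm2 v \<le> 1"
    by auto
  have "x \<le> mat_l1 A * vec_norm2 v"
    using vec_norm2_mult_le[of A "dim_row A" "dim_col A" v] v by auto
  also have "\<dots> \<le> mat_l1 A" using v mat_l1_nonneg[of A] by (simp add: mult_left_le)
  finally show "x \<le> mat_l1 A" .
qed

lemma vec_norm2_zero: "vec_norm2 (0\<^sub>v n) = 0"
  by (simp add: vec_norm2_def L2_set_def)

lemma spectral_norm_upper:
  assumes "v \<in> carrier_vec (dim_col A)" "vec_norm2 v \<le> 1"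
  shows "vec_norm2 (A *\<^sub>v v) \<le> spectral_norm A"
  unfolding spectral_norm_def using assms by (intro cSup_upper[OF _ spectral_norm_bdd]) auto

lemma spectral_norm_least:
  assumes "\<And>v. v \<in> carrier_vec (dim_col A) \<Longrightarrow> vec_norm2 v \<le> 1 \<Longrightarrow> vec_norm2 (A *\<^sub>v v) \<le> c"
  shows "spectral_norm A \<le> c"
  unfolding spectral_norm_def
proof (rule cSup_least)
  show "{vec_norm2 (A *\<^sub>v v) | v. v \<in> carrier_vec (dim_col A) \<and> vec_norm2 v \<le> 1} \<noteq> {}"
    using vec_norm2_zero[of "dim_col A"] by (auto intro!: exI[of _ "0\<^sub>v (dim_col A)"])
qed (use assms in auto)

lemma frobenius_norm_L2_set:
  "frobenius_norm A = L2_set (\<lambda>(i, j). cmod (A $$ (i, j))) ({..<dim_row A} \<times> {..<dim_col A})"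
  unfolding frobenius_norm_def L2_set_def by (simp add: sum.cartesian_product split_beta)

lemma frobenius_norm_sq: "(frobenius_norm A)\<^sup>2 = (\<Sum>i<dim_row A. (vec_norm2 (row A i))\<^sup>2)"
  unfolding frobenius_norm_def by (subst real_sqrt_pow2) (auto simp: vec_norm2_sq intro!: sum_nonneg)

lemma mat_norm_nonneg: "0 \<le> mat_norm s A"
proof (cases s)
  case Spectral
  have "0 \<le> vec_norm2 (A *\<^sub>v 0\<^sub>v (dim_col A))" by (rule vec_norm2_nonneg)
  also have "\<dots> \<le> spectral_norm A" by (rule spectral_norm_upper) (auto simp: vec_norm2_zero)
  finally show ?thesis using Spectral by simp
qed (auto simp: frobenius_norm_def intro!: sum_nonneg)

lemma mat_norm_add:
  assumes "A \<in> carrier_mat n m" "B \<in> carrier_mat n m"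
  shows "mat_norm s (A + B) \<le> mat_norm s A + mat_norm s B"
proof (cases s)
  case Spectral
  have "spectral_norm (A + B) \<le> spectral_norm A + spectral_norm B"
  proof (rule spectral_norm_least)
    fix v assume v: "v \<in> carrier_vec (dim_col (A + B))" "vec_norm2 v \<le> 1"
    have "(A + B) *\<^sub>v v = A *\<^sub>v v + B *\<^sub>v v"
      using assms v by (intro add_mult_distrib_mat_vec) auto
    then have "vec_norm2 ((A + B) *\<^sub>v v) \<le> vec_norm2 (A *\<^sub>v v) + vec_norm2 (B *\<^sub>v v)"
      using vec_norm2_add[of "A *\<^sub>v v" n "B *\<^sub>v v"] assms v by simp
    also have "\<dots> \<le> spectral_norm A + spectral_norm B"
      using assms v by (intro add_mono spectral_norm_upper) auto
    finally show "vec_norm2 ((A + B) *\<^sub>v v) \<le> spectral_norm A + spectral_norm B" .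
  qed
  then show ?thesis using Spectral by simp
next
  case Frobenius
  let ?I = "{..<n} \<times> {..<m}"
  have "frobenius_norm (A + B) = L2_set (\<lambda>(i, j). cmod (A $$ (i, j) + B $$ (i, j))) ?I"
    unfolding frobenius_norm_L2_set using assms by (auto intro!: L2_set_cong)
  also have "\<dots> \<le> L2_set (\<lambda>p. (\<lambda>(i, j). cmod (A $$ (i, j))) p + (\<lambda>(i, j). cmod (B $$ (i, j))) p) ?I"
    by (intro L2_set_mono) (auto intro: norm_triangle_ineq)
  also have "\<dots> \<le> L2_set (\<lambda>(i, j). cmod (A $$ (i, j))) ?I + L2_set (\<lambda>(i, j). cmod (B $$ (i, j))) ?I"
    by (rule L2_set_triangle_ineq)
  finally show ?thesis using Frobenius assms by (simp add: frobenius_norm_L2_set)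
qed

lemma mat_norm_uminus: "mat_norm s (- A) = mat_norm s A"
proof (cases s)
  case Spectral
  have "vec_norm2 ((- A) *\<^sub>v v) = vec_norm2 (A *\<^sub>v v)" if "v \<in> carrier_vec (dim_col A)" for v
    using that by (auto simp: vec_norm2_def intro!: L2_set_cong)
  then have "{vec_norm2 ((- A) *\<^sub>v v) | v. v \<in> carrier_vec (dim_col A) \<and> vec_norm2 v \<le> 1}
     = {vec_norm2 (A *\<^sub>v v) | v. v \<in> carrier_vec (dim_col A) \<and> vec_norm2 v \<le> 1}"
    by (intro Collect_cong) metis
  then show ?thesis using Spectral by (simp add: spectral_norm_def)
qed (simp add: frobenius_norm_def)

lemma mat_norm_le_mat_l1: "mat_norm s A \<le> mat_l1 A"
proof (cases s)
  case Spectral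
  have "spectral_norm A \<le> mat_l1 A"
  proof (rule spectral_norm_least)
    fix v assume v: "v \<in> carrier_vec (dim_col A)" "vec_norm2 v \<le> 1"
    have "vec_norm2 (A *\<^sub>v v) \<le> mat_l1 A * vec_norm2 v"
      by (rule vec_norm2_mult_le[of A "dim_row A" "dim_col A" v]) (use v in auto)
    also have "\<dots> \<le> mat_l1 A" using v mat_l1_nonneg[of A] by (simp add: mult_left_le)
    finally show "vec_norm2 (A *\<^sub>v v) \<le> mat_l1 A" .
  qed
  then show ?thesis using Spectral by simp
next
  case Frobenius
  have "frobenius_norm A \<le> mat_l1 A"
    unfolding frobenius_norm_L2_set mat_l1_def
    by (intro order.trans[OF L2_set_le_sum]) (auto simp: sum.cartesian_product split_beta)
  then show ?thesis using Frobenius by simp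
qed

definition contraction :: "complex mat \<Rightarrow> bool" where
  "contraction R \<longleftrightarrow> (\<forall>v \<in> carrier_vec (dim_col R). vec_norm2 (R *\<^sub>v v) \<le> vec_norm2 v)"

text \<open>The spectral norm of \<open>A R\<close> feels \<open>R\<close> acting on columns, whereas the Frobenius norm, taken row by row,
  feels \<open>R\<^sup>T\<close> acting on the rows of \<open>A\<close>; hence both have to be contractions.\<close>

lemma mat_norm_mult_contraction:
  assumes A: "A \<in> carrier_mat n m" and R: "R \<in> carrier_mat m l"
    and c: "contraction R" and ct: "contraction (R\<^sup>T)"
  shows "mat_norm s (A * R) \<le> mat_norm s A"
proof (cases s)
  case Spectral
  have "spectral_norm (A * R) \<le> spectral_norm A"
  proof (rule spectral_norm_least)
    fix v assume v: "v \<in> carrier_vec (dim_col (A * R))" "vec_norm2 v \<le> 1"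
    then have v': "v \<in> carrier_vec l" using R by auto
    have "vec_norm2 (R *\<^sub>v v) \<le> 1" using c v' v(2) R unfolding contraction_def by fastforce
    then have "vec_norm2 (A *\<^sub>v (R *\<^sub>v v)) \<le> spectral_norm A"
      using A R v' by (intro spectral_norm_upper) auto
    then show "vec_norm2 ((A * R) *\<^sub>v v) \<le> spectral_norm A"
      using A R v' by (simp add: assoc_mult_mat_vec)
  qed
  then show ?thesis using Spectral by simp
next
  case Frobenius
  have "vec_norm2 (row (A * R) i) \<le> vec_norm2 (row A i)" if i: "i < n" for i
  proof -
    have "row (A * R) i = R\<^sup>T *\<^sub>v row A i"
      using A R i by (intro eq_vecI) (auto simp: scalar_prod_def mult.commute intro!: sum.cong)
    then show ?thesis using ct A R i unfolding contraction_def by auto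
  qed
  then have "(frobenius_norm (A * R))\<^sup>2 \<le> (frobenius_norm A)\<^sup>2"
    unfolding frobenius_norm_sq using A R
    by (auto intro!: sum_mono power_mono vec_norm2_nonneg)
  then show ?thesis using Frobenius mat_norm_nonneg[of Frobenius A] by (auto intro: power2_le_imp_le)
qed

section \<open>The Moore--Penrose pseudoinverse\<close>

lemma mat_adjoint_carrier [simp]:
  "A \<in> carrier_mat n m \<Longrightarrow> mat_adjoint A \<in> carrier_mat m n"
  unfolding mat_adjoint_def by (auto simp: mat_of_rows_def)

lemma mat_adjoint_dim [simp]:
  "dim_row (mat_adjoint A) = dim_col A" "dim_col (mat_adjoint A) = dim_row A"
  unfolding mat_adjoint_def by auto

lemma mat_adjoint_entry:
  assumes "A \<in> carrier_mat n m" "i < m" "j < n"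
  shows "mat_adjoint A $$ (i, j) = cnj (A $$ (j, i))"
  using assms unfolding mat_adjoint_def
  by (subst mat_of_rows_index) (auto simp: conjugate_complex_def)

lemma mat_adjoint_adjoint:
  assumes "A \<in> carrier_mat n m"
  shows "mat_adjoint (mat_adjoint A) = (A :: complex mat)"
proof -
  have c: "mat_adjoint A \<in> carrier_mat m n" "mat_adjoint (mat_adjoint A) \<in> carrier_mat n m"
    using assms by auto
  show ?thesis
    using c assms by (intro eq_matI)
      (auto simp: mat_adjoint_entry[OF assms] mat_adjoint_entry[OF c(1)])
qed

lemma mat_adjoint_mult:
  assumes "A \<in> carrier_mat n m" "B \<in> carrier_mat m l"
  shows "mat_adjoint (A * B) = mat_adjoint B * (mat_adjoint A :: complex mat)"
proof -
  have c: "mat_adjoint A \<in> carrier_mat m n" "mat_adjoint B \<in> carrier_mat l m"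
    "A * B \<in> carrier_mat n l" "mat_adjoint (A * B) \<in> carrier_mat l n"
    "mat_adjoint B * mat_adjoint A \<in> carrier_mat l n"
    using assms by (auto intro!: mult_carrier_mat[of _ l m] mat_adjoint_carrier)
  show ?thesis
  proof (rule eq_matI)
    fix i j assume "i < dim_row (mat_adjoint B * mat_adjoint A)" "j < dim_col (mat_adjoint B * mat_adjoint A)"
    then have ij: "i < l" "j < n" using c by auto
    show "mat_adjoint (A * B) $$ (i, j) = (mat_adjoint B * mat_adjoint A) $$ (i, j)"
      unfolding mat_adjoint_entry[OF c(3) ij] mult_mat_entry[OF assms ij(2,1)] mult_mat_entry[OF c(2,1) ij]
      using ij assms by (auto simp: mat_adjoint_entry mult.commute intro!: sum.cong)
  qed (use c in auto)
qed

lemma mat_adjoint_add: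
  assumes "A \<in> carrier_mat n m" "B \<in> carrier_mat n m"
  shows "mat_adjoint (A + B) = mat_adjoint A + (mat_adjoint B :: complex mat)"
proof -
  have c: "A + B \<in> carrier_mat n m" "mat_adjoint (A + B) \<in> carrier_mat m n"
    "mat_adjoint A \<in> carrier_mat m n" "mat_adjoint B \<in> carrier_mat m n"
    using assms by (auto intro: mat_adjoint_carrier)
  show ?thesis
    using assms by (intro eq_matI)
      (auto simp: mat_adjoint_entry[OF c(1)] mat_adjoint_entry[OF assms(1)] mat_adjoint_entry[OF assms(2)])
qed

lemma cscalar_adjoint:
  fixes A :: "complex mat"
  assumes "A \<in> carrier_mat n m" "v \<in> carrier_vec m" "w \<in> carrier_vec n"
  shows "(A *\<^sub>v v) \<bullet>c w = v \<bullet>c (mat_adjoint A *\<^sub>v w)"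
proof -
  have c: "mat_adjoint A \<in> carrier_mat m n" using assms by auto
  have "(A *\<^sub>v v) \<bullet>c w = (\<Sum>i<n. (\<Sum>j<m. A $$ (i, j) * v $ j) * cnj (w $ i))"
    using assms by (auto simp: scalar_prod_def conjugate_complex_def atLeast0LessThan intro!: sum.cong)
  also have "\<dots> = (\<Sum>j<m. v $ j * cnj (\<Sum>i<n. mat_adjoint A $$ (j, i) * w $ i))"
    unfolding sum_distrib_right cnj_sum sum_distrib_left
    by (subst sum.swap) (auto intro!: sum.cong simp: mat_adjoint_entry[OF assms(1)])
  also have "\<dots> = (\<Sum>j<m. v $ j * cnj ((mat_adjoint A *\<^sub>v w) $ j))"
    by (intro sum.cong) (auto simp: mult_mat_vec_entry[OF c assms(3)])
  also have "\<dots> = v \<bullet>c (mat_adjoint A *\<^sub>v w)"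
    using assms c by (auto simp: scalar_prod_def conjugate_complex_def atLeast0LessThan intro!: sum.cong)
  finally show ?thesis .
qed

lemma cscalar_self: "v \<bullet>c v = complex_of_real ((vec_norm2 v)\<^sup>2)"
  unfolding vec_norm2_sq
  by (auto simp: scalar_prod_def conjugate_complex_def atLeast0LessThan complex_norm_square[symmetric] intro!: sum.cong)

text \<open>Pythagoras: \<open>v\<close> is the orthogonal sum of \<open>P v\<close> and \<open>v - P v\<close>.\<close>

lemma contraction_projection:
  fixes P :: "complex mat"
  assumes P: "P \<in> carrier_mat n n" and h: "mat_adjoint P = P" and i: "P * P = P"
  shows "contraction P"
  unfolding contraction_def
proof
  fix v :: "complex vec"
  assume "v \<in> carrier_vec (dim_col P)"
  then have v: "v \<in> carrier_vec n" using P by auto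
  define w where "w = P *\<^sub>v v"
  have w: "w \<in> carrier_vec n" unfolding w_def using P v by auto
  have Pw: "P *\<^sub>v w = w" unfolding w_def using P v i by (simp flip: assoc_mult_mat_vec)
  have vw: "v \<bullet>c w = w \<bullet>c w"
    using cscalar_adjoint[OF P v w] by (simp add: h Pw w_def[symmetric])
  have wv: "w \<bullet>c v = w \<bullet>c w"
    using cscalar_adjoint[OF P w v] by (simp add: h Pw w_def[symmetric])
  have "(v - w) \<bullet>c (v - w) = v \<bullet>c v - v \<bullet>c w - (w \<bullet>c v - w \<bullet>c w)"
    using v w by (auto simp: scalar_prod_def conjugate_complex_def sum_subtractf algebra_simps)
  also have "\<dots> = v \<bullet>c v - w \<bullet>c w" by (simp add: vw wv)
  finally have "complex_of_real ((vec_norm2 (v - w))\<^sup>2) = complex_of_real ((vec_norm2 v)\<^sup>2 - (vec_norm2 w)\<^sup>2)"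
    by (simp add: cscalar_self)
  then have "(vec_norm2 (v - w))\<^sup>2 = (vec_norm2 v)\<^sup>2 - (vec_norm2 w)\<^sup>2"
    by (simp only: of_real_eq_iff)
  then have "(vec_norm2 w)\<^sup>2 \<le> (vec_norm2 v)\<^sup>2" by (smt (verit) zero_le_power2)
  then show "vec_norm2 (P *\<^sub>v v) \<le> vec_norm2 v"
    unfolding w_def by (rule power2_le_imp_le) (rule vec_norm2_nonneg)
qed

lemma projection_transpose:
  assumes P: "(P :: complex mat) \<in> carrier_mat n n" and h: "mat_adjoint P = P" and i: "P * P = P"
  shows "mat_adjoint (P\<^sup>T) = P\<^sup>T" "P\<^sup>T * P\<^sup>T = P\<^sup>T"
proof -
  show "P\<^sup>T * P\<^sup>T = P\<^sup>T" using transpose_mult[OF P P] i by simp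
  have Pt: "P\<^sup>T \<in> carrier_mat n n" using P by auto
  show "mat_adjoint (P\<^sup>T) = P\<^sup>T"
  proof (rule eq_matI)
    fix a b assume "a < dim_row (P\<^sup>T)" "b < dim_col (P\<^sup>T)"
    then have ab: "a < n" "b < n" using P by auto
    have "mat_adjoint P $$ (b, a) = P $$ (b, a)" by (simp add: h)
    then show "mat_adjoint (P\<^sup>T) $$ (a, b) = P\<^sup>T $$ (a, b)"
      using ab P by (simp add: mat_adjoint_entry[OF P] mat_adjoint_entry[OF Pt])
  qed (use mat_adjoint_carrier[OF Pt] P in auto)
qed

lemma mat_norm_mult_projection:
  assumes "A \<in> carrier_mat n m" "P \<in> carrier_mat m m" "mat_adjoint P = P" "P * P = P"
  shows "mat_norm s (A * P) \<le> mat_norm s A"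
  using assms projection_transpose[OF assms(2-4)]
  by (intro mat_norm_mult_contraction contraction_projection) auto

text \<open>Gram--Schmidt: the columns of \<open>A\<close> are brought into the range of the projection \<open>A S\<close> one after the
  other.  That the projection factors through \<open>A\<close> is what makes \<open>S\<close> a first approximation of the
  pseudoinverse.\<close>

lemma projection_onto_columns:
  fixes A :: "complex mat"
  assumes A: "A \<in> carrier_mat m c"
  shows "\<exists>S \<in> carrier_mat c m. mat_adjoint (A * S) = A * S \<and> A * S * A = A"
proof -
  have "\<exists>S \<in> carrier_mat c m. mat_adjoint (A * S) = A * S \<and> A * S * (A * S) = A * S \<and>
          (\<forall>j<t. A * S *\<^sub>v col A j = col A j)" if "t \<le> c" for t
    using that
  proof (induction t)
    case 0
    have z: "A * 0\<^sub>m c m = 0\<^sub>m m m" using A by auto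
    have c0: "mat_adjoint (0\<^sub>m m m :: complex mat) \<in> carrier_mat m m" by auto
    have "mat_adjoint (0\<^sub>m m m :: complex mat) = 0\<^sub>m m m"
      using c0 by (intro eq_matI) (auto simp: mat_adjoint_entry[of _ m m])
    then show ?case by (intro bexI[of _ "0\<^sub>m c m"]) (auto simp: z)
  next
    case (Suc t)
    then obtain S where S: "S \<in> carrier_mat c m" and h: "mat_adjoint (A * S) = A * S"
      and i: "A * S * (A * S) = A * S" and f: "\<And>j. j < t \<Longrightarrow> A * S *\<^sub>v col A j = col A j"
      by auto
    define P where "P = A * S"
    have P: "P \<in> carrier_mat m m" unfolding P_def using A S by auto
    note h = h[folded P_def] and i = i[folded P_def] and f = f[folded P_def]
    define a where "a = col A t"
    have a: "a \<in> carrier_vec m" unfolding a_def using A by auto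
    define v where "v = a - P *\<^sub>v a"
    have v: "v \<in> carrier_vec m" unfolding v_def using a P by auto
    show ?case
    proof (cases "v = 0\<^sub>v m")
      case True
      have "P *\<^sub>v a = a"
      proof (rule eq_vecI)
        fix i assume "i < dim_vec a"
        then have im: "i < m" using a by auto
        have "v $ i = 0" using True im by simp
        then show "(P *\<^sub>v a) $ i = a $ i" using im a P unfolding v_def by simp
      qed (use a P in auto)
      then have "P *\<^sub>v col A j = col A j" if "j < Suc t" for j
        using f that by (cases "j = t") (auto simp: a_def)
      then have "mat_adjoint (A * S) = A * S \<and> A * S * (A * S) = A * S \<and>
          (\<forall>j<Suc t. A * S *\<^sub>v col A j = col A j)"
        using h i unfolding P_def by (intro conjI) auto
      with S show ?thesis by (rule bexI[rotated])
    next
      case False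
      define u where "u = unit_vec c t - S *\<^sub>v a"
      have u: "u \<in> carrier_vec c" unfolding u_def using S by (intro carrier_vecI) simp
      have Au: "A *\<^sub>v u = v"
      proof -
        have "A *\<^sub>v u = A *\<^sub>v unit_vec c t - A *\<^sub>v (S *\<^sub>v a)"
          unfolding u_def using A S a by (intro mult_minus_distrib_mat_vec) auto
        also have "A *\<^sub>v unit_vec c t = a" unfolding a_def using A Suc.prems
          by (intro eq_vecI) (auto simp: row_def)
        finally show ?thesis unfolding v_def P_def using A S a by simp
      qed
      have Pv: "P *\<^sub>v v = 0\<^sub>v m"
      proof -
        have "P *\<^sub>v v = P *\<^sub>v a - P *\<^sub>v (P *\<^sub>v a)"
          unfolding v_def using P a by (intro mult_minus_distrib_mat_vec) auto
        also have "P *\<^sub>v (P *\<^sub>v a) = P *\<^sub>v a" using assoc_mult_mat_vec[OF P P a] i by simp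
        finally show ?thesis using P a by auto
      qed
      define N where "N = complex_of_real ((vec_norm2 v)\<^sup>2)"
      have N: "v \<bullet>c v = N" by (simp add: N_def cscalar_self)
      have N0: "N \<noteq> 0" using False v N by (metis conjugate_square_eq_0_vec)
      \<comment> \<open>\<open>v\<close> is the part of the new column \<open>a\<close> orthogonal to the range of \<open>P\<close>, so \<open>P + v v\<^sup>* / (v\<^sup>* v)\<close> is
          again a projection; since \<open>v = A u\<close>, it still factors through \<open>A\<close>\<close>
      define R where "R = mat m m (\<lambda>(i, j). v $ i * cnj (v $ j) / N)"
      define S' where "S' = S + mat c m (\<lambda>(i, j). u $ i * cnj (v $ j) / N)"
      have R: "R \<in> carrier_mat m m" unfolding R_def by auto
      have S': "S' \<in> carrier_mat c m" unfolding S'_def using S by auto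
      have Rw: "R *\<^sub>v w = ((w \<bullet>c v) / N) \<cdot>\<^sub>v v" if w: "w \<in> carrier_vec m" for w
      proof (rule eq_vecI)
        fix i assume "i < dim_vec (((w \<bullet>c v) / N) \<cdot>\<^sub>v v)"
        then have im: "i < m" using v by auto
        show "(R *\<^sub>v w) $ i = (((w \<bullet>c v) / N) \<cdot>\<^sub>v v) $ i"
          unfolding mult_mat_vec_entry[OF R w im] using im v w
          by (auto simp: R_def scalar_prod_def conjugate_complex_def sum_divide_distrib
            sum_distrib_right atLeast0LessThan intro!: sum.cong)
      qed (use R v in auto)
      have orth: "(P *\<^sub>v w) \<bullet>c v = 0" if w: "w \<in> carrier_vec m" for w
        using cscalar_adjoint[OF P w v] h Pv w by (simp add: scalar_prod_def conjugate_complex_def)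
      have AS': "A * S' = P + R"
      proof -
        have "A * mat c m (\<lambda>(i, j). u $ i * cnj (v $ j) / N) = R"
        proof (rule eq_matI)
          fix i j assume "i < dim_row R" "j < dim_col R"
          then have ij: "i < m" "j < m" using R by auto
          have "(A * mat c m (\<lambda>(i, j). u $ i * cnj (v $ j) / N)) $$ (i, j)
            = (\<Sum>b<c. A $$ (i, b) * (u $ b * cnj (v $ j) / N))"
            using ij by (subst mult_mat_entry[OF A _ ij]) auto
          also have "\<dots> = (A *\<^sub>v u) $ i * cnj (v $ j) / N"
            unfolding mult_mat_vec_entry[OF A u ij(1)]
            by (simp add: sum_divide_distrib sum_distrib_right mult.assoc)
          finally show "(A * mat c m (\<lambda>(i, j). u $ i * cnj (v $ j) / N)) $$ (i, j) = R $$ (i, j)"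
            using ij by (simp add: Au R_def)
        qed (use R A in auto)
        then show ?thesis unfolding S'_def P_def using A S by (simp add: mult_add_distrib_mat[OF A S])
      qed
      have hR: "mat_adjoint R = R"
      proof (rule eq_matI)
        fix i j assume "i < dim_row R" "j < dim_col R"
        then have ij: "i < m" "j < m" using R by auto
        show "mat_adjoint R $$ (i, j) = R $$ (i, j)"
          unfolding mat_adjoint_entry[OF R ij] using ij by (simp add: R_def N_def)
      qed (use mat_adjoint_carrier[OF R] R in auto)
      have h': "mat_adjoint (P + R) = P + R" by (simp add: mat_adjoint_add[OF P R] h hR)
      have ap: "(P + R) *\<^sub>v w = P *\<^sub>v w + ((w \<bullet>c v) / N) \<cdot>\<^sub>v v" if w: "w \<in> carrier_vec m" for w
        using add_mult_distrib_mat_vec[OF P R w] Rw[OF w] by simp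
      have zv: "(0 :: complex) \<cdot>\<^sub>v v = 0\<^sub>v m" using v by (intro eq_vecI) auto
      have i': "(P + R) * (P + R) = P + R"
      proof (rule mat_col_eqI)
        fix j assume "j < dim_col (P + R)"
        then have j: "j < m" using R by auto
        define w :: "complex vec" where "w = unit_vec m j"
        have w: "w \<in> carrier_vec m" by (simp add: w_def)
        define d where "d = (w \<bullet>c v) / N"
        have "(P + R) *\<^sub>v ((P + R) *\<^sub>v w) = (P + R) *\<^sub>v (P *\<^sub>v w + d \<cdot>\<^sub>v v)"
          by (simp add: ap[OF w] d_def)
        also have "\<dots> = (P + R) *\<^sub>v (P *\<^sub>v w) + (P + R) *\<^sub>v (d \<cdot>\<^sub>v v)"
          using P R w v by (intro mult_add_distrib_mat_vec) auto
        also have "(P + R) *\<^sub>v (P *\<^sub>v w) = P *\<^sub>v w"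
        proof -
          have "P *\<^sub>v (P *\<^sub>v w) = P *\<^sub>v w" using assoc_mult_mat_vec[OF P P w] i by simp
          moreover have "P *\<^sub>v w \<in> carrier_vec m" using P w by auto
          ultimately show ?thesis using ap[of "P *\<^sub>v w"] orth[OF w] v by (simp add: zv)
        qed
        also have "(P + R) *\<^sub>v (d \<cdot>\<^sub>v v) = d \<cdot>\<^sub>v v"
        proof -
          have "P + R \<in> carrier_mat m m" using P R by auto
          then have "(P + R) *\<^sub>v (d \<cdot>\<^sub>v v) = d \<cdot>\<^sub>v ((P + R) *\<^sub>v v)" using v by (rule mult_mat_vec)
          also have "(P + R) *\<^sub>v v = v" using ap[OF v] N N0 Pv v by simp
          finally show ?thesis .
        qed
        finally have "(P + R) *\<^sub>v ((P + R) *\<^sub>v w) = (P + R) *\<^sub>v w" by (simp add: ap[OF w] d_def)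
        moreover have "col X j = X *\<^sub>v w" if "X \<in> carrier_mat m m" for X :: "complex mat"
          using that j by (intro eq_vecI) (auto simp: w_def row_def)
        moreover have "(P + R) * (P + R) \<in> carrier_mat m m" "P + R \<in> carrier_mat m m" using P R by auto
        ultimately show "col ((P + R) * (P + R)) j = col (P + R) j"
          using assoc_mult_mat_vec[of "P + R" m m "P + R" m w] w by simp
      qed (use P R in auto)
      have f': "(P + R) *\<^sub>v col A j = col A j" if "j < Suc t" for j
      proof (cases "j = t")
        case True
        have "v \<bullet>c v = a \<bullet>c v - (P *\<^sub>v a) \<bullet>c v"
          using v a P unfolding v_def
          by (intro minus_scalar_prod_distrib[of _ m]) auto
        then have "a \<bullet>c v = N" using N orth[OF a] by simp
        then have "(P + R) *\<^sub>v a = P *\<^sub>v a + v" using ap[OF a] N0 by simp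
        also have "\<dots> = a" unfolding v_def using a P by (intro eq_vecI) auto
        finally show ?thesis by (simp add: True a_def)
      next
        case False
        then have j: "j < t" using that by simp
        have cj: "col A j \<in> carrier_vec m" using A by auto
        have "col A j \<bullet>c v = 0" using orth[OF cj] f[OF j] by simp
        then show ?thesis using ap[OF cj] f[OF j] v cj by (simp add: zv)
      qed
      show ?thesis
        by (intro bexI[of _ S'] conjI allI impI) (simp_all add: AS' S' h' i' f')
    qed
  qed
  from this[of c] obtain S where S: "S \<in> carrier_mat c m" "mat_adjoint (A * S) = A * S"
    and f: "\<forall>j<c. A * S *\<^sub>v col A j = col A j" by auto
  have "A * S * A = A"
  proof (rule mat_col_eqI)
    fix j assume "j < dim_col A"
    then show "col (A * S * A) j = col A j" using f A S by (subst col_mult2[of _ m m _ c]) auto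
  qed (use A S in auto)
  then show ?thesis using S by auto
qed

text \<open>If \<open>P = A S\<close> and \<open>Q = U A\<close> are the orthogonal projections onto the ranges of \<open>A\<close> and of its adjoint,
  then \<open>B = Q S P\<close> satisfies \<open>A B = P\<close> and \<open>B A = Q\<close>.\<close>

lemma is_pinv_exists:
  fixes A :: "complex mat"
  shows "\<exists>B. is_pinv A B"
proof -
  obtain m c where A: "A \<in> carrier_mat m c" by blast
  obtain S where S: "S \<in> carrier_mat c m" "mat_adjoint (A * S) = A * S" "A * S * A = A"
    using projection_onto_columns[OF A] by auto
  have A': "mat_adjoint A \<in> carrier_mat c m" using A by auto
  obtain T where T: "T \<in> carrier_mat m c" "mat_adjoint (mat_adjoint A * T) = mat_adjoint A * T"
    "mat_adjoint A * T * mat_adjoint A = mat_adjoint A"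
    using projection_onto_columns[OF A'] by auto
  define P where "P = A * S"
  define U where "U = mat_adjoint T"
  have U: "U \<in> carrier_mat c m" unfolding U_def using T by auto
  define Q where "Q = U * A"
  have P: "P \<in> carrier_mat m m" unfolding P_def using A S by auto
  have Q: "Q \<in> carrier_mat c c" unfolding Q_def using A U by auto
  have Qh: "mat_adjoint A * T = Q"
    using T(2) mat_adjoint_mult[OF A' T(1)] mat_adjoint_adjoint[OF A] by (simp add: Q_def U_def)
  have hQ: "mat_adjoint Q = Q" using T(2) Qh by simp
  have AQ: "A * Q = A"
  proof -
    have "mat_adjoint (Q * mat_adjoint A) = A * Q"
      using mat_adjoint_mult[OF Q A'] hQ mat_adjoint_adjoint[OF A] by simp
    then show ?thesis using T(3) Qh mat_adjoint_adjoint[OF A] by simp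
  qed
  have PA: "P * A = A" using S by (simp add: P_def)
  define B where "B = Q * S * P"
  have B: "B \<in> carrier_mat c m" unfolding B_def using Q S P by auto
  have AB: "A * B = P"
  proof -
    have "A * B = A * Q * S * P" unfolding B_def using A Q S(1) P
      by (simp add: assoc_mult_mat[of _ c c _ m _ m] assoc_mult_mat[of _ m c _ c _ m] assoc_mult_mat[of _ m c _ m _ m])
    also have "\<dots> = P * (A * S)" using AQ P_def by simp
    also have "\<dots> = P" using assoc_mult_mat[OF P A S(1)] PA by (simp add: P_def[symmetric])
    finally show ?thesis .
  qed
  have BA: "B * A = Q"
  proof -
    have "B * A = Q * S * (P * A)" unfolding B_def using A Q S P by (intro assoc_mult_mat[of _ c m]) auto
    also have "\<dots> = U * A * S * A" by (simp add: PA Q_def)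
    also have "\<dots> = U * (A * S * A)" using U A S(1)
      by (simp add: assoc_mult_mat[of _ c m _ c _ m] assoc_mult_mat[of _ c m _ m _ c] assoc_mult_mat[of _ m c _ m _ c])
    finally show ?thesis using S by (simp add: Q_def)
  qed
  have QQ: "Q * Q = Q" unfolding Q_def using AQ U A Q by (metis Q_def assoc_mult_mat)
  have "B * A * B = B"
  proof -
    have "Q * B = Q * Q * S * P" unfolding B_def using Q S(1) P
      by (simp add: assoc_mult_mat[of _ c c _ m _ m] assoc_mult_mat[of _ c c _ c _ m])
    then have "Q * B = B" unfolding QQ B_def by simp
    then show ?thesis by (simp add: BA)
  qed
  then have "is_pinv A B"
    unfolding is_pinv_def using A B S hQ by (simp add: AB BA PA P_def[symmetric])
  then show ?thesis by blast
qed

lemma is_pinv_unique: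
  fixes A :: "complex mat"
  assumes "is_pinv A B" "is_pinv A C"
  shows "B = C"
proof -
  obtain m c where A: "A \<in> carrier_mat m c" by blast
  note d = assms[unfolded is_pinv_def]
  have B: "B \<in> carrier_mat c m" and C: "C \<in> carrier_mat c m" using d A by auto
  note a = assoc_mult_mat[of _ m c _ m _ c] assoc_mult_mat[of _ m c _ c _ m] assoc_mult_mat[of _ c m _ c _ m]
    assoc_mult_mat[of _ m c _ m _ m] assoc_mult_mat[of _ c m _ c _ c]
  have "A * B = A * C"
  proof -
    have "A * B = A * C * A * B" using d by simp
    also have "A * C * A * B = (A * C) * (A * B)" using A B C by (simp add: a)
    finally have "mat_adjoint (A * B) = mat_adjoint ((A * C) * (A * B))" by simp
    also have "\<dots> = (A * B) * (A * C)" using A B C d by (subst mat_adjoint_mult[of _ m m _ m]) auto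
    also have "\<dots> = (A * B * A) * C" using A B C by (simp add: a)
    finally show ?thesis using d by simp
  qed
  moreover have "B * A = C * A"
  proof -
    have "B * A = B * (A * C * A)" using d by simp
    also have "\<dots> = (B * A) * (C * A)" using A B C by (simp add: a)
    finally have "mat_adjoint (B * A) = mat_adjoint ((B * A) * (C * A))" by simp
    also have "\<dots> = (C * A) * (B * A)" using A B C d by (subst mat_adjoint_mult[of _ c c _ c]) auto
    also have "\<dots> = C * (A * B * A)" using A B C by (simp add: a)
    finally show ?thesis using d by simp
  qed
  moreover have "B = B * A * B" "C = C * A * C" using d by auto
  moreover have "C * A * B = C * (A * B)" "C * A * C = C * (A * C)"
    using A B C by (auto simp: a)
  ultimately show ?thesis by metis
qed

lemma pinv_eqI: "is_pinv A B \<Longrightarrow> pinv A = B"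
  unfolding pinv_def by (rule the_equality) (auto intro: is_pinv_unique)

lemma is_pinv_pinv: "is_pinv A (pinv A)"
  using is_pinv_exists[of A] pinv_eqI by metis

lemma pinv_carrier [simp]: "A \<in> carrier_mat m c \<Longrightarrow> pinv A \<in> carrier_mat c m"
  using is_pinv_pinv[of A] unfolding is_pinv_def by auto

section \<open>Smith form of a polynomial matrix\<close>

lemma unimodularD:
  assumes "unimodular n E"
  shows "E \<in> carrier_mat n n" "\<exists>c. c \<noteq> 0 \<and> det E = [:c:]"
  using assms unfolding unimodular_def by auto

lemma unimodularI:
  "E \<in> carrier_mat n n \<Longrightarrow> det E = [:c:] \<Longrightarrow> c \<noteq> 0 \<Longrightarrow> unimodular n E"
  unfolding unimodular_def by auto

lemma unimodular_one: "unimodular n (1\<^sub>m n)"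
  by (rule unimodularI[of _ _ 1]) auto

lemma unimodular_mult:
  assumes "unimodular n E" "unimodular n F"
  shows "unimodular n (E * F)"
proof -
  note c = unimodularD(1)[OF assms(1)] unimodularD(1)[OF assms(2)]
  obtain a b where "det E = [:a:]" "a \<noteq> 0" "det F = [:b:]" "b \<noteq> 0"
    using unimodularD(2)[OF assms(1)] unimodularD(2)[OF assms(2)] by auto
  then show ?thesis using c by (intro unimodularI[of _ _ "a * b"]) (auto simp: det_mult[of E n F])
qed

text \<open>The inverse is the adjugate divided by the determinant, which is a nonzero constant.\<close>

lemma unimodular_inverse:
  assumes "unimodular n E"
  obtains E' where "unimodular n E'" "E * E' = 1\<^sub>m n" "E' * E = 1\<^sub>m n"
proof -
  note c = unimodularD(1)[OF assms]
  obtain a where a: "det E = [:a:]" "a \<noteq> 0" using unimodularD(2)[OF assms] by auto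
  define E' where "E' = [:1/a:] \<cdot>\<^sub>m adj_mat E"
  have adj: "adj_mat E \<in> carrier_mat n n" "E * adj_mat E = det E \<cdot>\<^sub>m 1\<^sub>m n"
    "adj_mat E * E = det E \<cdot>\<^sub>m 1\<^sub>m n" using adj_mat[OF c] by auto
  have E': "E' \<in> carrier_mat n n" unfolding E'_def using adj by auto
  have s: "[:1/a:] \<cdot>\<^sub>m ([:a:] \<cdot>\<^sub>m 1\<^sub>m n) = (1\<^sub>m n :: complex poly mat)"
    using a by (intro eq_matI) auto
  have 1: "E * E' = 1\<^sub>m n" unfolding E'_def mult_smult_distrib[OF c adj(1)] adj a by (rule s)
  have 2: "E' * E = 1\<^sub>m n" unfolding E'_def mult_smult_assoc_mat[OF adj(1) c] adj a by (rule s)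
  have "[:a:] * det E' = 1" using det_mult[OF c E'] 1 a by simp
  then have "smult (1/a) (smult a (det E')) = smult (1/a) 1" by simp
  then have "det E' = [:1/a:]" using a by (simp add: one_pCons)
  then have "unimodular n E'" using E' a by (intro unimodularI[of _ _ "1/a"]) auto
  then show ?thesis using that 1 2 by blast
qed

definition cons_block :: "'a :: zero \<Rightarrow> 'a mat \<Rightarrow> 'a mat" where
  "cons_block d M = four_block_mat (mat 1 1 (\<lambda>_. d)) (0\<^sub>m 1 (dim_col M)) (0\<^sub>m (dim_row M) 1) M"

lemma cons_block_carrier [simp]: "M \<in> carrier_mat n m \<Longrightarrow> cons_block d M \<in> carrier_mat (Suc n) (Suc m)"
  unfolding cons_block_def by (auto intro: four_block_carrier_mat)

lemma det_cons_block:
  assumes "(M :: 'a :: idom mat) \<in> carrier_mat n n"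
  shows "det (cons_block d M) = d * det M"
  using assms unfolding cons_block_def
  by (subst det_four_block_mat_lower_left_zero[of _ 1 _ n]) (auto simp: det_single)

lemma cons_block_mult:
  assumes "(M :: 'a :: comm_ring_1 mat) \<in> carrier_mat n m" "N \<in> carrier_mat m l"
  shows "cons_block d M * cons_block e N = cons_block (d * e) (M * N)"
proof -
  have 1: "mat 1 1 (\<lambda>_. d) * mat 1 1 (\<lambda>_. e) = mat 1 1 (\<lambda>_. d * e)"
    by (intro eq_matI) (auto simp: scalar_prod_def)
  show ?thesis
    using assms unfolding cons_block_def
    by (subst mult_four_block_mat[of _ 1 1 _ m _ n]) (auto simp: 1[unfolded One_nat_def] intro!: cong_four_block_mat)
qed

lemma cons_block_mat_diag: "cons_block d (mat_diag n f) = mat_diag (Suc n) (\<lambda>i. case i of 0 \<Rightarrow> d | Suc j \<Rightarrow> f j)"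
  unfolding cons_block_def mat_diag_def
  by (intro eq_matI) (auto split: nat.splits)

lemma unimodular_cons_block: "unimodular n E \<Longrightarrow> unimodular (Suc n) (cons_block 1 E)"
  unfolding unimodular_def by (auto simp: det_cons_block)

definition poly_mat_equiv :: "nat \<Rightarrow> complex poly mat \<Rightarrow> complex poly mat \<Rightarrow> bool" where
  "poly_mat_equiv n M N \<longleftrightarrow> (\<exists>E F. unimodular n E \<and> unimodular n F \<and> M = E * N * F)"

lemma poly_mat_equiv_refl: "M \<in> carrier_mat n n \<Longrightarrow> poly_mat_equiv n M M"
  unfolding poly_mat_equiv_def by (intro exI[of _ "1\<^sub>m n"]) (auto simp: unimodular_one)

lemma poly_mat_equiv_trans:
  assumes "poly_mat_equiv n L M" "poly_mat_equiv n M N" "N \<in> carrier_mat n n"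
  shows "poly_mat_equiv n L N"
proof -
  obtain E F E' F' where e: "unimodular n E" "unimodular n F" "L = E * M * F"
    "unimodular n E'" "unimodular n F'" "M = E' * N * F'"
    using assms unfolding poly_mat_equiv_def by auto
  note c = unimodularD(1)[OF e(1)] unimodularD(1)[OF e(2)] unimodularD(1)[OF e(4)] unimodularD(1)[OF e(5)] assms(3)
  have "L = (E * E') * N * (F' * F)"
    unfolding e(3,6) using c by (simp add: assoc_mult_mat[of _ n n _ n _ n])
  then show ?thesis unfolding poly_mat_equiv_def using e unimodular_mult by blast
qed

lemma poly_mat_equiv_left:
  assumes "unimodular n E" "N \<in> carrier_mat n n"
  shows "poly_mat_equiv n N (E * N)"
proof -
  obtain E' where e: "unimodular n E'" "E' * E = 1\<^sub>m n" using unimodular_inverse[OF assms(1)] by metis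
  note c = unimodularD(1)[OF e(1)] unimodularD(1)[OF assms(1)]
  have "E' * (E * N) * 1\<^sub>m n = N"
    using c assms by (simp add: e(2) flip: assoc_mult_mat[of E' n n E n N n])
  then show ?thesis unfolding poly_mat_equiv_def using e unimodular_one by metis
qed

lemma poly_mat_equiv_right:
  assumes "unimodular n E" "N \<in> carrier_mat n n"
  shows "poly_mat_equiv n N (N * E)"
proof -
  obtain E' where e: "unimodular n E'" "E * E' = 1\<^sub>m n" using unimodular_inverse[OF assms(1)] by metis
  note c = unimodularD(1)[OF e(1)] unimodularD(1)[OF assms(1)]
  have "1\<^sub>m n * (N * E) * E' = N"
    using c assms by (simp add: e(2) assoc_mult_mat[of N n n E n E' n])
  then show ?thesis unfolding poly_mat_equiv_def using e unimodular_one by metis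
qed

lemma unimodular_addrow: "k \<noteq> l \<Longrightarrow> unimodular n (addrow_mat n a k l)"
  by (rule unimodularI[of _ _ 1]) (auto simp: det_addrow_mat)

lemma unimodular_swaprows: "k < n \<Longrightarrow> l < n \<Longrightarrow> unimodular n (swaprows_mat n k l)"
proof (cases "k = l")
  case True
  assume "k < n" "l < n"
  have "swaprows_mat n k k = (1\<^sub>m n :: complex poly mat)"
    by (intro eq_matI) (auto simp: swaprows_mat_def)
  then show ?thesis using True unimodular_one by simp
qed (rule unimodularI[of _ _ "-1"], auto simp: det_swaprows_mat)

lemma dvd_entries_mult:
  fixes M :: "'a :: comm_semiring_1 mat"
  assumes "E \<in> carrier_mat n n" "F \<in> carrier_mat n n" "M \<in> carrier_mat n n"
    and g: "\<And>i j. i < n \<Longrightarrow> j < n \<Longrightarrow> g dvd M $$ (i, j)" and ij: "i < n" "j < n"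
  shows "g dvd (E * M * F) $$ (i, j)"
proof -
  have "g dvd (E * M) $$ (i, l)" if "l < n" for l
    using assms that by (auto simp: scalar_prod_def intro!: dvd_sum dvd_mult)
  moreover have "E * M \<in> carrier_mat n n" using assms by auto
  ultimately show ?thesis using assms(2) ij
    by (subst mult_mat_entry[of _ n n _ n]) (auto simp del: index_mult_mat(1) intro!: dvd_sum dvd_mult2)
qed

text \<open>One elimination step.  A nonzero entry \<open>d\<close> of least degree among all entries of all equivalent matrices
  divides everything: a remainder, produced by a row or column operation, would have smaller degree.\<close>

lemma smith_step:
  assumes M: "M \<in> carrier_mat (Suc n) (Suc n)" and M0: "M \<noteq> 0\<^sub>m (Suc n) (Suc n)"
  obtains d N where "poly_mat_equiv (Suc n) M (cons_block d N)" "N \<in> carrier_mat n n" "lead_coeff d = 1"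
    "\<And>i j. i < n \<Longrightarrow> j < n \<Longrightarrow> d dvd N $$ (i, j)"
proof -
  let ?m = "Suc n"
  define C where "C = {L \<in> carrier_mat ?m ?m. poly_mat_equiv ?m M L}"
  define Q where "Q = (\<lambda>x. \<exists>L i j. L \<in> C \<and> i < ?m \<and> j < ?m \<and> x = L $$ (i, j) \<and> x \<noteq> (0 :: complex poly))"
  have MC: "M \<in> C" using M poly_mat_equiv_refl by (auto simp: C_def)
  have "\<exists>i<?m. \<exists>j<?m. M $$ (i, j) \<noteq> 0"
  proof (rule ccontr)
    assume "\<not> ?thesis"
    then have "M = 0\<^sub>m ?m ?m" using M by (intro eq_matI) auto
    then show False using M0 by simp
  qed
  then have "\<exists>x. Q x" using MC unfolding Q_def by blast
  then obtain d where d: "Q d" and min: "\<And>x. Q x \<Longrightarrow> degree d \<le> degree x"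
    using ex_has_least_nat[of Q _ degree] by blast
  have left: "E * L \<in> C" if "L \<in> C" "unimodular ?m E" for L E
    using that poly_mat_equiv_left[of ?m E L] poly_mat_equiv_trans[of ?m M L "E * L"] unimodularD(1)[of ?m E]
    by (auto simp: C_def)
  have right: "L * E \<in> C" if "L \<in> C" "unimodular ?m E" for L E
    using that poly_mat_equiv_right[of ?m E L] poly_mat_equiv_trans[of ?m M L "L * E"] unimodularD(1)[of ?m E]
    by (auto simp: C_def)
  have addrow: "addrow a k l L \<in> C" if "L \<in> C" "k \<noteq> l" "l < ?m" for a k l L
    using left[OF that(1) unimodular_addrow[OF that(2)]] addrow_mat[of L ?m ?m l a k] that by (auto simp: C_def)
  have addcol: "addcol a l k L \<in> C" if "L \<in> C" "k \<noteq> l" "k < ?m" for a k l L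
    using right[OF that(1) unimodular_addrow[OF that(2)]] addcol_mat[of L ?m ?m k a l] that by (auto simp: C_def)
  obtain L0 i1 j1 where L0: "L0 \<in> C" "i1 < ?m" "j1 < ?m" "d = L0 $$ (i1, j1)" "d \<noteq> 0"
    using d unfolding Q_def by auto
  have L0c: "L0 \<in> carrier_mat ?m ?m" using L0 by (auto simp: C_def)
  define L1 where "L1 = swapcols 0 j1 (swaprows 0 i1 L0)"
  have L1: "L1 \<in> C"
  proof -
    have "swaprows 0 i1 L0 \<in> C"
      using left[OF L0(1) unimodular_swaprows[of 0 ?m i1]] swaprows_mat[OF L0c, of 0 i1] L0 by simp
    then show ?thesis unfolding L1_def
      using right[OF _ unimodular_swaprows[of 0 ?m j1]] swapcols_mat[of "swaprows 0 i1 L0" ?m ?m 0 j1] L0 L0c by simp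
  qed
  have L1d: "L1 $$ (0, 0) = d" unfolding L1_def using L0 L0c by auto
  have col_dvd: "d dvd L $$ (i, 0)" if L: "L \<in> C" "L $$ (0, 0) = d" and i: "i < ?m" "i \<noteq> 0" for L i
  proof (rule ccontr)
    assume nd: "\<not> d dvd L $$ (i, 0)"
    define x where "x = addrow (- (L $$ (i, 0) div d)) i 0 L $$ (i, 0)"
    have "x = L $$ (i, 0) mod d"
      unfolding x_def using L i by (auto simp: C_def minus_mult_div_eq_mod[symmetric] algebra_simps)
    moreover have "L $$ (i, 0) mod d \<noteq> 0" using nd by (simp add: mod_eq_0_iff_dvd)
    ultimately have x: "x \<noteq> 0" "degree x < degree d"
      using degree_mod_less[OF L0(5), of "L $$ (i, 0)"] by auto
    have "Q x" unfolding Q_def using addrow[OF L(1) i(2), of "- (L $$ (i, 0) div d)"] i x(1)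
      by (intro exI[of _ "addrow (- (L $$ (i, 0) div d)) i 0 L"] exI[of _ i] exI[of _ 0]) (auto simp: x_def)
    then show False using min[of x] x by simp
  qed
  have row_dvd: "d dvd L $$ (0, j)" if L: "L \<in> C" "L $$ (0, 0) = d" and j: "j < ?m" "j \<noteq> 0" for L j
  proof (rule ccontr)
    assume nd: "\<not> d dvd L $$ (0, j)"
    define x where "x = addcol (- (L $$ (0, j) div d)) j 0 L $$ (0, j)"
    have "x = L $$ (0, j) mod d"
      unfolding x_def using L j by (auto simp: C_def minus_mult_div_eq_mod[symmetric] algebra_simps)
    moreover have "L $$ (0, j) mod d \<noteq> 0" using nd by (simp add: mod_eq_0_iff_dvd)
    ultimately have x: "x \<noteq> 0" "degree x < degree d"
      using degree_mod_less[OF L0(5), of "L $$ (0, j)"] by auto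
    have "Q x" unfolding Q_def using addcol[OF L(1), of 0 j "- (L $$ (0, j) div d)"] j x(1)
      by (intro exI[of _ "addcol (- (L $$ (0, j) div d)) j 0 L"] exI[of _ 0] exI[of _ j]) (auto simp: x_def)
    then show False using min[of x] x by simp
  qed
  \<comment> \<open>clear the first column and the first row with the quotients by \<open>d\<close>; \<open>d'\<close> is the monic multiple of \<open>d\<close>\<close>
  define q where "q = mat n 1 (\<lambda>(i, _). L1 $$ (Suc i, 0) div d)"
  define s where "s = mat 1 n (\<lambda>(_, j). L1 $$ (0, Suc j) div d)"
  define N where "N = mat n n (\<lambda>(i, j). L1 $$ (Suc i, Suc j) - (q $$ (i, 0)) * d * (s $$ (0, j)))"
  define lc where "lc = lead_coeff d"
  define d' where "d' = smult (1 / lc) d"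
  have lc: "lc \<noteq> 0" using L0 by (simp add: lc_def)
  have dd': "d = [:lc:] * d'" using lc by (simp add: d'_def)
  define E where "E = four_block_mat (mat 1 1 (\<lambda>_. [:lc:])) (0\<^sub>m 1 n) ([:lc:] \<cdot>\<^sub>m q) (1\<^sub>m n)"
  define F where "F = four_block_mat (1\<^sub>m 1) s (0\<^sub>m n 1) (1\<^sub>m n)"
  have q: "q \<in> carrier_mat n 1" and s: "s \<in> carrier_mat 1 n" and N: "N \<in> carrier_mat n n"
    unfolding q_def s_def N_def by auto
  have uE: "unimodular ?m E"
    unfolding E_def using q lc
    by (intro unimodularI[of _ _ lc]) (auto intro!: four_block_carrier_mat[of _ 1 1 _ n n, simplified]
      simp: det_four_block_mat_upper_right_zero[of _ 1 _ n] det_single)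
  have uF: "unimodular ?m F"
    unfolding F_def using s
    by (intro unimodularI[of _ _ 1]) (auto intro!: four_block_carrier_mat[of _ 1 1 _ n n, simplified]
      simp: det_four_block_mat_lower_left_zero[of _ 1 _ n])
  have L1c: "L1 \<in> carrier_mat ?m ?m" using L1 by (auto simp: C_def)
  have EN: "E * cons_block d' N = four_block_mat (mat 1 1 (\<lambda>_. d)) (0\<^sub>m 1 n) (d \<cdot>\<^sub>m q) N"
  proof -
    have "mat 1 1 (\<lambda>_. [:lc:]) * mat 1 1 (\<lambda>_. d') = mat 1 1 (\<lambda>_. d)"
      by (intro eq_matI) (auto simp: scalar_prod_def dd')
    moreover have "[:lc:] \<cdot>\<^sub>m q * mat 1 1 (\<lambda>_. d') = d \<cdot>\<^sub>m q"
      using q by (intro eq_matI) (auto simp: scalar_prod_def dd' algebra_simps)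
    moreover have "dim_row N = n" "dim_col N = n" using N by auto
    ultimately show ?thesis unfolding E_def cons_block_def using q N
      by (subst mult_four_block_mat[of _ 1 1 _ n _ n _ _ 1 _ n]) auto
  qed
  have "E * cons_block d' N * F = four_block_mat (mat 1 1 (\<lambda>_. d)) (mat 1 1 (\<lambda>_. d) * s)
          (d \<cdot>\<^sub>m q) ((d \<cdot>\<^sub>m q) * s + N)"
    unfolding EN F_def using q s N
    by (subst mult_four_block_mat[of _ 1 1 _ n _ n _ _ 1 _ n]) (auto simp: right_mult_one_mat[of _ _ 1])
  also have "\<dots> = L1"
  proof (rule eq_matI)
    fix i j assume "i < dim_row L1" "j < dim_col L1"
    then have ij: "i < ?m" "j < ?m" using L1c by auto
    have dc: "i \<noteq> 0 \<Longrightarrow> d * (L1 $$ (i, 0) div d) = L1 $$ (i, 0)"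
      using col_dvd[OF L1 L1d ij(1)] by simp
    have dr: "j \<noteq> 0 \<Longrightarrow> d * (L1 $$ (0, j) div d) = L1 $$ (0, j)"
      using row_dvd[OF L1 L1d ij(2)] by simp
    show "four_block_mat (mat 1 1 (\<lambda>_. d)) (mat 1 1 (\<lambda>_. d) * s) (d \<cdot>\<^sub>m q) ((d \<cdot>\<^sub>m q) * s + N) $$ (i, j)
        = L1 $$ (i, j)"
      using ij q s N dc dr L1d
      by (cases i; cases j) (auto simp: scalar_prod_def q_def s_def N_def algebra_simps)
  qed (use q s N L1c in auto)
  finally have "poly_mat_equiv ?m L1 (cons_block d' N)"
    unfolding poly_mat_equiv_def using uE uF by metis
  then have eqv: "poly_mat_equiv ?m M (cons_block d' N)"
    using poly_mat_equiv_trans[of ?m M L1] L1 N by (auto simp: C_def)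
  \<comment> \<open>adding row \<open>i + 1\<close> to the first row keeps the corner entry, so it divides row \<open>i\<close> of \<open>N\<close>\<close>
  have "d' dvd N $$ (i, j)" if ij: "i < n" "j < n" for i j
  proof -
    have "cons_block d' N \<in> C" using eqv N by (auto simp: C_def)
    then have KC: "multrow_mat ?m 0 [:lc:] * cons_block d' N \<in> C"
      using lc by (intro left unimodularI[of _ _ lc]) (auto simp: det_multrow_mat)
    define K where "K = multrow 0 [:lc:] (cons_block d' N)"
    have cb: "cons_block d' N \<in> carrier_mat ?m ?m" using N by simp
    have K: "K \<in> C" using KC multrow_mat[OF cb, of 0 "[:lc:]"] unfolding K_def by simp
    define J where "J = addrow 1 0 (Suc i) K"
    have J: "J \<in> C" unfolding J_def using ij by (intro addrow[OF K]) auto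
    have "J $$ (0, 0) = d" "J $$ (0, Suc j) = N $$ (i, j)"
      unfolding J_def K_def using ij N dd' by (auto simp: cons_block_def)
    then have "d dvd N $$ (i, j)" using row_dvd[OF J, of "Suc j"] ij by simp
    then show ?thesis using lc by (simp add: d'_def smult_dvd_iff)
  qed
  moreover have "lead_coeff d' = 1" using lc by (simp add: d'_def lc_def)
  ultimately show ?thesis using that eqv N by blast
qed

lemma poly_mat_equiv_cons_block:
  assumes "poly_mat_equiv n M N" "N \<in> carrier_mat n n"
  shows "poly_mat_equiv (Suc n) (cons_block d M) (cons_block d N)"
proof -
  obtain E F where e: "unimodular n E" "unimodular n F" "M = E * N * F"
    using assms unfolding poly_mat_equiv_def by auto
  note c = unimodularD(1)[OF e(1)] unimodularD(1)[OF e(2)] assms(2)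
  have "cons_block d M = cons_block 1 E * cons_block d N * cons_block 1 F"
    using c by (simp add: cons_block_mult[of _ n n _ n] e(3))
  then show ?thesis unfolding poly_mat_equiv_def using e unimodular_cons_block by blast
qed

text \<open>The clause on common divisors \<open>g\<close> makes the induction produce a divisibility chain: the corner entry
  divides all entries of the remaining block, hence all its later diagonal entries.\<close>

lemma smith_diag_exists:
  assumes "M \<in> carrier_mat n n"
  shows "\<exists>ds. length ds \<le> n \<and> (\<forall>d \<in> set ds. lead_coeff d = 1) \<and>
     (\<forall>i. Suc i < length ds \<longrightarrow> ds ! i dvd ds ! Suc i) \<and>
     (\<forall>g. (\<forall>i<n. \<forall>j<n. g dvd M $$ (i, j)) \<longrightarrow> (\<forall>d \<in> set ds. g dvd d)) \<and>
     poly_mat_equiv n M (mat_diag n (\<lambda>i. if i < length ds then ds ! i else 0))"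
  using assms
proof (induction n arbitrary: M)
  case 0
  then have "M = mat_diag 0 (\<lambda>i. if i < length [] then [] ! i else 0)"
    by (intro eq_matI) (auto simp: mat_diag_def)
  then show ?case using poly_mat_equiv_refl[OF 0] by (intro exI[of _ "[]"]) auto
next
  case (Suc n)
  show ?case
  proof (cases "M = 0\<^sub>m (Suc n) (Suc n)")
    case True
    then have "M = mat_diag (Suc n) (\<lambda>i. if i < length [] then [] ! i else 0)"
      by (intro eq_matI) (auto simp: mat_diag_def)
    then show ?thesis using poly_mat_equiv_refl[OF Suc.prems] by (intro exI[of _ "[]"]) auto
  next
    case False
    obtain d N where dN: "poly_mat_equiv (Suc n) M (cons_block d N)" and N: "N \<in> carrier_mat n n"
      and d1: "lead_coeff d = 1" and dvdN: "\<And>i j. i < n \<Longrightarrow> j < n \<Longrightarrow> d dvd N $$ (i, j)"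
      using smith_step[OF Suc.prems False] by metis
    obtain ds where ds: "length ds \<le> n" "\<forall>d \<in> set ds. lead_coeff d = 1"
      "\<forall>i. Suc i < length ds \<longrightarrow> ds ! i dvd ds ! Suc i"
      "\<forall>g. (\<forall>i<n. \<forall>j<n. g dvd N $$ (i, j)) \<longrightarrow> (\<forall>d \<in> set ds. g dvd d)"
      "poly_mat_equiv n N (mat_diag n (\<lambda>i. if i < length ds then ds ! i else 0))"
      using Suc.IH[OF N] by blast
    have dds: "\<forall>e \<in> set ds. d dvd e" using ds(4) dvdN by blast
    have eqv: "poly_mat_equiv (Suc n) M (mat_diag (Suc n) (\<lambda>i. if i < length (d # ds) then (d # ds) ! i else 0))"
    proof -
      have "cons_block d (mat_diag n (\<lambda>i. if i < length ds then ds ! i else 0))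
        = mat_diag (Suc n) (\<lambda>i. if i < length (d # ds) then (d # ds) ! i else 0)"
        unfolding cons_block_mat_diag by (auto simp: mat_diag_def split: nat.splits intro!: eq_matI)
      then show ?thesis
        using poly_mat_equiv_trans[OF dN poly_mat_equiv_cons_block[OF ds(5)]] by simp
    qed
    have gd: "g dvd e" if g: "\<forall>i<Suc n. \<forall>j<Suc n. g dvd M $$ (i, j)" and e: "e \<in> set (d # ds)" for g e
    proof -
      obtain E F where u: "unimodular (Suc n) E" "unimodular (Suc n) F" "M = E * cons_block d N * F"
        using dN unfolding poly_mat_equiv_def by auto
      obtain E' where E': "unimodular (Suc n) E'" "E' * E = 1\<^sub>m (Suc n)" using unimodular_inverse[OF u(1)] by metis
      obtain F' where F': "unimodular (Suc n) F'" "F * F' = 1\<^sub>m (Suc n)" using unimodular_inverse[OF u(2)] by metis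
      note c = unimodularD(1)[OF u(1)] unimodularD(1)[OF u(2)] unimodularD(1)[OF E'(1)] unimodularD(1)[OF F'(1)]
      have cb: "cons_block d N \<in> carrier_mat (Suc n) (Suc n)" using N by simp
      have "E' * M * F' = (E' * E) * cons_block d N * (F * F')"
        unfolding u(3) using c cb by (simp add: assoc_mult_mat[of _ "Suc n" "Suc n" _ "Suc n" _ "Suc n"])
      also have "\<dots> = cons_block d N" using E' F' cb by simp
      finally have "g dvd cons_block d N $$ (0, 0)"
        using dvd_entries_mult[OF c(3,4) Suc.prems, of g 0 0] g by simp
      then have "g dvd d" by (simp add: cons_block_def)
      then show ?thesis using e dds dvd_trans by auto
    qed
    have ch: "\<forall>i. Suc i < length (d # ds) \<longrightarrow> (d # ds) ! i dvd (d # ds) ! Suc i"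
      using ds(3) dds by (auto simp: nth_Cons split: nat.splits)
    show ?thesis
      using ds(1,2) d1 eqv gd ch by (intro exI[of _ "d # ds"]) auto
  qed
qed

theorem smith_form_exists:
  assumes "M \<in> carrier_mat n n"
  shows "\<exists>ds. smith_form M ds"
  using smith_diag_exists[OF assms] assms unfolding smith_form_def poly_mat_equiv_def by auto

section \<open>Singular pencils as limits of pencils with a single Jordan block\<close>

lemma mat_inverse_obtain:
  fixes U :: "complex mat"
  assumes U: "U \<in> carrier_mat n n" and d: "det U \<noteq> 0"
  obtains V where "V \<in> carrier_mat n n" "U * V = 1\<^sub>m n" "V * U = 1\<^sub>m n" "det V \<noteq> 0"
proof -
  define V where "V = (1 / det U) \<cdot>\<^sub>m adj_mat U"
  note adj = adj_mat[OF U]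
  have V: "V \<in> carrier_mat n n" unfolding V_def using adj by auto
  have s: "(1 / det U) \<cdot>\<^sub>m (det U \<cdot>\<^sub>m 1\<^sub>m n) = 1\<^sub>m n" using d by (intro eq_matI) auto
  have 1: "U * V = 1\<^sub>m n" unfolding V_def mult_smult_distrib[OF U adj(1)] adj by (rule s)
  have 2: "V * U = 1\<^sub>m n" unfolding V_def mult_smult_assoc_mat[OF adj(1) U] adj by (rule s)
  have "det U * det V = 1" using det_mult[OF U V] 1 by simp
  then have "det V \<noteq> 0" by auto
  with that V 1 2 show ?thesis by blast
qed

lemma mult_vec_eq_0_imp:
  fixes U :: "complex mat"
  assumes "U \<in> carrier_mat n n" "det U \<noteq> 0" "v \<in> carrier_vec n" "U *\<^sub>v v = 0\<^sub>v n"
  shows "v = 0\<^sub>v n"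
  using assms det_0_iff_vec_prod_zero[OF assms(1)] by auto

lemma vec_eq_0I: "v \<in> carrier_vec n \<Longrightarrow> (\<And>i. i < n \<Longrightarrow> v $ i = 0) \<Longrightarrow> v = 0\<^sub>v n"
  by (intro eq_vecI) auto

lemma det_nonzeroI:
  fixes A :: "complex mat"
  assumes "A \<in> carrier_mat n n" "\<And>x. x \<in> carrier_vec n \<Longrightarrow> A *\<^sub>v x = 0\<^sub>v n \<Longrightarrow> x = 0\<^sub>v n"
  shows "det A \<noteq> 0"
  using assms det_0_iff_vec_prod_zero[OF assms(1)] by blast

lemma kernel_vectorE:
  fixes A :: "complex mat"
  assumes "A \<in> carrier_mat n n" "det A = 0"
  obtains x where "x \<in> carrier_vec n" "x \<noteq> 0\<^sub>v n" "A *\<^sub>v x = 0\<^sub>v n"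
  using assms det_0_iff_vec_prod_zero[OF assms(1)] by auto

lemma poly_eq_0_off_0:
  fixes p :: "complex poly"
  assumes "\<And>t. t \<noteq> 0 \<Longrightarrow> poly p t = 0"
  shows "p = 0"
proof (rule ccontr)
  assume "p \<noteq> 0"
  then have "finite {t. poly p t = 0}" by (rule poly_roots_finite)
  moreover have "UNIV - {0} \<subseteq> {t. poly p t = 0}" using assms by auto
  ultimately have "finite (UNIV - {0} :: complex set)" using finite_subset by blast
  then show False using infinite_UNIV_char_0[where ?'a = complex] by simp
qed

text \<open>If \<open>v\<^sub>i \<noteq> 0\<close>, column \<open>i\<close> of the identity matrix can be replaced by \<open>v\<close>; then it is swapped to the
  front.\<close>

lemma matrix_with_first_column:
  fixes v :: "complex vec"
  assumes v: "v \<in> carrier_vec (Suc n)" and v0: "v \<noteq> 0\<^sub>v (Suc n)"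
  obtains V where "V \<in> carrier_mat (Suc n) (Suc n)" "det V \<noteq> 0" "col V 0 = v"
proof -
  let ?N = "Suc n"
  obtain i where i: "i < ?N" "v $ i \<noteq> 0" using vec_eq_0I[OF v] v0 by blast
  define T where "T = mat ?N ?N (\<lambda>(a, b). if b = i then v $ a else if a = b then 1 else (0::complex))"
  have T: "T \<in> carrier_mat ?N ?N" unfolding T_def by auto
  have "det T \<noteq> 0"
  proof (rule det_nonzeroI[OF T], rule vec_eq_0I)
    fix x a assume x: "x \<in> carrier_vec ?N" "T *\<^sub>v x = 0\<^sub>v ?N" and a: "a < ?N"
    have e: "(\<Sum>b<?N. T $$ (a, b) * x $ b) = 0" if "a < ?N" for a
      using mult_mat_vec_entry[OF T x(1) that] x(2) that by simp
    have "(\<Sum>b<?N. T $$ (i, b) * x $ b) = (\<Sum>b<?N. if b = i then v $ i * x $ i else 0)"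
      using i by (intro sum.cong) (auto simp: T_def)
    then have xi: "x $ i = 0" using e[OF i(1)] i by (simp add: sum.delta del: sum.lessThan_Suc)
    show "x $ a = 0"
    proof (cases "a = i")
      case False
      have "(\<Sum>b<?N. T $$ (a, b) * x $ b) = (\<Sum>b<?N. if b = a then x $ a else 0)"
        using i a False xi by (intro sum.cong) (auto simp: T_def)
      then show ?thesis using e[OF a] a by (simp add: sum.delta del: sum.lessThan_Suc)
    qed (use xi in auto)
  qed
  define V where "V = swapcols 0 i T"
  have V: "V = T * swaprows_mat ?N 0 i" unfolding V_def using swapcols_mat[OF T, of 0 i] i by simp
  have "det (swaprows_mat ?N 0 i :: complex mat) \<noteq> 0"
  proof (cases "i = 0")
    case True
    then have "swaprows_mat ?N 0 i = (1\<^sub>m ?N :: complex mat)"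
      by (intro eq_matI) (auto simp: swaprows_mat_def)
    then show ?thesis by simp
  qed (use i in \<open>auto simp: det_swaprows_mat\<close>)
  then have "det V \<noteq> 0" unfolding V using \<open>det T \<noteq> 0\<close> by (subst det_mult[OF T]) auto
  moreover have "V \<in> carrier_mat ?N ?N" unfolding V using T by auto
  moreover have "col V 0 = v"
    unfolding V_def using i v T by (intro eq_vecI) (auto simp: T_def)
  ultimately show ?thesis using that by blast
qed

definition pencil :: "complex mat \<Rightarrow> complex mat \<Rightarrow> complex \<Rightarrow> complex \<Rightarrow> complex mat" where
  "pencil A B \<alpha> \<beta> = \<alpha> \<cdot>\<^sub>m A + \<beta> \<cdot>\<^sub>m B"

lemma pencil_carrier [simp]:
  "A \<in> carrier_mat n m \<Longrightarrow> B \<in> carrier_mat n m \<Longrightarrow> pencil A B \<alpha> \<beta> \<in> carrier_mat n m"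
  by (simp add: pencil_def)

lemma pencil_entry:
  assumes "A \<in> carrier_mat n m" "B \<in> carrier_mat n m" "i < n" "j < m"
  shows "pencil A B \<alpha> \<beta> $$ (i, j) = \<alpha> * A $$ (i, j) + \<beta> * B $$ (i, j)"
  using assms by (simp add: pencil_def)

lemma pencil_1_0: "A \<in> carrier_mat n m \<Longrightarrow> B \<in> carrier_mat n m \<Longrightarrow> pencil A B 1 0 = A"
  by (intro eq_matI) (auto simp: pencil_def)

lemma pencil_transpose:
  "A \<in> carrier_mat n m \<Longrightarrow> B \<in> carrier_mat n m \<Longrightarrow> pencil (A\<^sup>T) (B\<^sup>T) \<alpha> \<beta> = (pencil A B \<alpha> \<beta>)\<^sup>T"
  by (intro eq_matI) (auto simp: pencil_def)

text \<open>The homogeneous parameters include \<open>\<alpha> = 0\<close>: the matrix \<open>B\<close> is invertible and \<open>B\<inverse> A\<close> is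
  nilpotent.  The kernel of \<open>A\<close> is at most one-dimensional, so \<open>B\<inverse> A\<close> consists of a single Jordan block.
  The last condition is expressed by a linear functional that is injective on the kernel, because such a
  functional can be followed through the constructions below.\<close>

definition single_block :: "nat \<Rightarrow> complex mat \<Rightarrow> complex mat \<Rightarrow> bool" where
  "single_block N A B \<longleftrightarrow> A \<in> carrier_mat N N \<and> B \<in> carrier_mat N N \<and>
     (\<forall>\<alpha> \<beta>. \<beta> \<noteq> 0 \<longrightarrow> det (pencil A B \<alpha> \<beta>) \<noteq> 0) \<and>
     (\<exists>w \<in> carrier_vec N. \<forall>v \<in> carrier_vec N. A *\<^sub>v v = 0\<^sub>v N \<and> w \<bullet> v = 0 \<longrightarrow> v = 0\<^sub>v N)"

definition single_block_limit :: "nat \<Rightarrow> complex mat \<Rightarrow> complex mat \<Rightarrow> bool" where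
  "single_block_limit N A B \<longleftrightarrow> (\<forall>e>0. \<exists>A' B'. single_block N A' B' \<and>
     mat_l1 (A' - A) < e \<and> mat_l1 (B' - B) < e)"

lemma single_blockD:
  assumes "single_block N A B"
  shows "A \<in> carrier_mat N N" "B \<in> carrier_mat N N" "\<And>\<alpha> \<beta>. \<beta> \<noteq> 0 \<Longrightarrow> det (pencil A B \<alpha> \<beta>) \<noteq> 0"
    "\<exists>w \<in> carrier_vec N. \<forall>v \<in> carrier_vec N. A *\<^sub>v v = 0\<^sub>v N \<and> w \<bullet> v = 0 \<longrightarrow> v = 0\<^sub>v N"
  using assms unfolding single_block_def by auto

lemma mat_l1_transpose: "mat_l1 (A\<^sup>T) = mat_l1 A"
  unfolding mat_l1_def by (subst sum.swap) (auto intro!: sum.cong)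

lemma mat_l1_smult: "mat_l1 (d \<cdot>\<^sub>m R) = cmod d * mat_l1 R"
  by (simp add: mat_l1_def norm_mult sum_distrib_left)

lemma scalar_prod_transpose:
  fixes A :: "complex mat"
  assumes "A \<in> carrier_mat n m" "x \<in> carrier_vec m" "y \<in> carrier_vec n"
  shows "(A\<^sup>T *\<^sub>v y) \<bullet> x = y \<bullet> (A *\<^sub>v x)"
  using transpose_vec_mult_scalar[OF assms] by simp

lemma pencil_mult:
  fixes A B U V :: "complex mat"
  assumes "A \<in> carrier_mat n n" "B \<in> carrier_mat n n" "U \<in> carrier_mat n n" "V \<in> carrier_mat n n"
  shows "pencil (U * A * V) (U * B * V) \<alpha> \<beta> = U * pencil A B \<alpha> \<beta> * V"
proof -
  have c: "U * A \<in> carrier_mat n n" "U * B \<in> carrier_mat n n" "\<alpha> \<cdot>\<^sub>m A \<in> carrier_mat n n" "\<beta> \<cdot>\<^sub>m B \<in> carrier_mat n n"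
    using assms by auto
  have "U * pencil A B \<alpha> \<beta> * V = (\<alpha> \<cdot>\<^sub>m (U * A) + \<beta> \<cdot>\<^sub>m (U * B)) * V"
    unfolding pencil_def mult_add_distrib_mat[OF assms(3) c(3,4)]
      mult_smult_distrib[OF assms(3,1)] mult_smult_distrib[OF assms(3,2)] ..
  also have "\<dots> = pencil (U * A * V) (U * B * V) \<alpha> \<beta>"
    unfolding pencil_def using assms c
    by (subst add_mult_distrib_mat[of _ n n]) (auto simp: mult_smult_assoc_mat[of "U * A" n n] mult_smult_assoc_mat[of "U * B" n n])
  finally show ?thesis by simp
qed

lemma single_block_equivalence:
  assumes g: "single_block n A B" and U: "U \<in> carrier_mat n n" "det U \<noteq> 0" and V: "V \<in> carrier_mat n n" "det V \<noteq> 0"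
  shows "single_block n (U * A * V) (U * B * V)"
proof -
  note d = single_blockD[OF g]
  obtain w where w: "w \<in> carrier_vec n" "\<And>v. v \<in> carrier_vec n \<Longrightarrow> A *\<^sub>v v = 0\<^sub>v n \<Longrightarrow> w \<bullet> v = 0 \<Longrightarrow> v = 0\<^sub>v n"
    using d(4) by blast
  have det3: "det (U * X * V) = det U * det X * det V" if "X \<in> carrier_mat n n" for X
    using that U V by (simp add: det_mult[of _ n])
  have "v = 0\<^sub>v n" if v: "v \<in> carrier_vec n" and z: "U * A * V *\<^sub>v v = 0\<^sub>v n" "(V\<^sup>T *\<^sub>v w) \<bullet> v = 0" for v
  proof -
    have Vv: "V *\<^sub>v v \<in> carrier_vec n" using V v by auto
    have AV: "A *\<^sub>v (V *\<^sub>v v) \<in> carrier_vec n" using d Vv by auto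
    have "U * A * V *\<^sub>v v = U *\<^sub>v (A *\<^sub>v (V *\<^sub>v v))"
      using U V d v Vv by (simp add: assoc_mult_mat_vec[of _ n n _ n])
    then have "A *\<^sub>v (V *\<^sub>v v) = 0\<^sub>v n" using mult_vec_eq_0_imp[OF U AV] z by simp
    moreover have "w \<bullet> (V *\<^sub>v v) = 0" using scalar_prod_transpose[OF V(1) v w(1)] z by simp
    ultimately have "V *\<^sub>v v = 0\<^sub>v n" using w(2)[OF Vv] by simp
    then show ?thesis using mult_vec_eq_0_imp[OF V v] by simp
  qed
  moreover have "V\<^sup>T *\<^sub>v w \<in> carrier_vec n" using V w by auto
  ultimately have "\<exists>w \<in> carrier_vec n. \<forall>v \<in> carrier_vec n. U * A * V *\<^sub>v v = 0\<^sub>v n \<and> w \<bullet> v = 0 \<longrightarrow> v = 0\<^sub>v n"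
    by blast
  moreover have "det (pencil (U * A * V) (U * B * V) \<alpha> \<beta>) \<noteq> 0" if "\<beta> \<noteq> 0" for \<alpha> \<beta>
    unfolding pencil_mult[OF d(1,2) U(1) V(1)] using d that U V by (subst det3) auto
  moreover have "U * A * V \<in> carrier_mat n n" "U * B * V \<in> carrier_mat n n" using U V d by auto
  ultimately show ?thesis unfolding single_block_def by blast
qed

lemma mat_l1_sandwich:
  assumes "U \<in> carrier_mat n n" "V \<in> carrier_mat n n" "A \<in> carrier_mat n n" "B \<in> carrier_mat n n"
  shows "mat_l1 (U * A * V - U * B * V) \<le> mat_l1 U * mat_l1 V * mat_l1 (A - B)"
proof -
  have c: "A - B \<in> carrier_mat n n" "U * (A - B) \<in> carrier_mat n n" "U * A \<in> carrier_mat n n" "U * B \<in> carrier_mat n n"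
    using assms by auto
  have "U * A * V - U * B * V = U * (A - B) * V"
    using assms c by (simp add: mult_minus_distrib_mat[of U n n] minus_mult_distrib_mat[of _ n n])
  also have "mat_l1 \<dots> \<le> mat_l1 (U * (A - B)) * mat_l1 V" by (rule mat_l1_mult[OF c(2) assms(2)])
  also have "\<dots> \<le> mat_l1 U * mat_l1 (A - B) * mat_l1 V"
    by (intro mult_right_mono mat_l1_mult[OF assms(1) c(1)] mat_l1_nonneg)
  finally show ?thesis by (simp add: mult_ac)
qed

lemma single_block_limit_equivalence:
  assumes g: "single_block_limit n A B" and A: "A \<in> carrier_mat n n" and B: "B \<in> carrier_mat n n"
    and U: "U \<in> carrier_mat n n" "det U \<noteq> 0" and V: "V \<in> carrier_mat n n" "det V \<noteq> 0"
  shows "single_block_limit n (U * A * V) (U * B * V)"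
  unfolding single_block_limit_def
proof (intro allI impI)
  fix e :: real assume e: "e > 0"
  define c where "c = mat_l1 U * mat_l1 V + 1"
  have "0 \<le> mat_l1 U * mat_l1 V" by (intro mult_nonneg_nonneg mat_l1_nonneg)
  then have c: "c > 0" "mat_l1 U * mat_l1 V \<le> c" unfolding c_def by auto
  obtain A' B' where g': "single_block n A' B'" "mat_l1 (A' - A) < e / c" "mat_l1 (B' - B) < e / c"
    using g e c unfolding single_block_limit_def by (meson divide_pos_pos)
  note d = single_blockD[OF g'(1)]
  have small: "mat_l1 (U * X' * V - U * X * V) < e"
    if "X' \<in> carrier_mat n n" "X \<in> carrier_mat n n" "mat_l1 (X' - X) < e / c" for X X'
  proof -
    have "mat_l1 (U * X' * V - U * X * V) \<le> mat_l1 U * mat_l1 V * mat_l1 (X' - X)"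
      by (rule mat_l1_sandwich[OF U(1) V(1) that(1,2)])
    also have "\<dots> \<le> c * mat_l1 (X' - X)" by (intro mult_right_mono c mat_l1_nonneg)
    also have "\<dots> < c * (e / c)" using that c by (intro mult_strict_left_mono)
    finally show ?thesis using c by simp
  qed
  show "\<exists>A' B'. single_block n A' B' \<and> mat_l1 (A' - U * A * V) < e \<and> mat_l1 (B' - U * B * V) < e"
    using single_block_equivalence[OF g'(1) U V] small[OF d(1) A g'(2)] small[OF d(2) B g'(3)] by blast
qed

lemma smult_mat_mult_vec:
  fixes M :: "complex mat"
  assumes "M \<in> carrier_mat n m" "v \<in> carrier_vec m"
  shows "(d \<cdot>\<^sub>m M) *\<^sub>v v = d \<cdot>\<^sub>v (M *\<^sub>v v)"
  using assms by (auto intro!: eq_vecI sum.cong simp: scalar_prod_def sum_distrib_left mult.assoc)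

lemma rank_one_mult_vec:
  fixes u w x :: "complex vec"
  assumes "u \<in> carrier_vec n" "w \<in> carrier_vec n" "x \<in> carrier_vec n"
  shows "mat n n (\<lambda>(i, j). u $ i * w $ j) *\<^sub>v x = (w \<bullet> x) \<cdot>\<^sub>v u"
    "(mat n n (\<lambda>(i, j). u $ i * w $ j))\<^sup>T *\<^sub>v x = (u \<bullet> x) \<cdot>\<^sub>v w"
  using assms by (auto intro!: eq_vecI sum.cong simp: scalar_prod_def sum_distrib_right)

text \<open>The kernel condition is symmetric because it means that some matrix of rank one makes \<open>A\<close> invertible
  when added to it.\<close>

lemma single_block_transpose:
  assumes g: "single_block n A B"
  shows "single_block n (A\<^sup>T) (B\<^sup>T)"
proof -
  note d = single_blockD[OF g]
  have At: "A\<^sup>T \<in> carrier_mat n n" using d by auto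
  obtain w where w: "w \<in> carrier_vec n" "\<And>v. v \<in> carrier_vec n \<Longrightarrow> A *\<^sub>v v = 0\<^sub>v n \<Longrightarrow> w \<bullet> v = 0 \<Longrightarrow> v = 0\<^sub>v n"
    using d(4) by blast
  have "\<exists>u \<in> carrier_vec n. \<forall>v \<in> carrier_vec n. A\<^sup>T *\<^sub>v v = 0\<^sub>v n \<and> u \<bullet> v = 0 \<longrightarrow> v = 0\<^sub>v n"
  proof (cases "det A = 0")
    case False
    then have "det (A\<^sup>T) \<noteq> 0" using det_transpose[OF d(1)] by simp
    then show ?thesis using mult_vec_eq_0_imp[OF At] by (intro bexI[of _ "0\<^sub>v n"]) auto
  next
    case True
    then have "det (A\<^sup>T) = 0" using det_transpose[OF d(1)] by simp
    then obtain y where y: "y \<in> carrier_vec n" "y \<noteq> 0\<^sub>v n" "A\<^sup>T *\<^sub>v y = 0\<^sub>v n"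
      using kernel_vectorE[OF At] by blast
    \<comment> \<open>the correction \<open>u w\<^sup>T\<close> makes \<open>A\<close> invertible: applying \<open>y\<^sup>T\<close> to \<open>(A + u w\<^sup>T) x = 0\<close> gives \<open>w\<^sup>T x = 0\<close>\<close>
    define u where "u = conjugate y"
    have u: "u \<in> carrier_vec n" using y by (simp add: u_def)
    have yu: "y \<bullet> u \<noteq> 0" using y by (simp add: u_def)
    define R where "R = mat n n (\<lambda>(i, j). u $ i * w $ j)"
    have R: "R \<in> carrier_mat n n" by (simp add: R_def)
    have Rx: "R *\<^sub>v x = (w \<bullet> x) \<cdot>\<^sub>v u" if "x \<in> carrier_vec n" for x
      unfolding R_def by (rule rank_one_mult_vec(1)[OF u w(1) that])
    have Rtx: "R\<^sup>T *\<^sub>v x = (u \<bullet> x) \<cdot>\<^sub>v w" if "x \<in> carrier_vec n" for x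
      unfolding R_def by (rule rank_one_mult_vec(2)[OF u w(1) that])
    have K: "A + R \<in> carrier_mat n n" using R by auto
    have "det (A + R) \<noteq> 0"
    proof (rule det_nonzeroI[OF K])
      fix x assume x: "x \<in> carrier_vec n" "(A + R) *\<^sub>v x = 0\<^sub>v n"
      have Ax: "A *\<^sub>v x \<in> carrier_vec n" using d x by auto
      have e: "A *\<^sub>v x + (w \<bullet> x) \<cdot>\<^sub>v u = 0\<^sub>v n"
        using add_mult_distrib_mat_vec[OF d(1) R x(1)] x Rx by simp
      have "y \<bullet> (A *\<^sub>v x) = 0" using scalar_prod_transpose[OF d(1) x(1) y(1)] y(3) x(1) by simp
      moreover have "y \<bullet> (A *\<^sub>v x + (w \<bullet> x) \<cdot>\<^sub>v u) = y \<bullet> (A *\<^sub>v x) + (w \<bullet> x) * (y \<bullet> u)"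
        using y u Ax by (simp add: scalar_prod_add_distrib[of _ n])
      ultimately have "w \<bullet> x = 0" using e yu y by simp
      moreover have "A *\<^sub>v x = 0\<^sub>v n"
      proof (rule eq_vecI)
        fix i assume "i < dim_vec (0\<^sub>v n :: complex vec)"
        then have "i < n" by simp
        then have "(A *\<^sub>v x + (w \<bullet> x) \<cdot>\<^sub>v u) $ i = (A *\<^sub>v x) $ i" using \<open>w \<bullet> x = 0\<close> u Ax by simp
        then show "(A *\<^sub>v x) $ i = 0\<^sub>v n $ i" using e by simp
      qed (use Ax d(1) in auto)
      ultimately show "x = 0\<^sub>v n" using w(2)[OF x(1)] by simp
    qed
    then have Kt: "det ((A + R)\<^sup>T) \<noteq> 0" using det_transpose[OF K] by simp
    have "v = 0\<^sub>v n" if v: "v \<in> carrier_vec n" "A\<^sup>T *\<^sub>v v = 0\<^sub>v n" "u \<bullet> v = 0" for v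
    proof -
      have "(A + R)\<^sup>T = A\<^sup>T + R\<^sup>T" using d R by (intro transpose_add) auto
      then have "(A + R)\<^sup>T *\<^sub>v v = A\<^sup>T *\<^sub>v v + R\<^sup>T *\<^sub>v v"
        using d R v by (simp add: add_mult_distrib_mat_vec[of _ n n])
      also have "\<dots> = 0\<^sub>v n" using Rtx[OF v(1)] v w by (intro eq_vecI) auto
      finally show ?thesis using mult_vec_eq_0_imp[of "(A + R)\<^sup>T" n v] Kt K v by simp
    qed
    then show ?thesis using u by blast
  qed
  moreover have "det (pencil (A\<^sup>T) (B\<^sup>T) \<alpha> \<beta>) \<noteq> 0" if "\<beta> \<noteq> 0" for \<alpha> \<beta>
    unfolding pencil_transpose[OF d(1,2)] using det_transpose[of "pencil A B \<alpha> \<beta>" n] d(3)[OF that] d(1,2) by simp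
  ultimately show ?thesis using d by (auto simp: single_block_def)
qed

lemma single_block_limit_transpose:
  assumes "single_block_limit n (A\<^sup>T) (B\<^sup>T)" "A \<in> carrier_mat n n" "B \<in> carrier_mat n n"
  shows "single_block_limit n A B"
  unfolding single_block_limit_def
proof (intro allI impI)
  fix e :: real assume "e > 0"
  then obtain A' B' where g: "single_block n A' B'" "mat_l1 (A' - A\<^sup>T) < e" "mat_l1 (B' - B\<^sup>T) < e"
    using assms(1) unfolding single_block_limit_def by blast
  note d = single_blockD[OF g(1)]
  have "A'\<^sup>T - A = (A' - A\<^sup>T)\<^sup>T" "B'\<^sup>T - B = (B' - B\<^sup>T)\<^sup>T" using assms d by (auto intro!: eq_matI)
  then show "\<exists>A' B'. single_block n A' B' \<and> mat_l1 (A' - A) < e \<and> mat_l1 (B' - B) < e"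
    using single_block_transpose[OF g(1)] g(2,3) mat_l1_transpose by metis
qed

lemma single_block_limit_closed:
  assumes "A \<in> carrier_mat n n" "B \<in> carrier_mat n n"
    and "\<And>e. e > 0 \<Longrightarrow> \<exists>B1 \<in> carrier_mat n n. single_block_limit n A B1 \<and> mat_l1 (B1 - B) < e"
  shows "single_block_limit n A B"
  unfolding single_block_limit_def
proof (intro allI impI)
  fix e :: real assume e: "e > 0"
  obtain B1 where B1: "B1 \<in> carrier_mat n n" "single_block_limit n A B1" "mat_l1 (B1 - B) < e / 2"
    using assms(3)[of "e / 2"] e by auto
  obtain A' B' where g: "single_block n A' B'" "mat_l1 (A' - A) < e / 2" "mat_l1 (B' - B1) < e / 2"
    using B1(2) e unfolding single_block_limit_def by (meson half_gt_zero)
  note d = single_blockD[OF g(1)]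
  have "B' - B = (B' - B1) + (B1 - B)" using d B1 assms by (intro eq_matI) auto
  then have "mat_l1 (B' - B) \<le> mat_l1 (B' - B1) + mat_l1 (B1 - B)"
    using mat_l1_add[OF minus_carrier_mat[OF B1(1), of B'] minus_carrier_mat[OF assms(2), of B1]] by simp
  then show "\<exists>A' B'. single_block n A' B' \<and> mat_l1 (A' - A) < e \<and> mat_l1 (B' - B) < e"
    using g B1 e by (intro exI[of _ A'] exI[of _ B']) auto
qed

definition corner_block :: "complex \<Rightarrow> complex vec \<Rightarrow> complex mat \<Rightarrow> complex mat" where
  "corner_block c r M = four_block_mat (mat 1 1 (\<lambda>_. c)) (mat 1 (dim_vec r) (\<lambda>(_, j). r $ j))
     (0\<^sub>m (dim_row M) 1) M"

lemma corner_block_carrier [simp]: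
  "r \<in> carrier_vec n \<Longrightarrow> M \<in> carrier_mat n n \<Longrightarrow> corner_block c r M \<in> carrier_mat (Suc n) (Suc n)"
  unfolding corner_block_def by (auto intro: four_block_carrier_mat)

lemma corner_block_entry:
  assumes "r \<in> carrier_vec n" "M \<in> carrier_mat n n" "i < Suc n" "j < Suc n"
  shows "corner_block c r M $$ (i, j) =
    (if j = 0 then (if i = 0 then c else 0) else if i = 0 then r $ (j - 1) else M $$ (i - 1, j - 1))"
  using assms unfolding corner_block_def by auto

lemma corner_block_decompose:
  assumes X: "X \<in> carrier_mat (Suc n) (Suc n)"
    and c: "\<And>i. i < Suc n \<Longrightarrow> X $$ (i, 0) = (if i = 0 then c else 0)"
  shows "X = corner_block c (vec n (\<lambda>j. X $$ (0, Suc j))) (mat n n (\<lambda>(i, j). X $$ (Suc i, Suc j)))"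
proof -
  let ?r = "vec n (\<lambda>j. X $$ (0, Suc j))" and ?M = "mat n n (\<lambda>(i, j). X $$ (Suc i, Suc j))"
  have r: "?r \<in> carrier_vec n" and M: "?M \<in> carrier_mat n n" by auto
  show ?thesis
  proof (rule eq_matI)
    fix i j assume "i < dim_row (corner_block c ?r ?M)" "j < dim_col (corner_block c ?r ?M)"
    then have ij: "i < Suc n" "j < Suc n" using corner_block_carrier[OF r M, of c] by auto
    show "X $$ (i, j) = corner_block c ?r ?M $$ (i, j)"
      unfolding corner_block_entry[OF r M ij] using c[OF ij(1)] ij by auto
  qed (use X carrier_matD[OF corner_block_carrier[OF r M, of c]] in simp_all)
qed

lemma det_corner_block:
  assumes "r \<in> carrier_vec n" "M \<in> carrier_mat n n"
  shows "det (corner_block c r M) = c * det M"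
  using assms unfolding corner_block_def
  by (subst det_four_block_mat_lower_left_zero[of _ 1 _ n]) (auto simp: det_single)

lemma corner_block_pencil:
  assumes "r \<in> carrier_vec n" "M \<in> carrier_mat n n" "r' \<in> carrier_vec n" "M' \<in> carrier_mat n n"
  shows "pencil (corner_block c r M) (corner_block c' r' M') \<alpha> \<beta> =
    corner_block (\<alpha> * c + \<beta> * c') (\<alpha> \<cdot>\<^sub>v r + \<beta> \<cdot>\<^sub>v r') (pencil M M' \<alpha> \<beta>)"
    (is "?L = corner_block ?c ?r ?M")
proof (rule eq_matI)
  have s: "?r \<in> carrier_vec n" "?M \<in> carrier_mat n n" using assms by auto
  note k = corner_block_carrier[OF assms(1,2), of c] corner_block_carrier[OF assms(3,4), of c']
  fix i j assume "i < dim_row (corner_block ?c ?r ?M)" "j < dim_col (corner_block ?c ?r ?M)"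
  then have ij: "i < Suc n" "j < Suc n" using carrier_matD[OF corner_block_carrier[OF s, of ?c]] by auto
  then show "?L $$ (i, j) = corner_block ?c ?r ?M $$ (i, j)"
    unfolding pencil_entry[OF k ij] using assms
    by (simp add: corner_block_entry[OF s ij] corner_block_entry[OF assms(1,2) ij]
      corner_block_entry[OF assms(3,4) ij] pencil_entry[OF assms(2,4)])
qed (use assms in \<open>auto simp: pencil_def corner_block_def\<close>)

lemma mat_l1_corner_block_diff:
  assumes "r \<in> carrier_vec n" "M \<in> carrier_mat n n" "r' \<in> carrier_vec n" "M' \<in> carrier_mat n n"
  shows "mat_l1 (corner_block c r' M' - corner_block c r M) = (\<Sum>j<n. cmod (r' $ j - r $ j)) + mat_l1 (M' - M)"
proof -
  have c: "corner_block c r M \<in> carrier_mat (Suc n) (Suc n)" "corner_block c r' M' \<in> carrier_mat (Suc n) (Suc n)"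
    using assms by auto
  have "mat_l1 (corner_block c r' M' - corner_block c r M) =
      (\<Sum>i<Suc n. \<Sum>j<Suc n. cmod (corner_block c r' M' $$ (i, j) - corner_block c r M $$ (i, j)))"
    unfolding mat_l1_def using c by (auto intro!: sum.cong simp del: sum.lessThan_Suc)
  also have "\<dots> = (\<Sum>j<n. cmod (r' $ j - r $ j)) + (\<Sum>i<n. \<Sum>j<n. cmod (M' $$ (i, j) - M $$ (i, j)))"
    unfolding sum.lessThan_Suc_shift
    using assms by (simp add: corner_block_entry[OF assms(1,2)] corner_block_entry[OF assms(3,4)] del: sum.lessThan_Suc)
  finally show ?thesis using assms by (simp add: mat_l1_def)
qed

lemma corner_block_mult_vec:
  assumes "r \<in> carrier_vec n" "M \<in> carrier_mat n n" "v \<in> carrier_vec (Suc n)"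
  defines "t \<equiv> vec n (\<lambda>i. v $ Suc i)"
  shows "(corner_block c r M *\<^sub>v v) $ 0 = c * v $ 0 + r \<bullet> t"
    "\<And>i. i < n \<Longrightarrow> (corner_block c r M *\<^sub>v v) $ Suc i = (M *\<^sub>v t) $ i"
proof -
  have c: "corner_block c r M \<in> carrier_mat (Suc n) (Suc n)" using assms by auto
  show "(corner_block c r M *\<^sub>v v) $ 0 = c * v $ 0 + r \<bullet> t"
    using assms(1,2,3) unfolding t_def
    by (subst mult_mat_vec_entry[OF c assms(3)])
      (auto simp: sum.lessThan_Suc_shift corner_block_entry[OF assms(1,2)] scalar_prod_def atLeast0LessThan
        simp del: sum.lessThan_Suc)
  show "(corner_block c r M *\<^sub>v v) $ Suc i = (M *\<^sub>v t) $ i" if "i < n" for i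
    using assms(1,2,3) that unfolding t_def
    by (subst mult_mat_vec_entry[OF c assms(3)])
      (auto simp: sum.lessThan_Suc_shift corner_block_entry[OF assms(1,2)] scalar_prod_def atLeast0LessThan
        simp del: sum.lessThan_Suc intro!: sum.cong)
qed

text \<open>The determinant is a polynomial in \<open>\<mu>\<close>, so its value at \<open>0\<close> is determined by the other ones.\<close>

lemma det_pencil_zero:
  fixes A B :: "complex mat"
  assumes A: "A \<in> carrier_mat n n" and B: "B \<in> carrier_mat n n"
    and z: "\<And>\<mu>. \<mu> \<noteq> 0 \<Longrightarrow> det (pencil A B 1 \<mu>) = 0"
  shows "det (pencil A B 1 \<mu>) = 0"
proof -
  define M where "M = mat n n (\<lambda>(i, j). [:A $$ (i, j), B $$ (i, j):])"
  have M: "M \<in> carrier_mat n n" unfolding M_def by auto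
  have p: "poly (det M) x = det (pencil A B 1 x)" for x
    using A B by (intro poly_det_cong[OF _ M]) (auto simp: M_def pencil_def)
  have "det M = 0" by (rule poly_eq_0_off_0) (use z p in auto)
  then show ?thesis using p by (metis poly_0)
qed

text \<open>The functional \<open>w\<close> shows that the kernel of \<open>M\<close> is at most a line.  If \<open>r\<close> vanishes on that line,
  then adding a small multiple of \<open>w\<close> to \<open>r\<close> repairs this.\<close>

lemma separating_row:
  fixes M :: "complex mat"
  assumes M: "M \<in> carrier_mat n n" and r: "r \<in> carrier_vec n" and w: "w \<in> carrier_vec n" and e: "e > 0"
    and sep: "\<And>v. v \<in> carrier_vec n \<Longrightarrow> M *\<^sub>v v = 0\<^sub>v n \<Longrightarrow> w \<bullet> v = 0 \<Longrightarrow> v = 0\<^sub>v n"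
  shows "\<exists>r' \<in> carrier_vec n. (\<Sum>j<n. cmod (r' $ j - r $ j)) < e \<and>
    (\<forall>v \<in> carrier_vec n. M *\<^sub>v v = 0\<^sub>v n \<and> r' \<bullet> v = 0 \<longrightarrow> v = 0\<^sub>v n)"
proof (cases "\<forall>v \<in> carrier_vec n. M *\<^sub>v v = 0\<^sub>v n \<and> r \<bullet> v = 0 \<longrightarrow> v = 0\<^sub>v n")
  case True
  then show ?thesis using r e by (intro bexI[of _ r]) auto
next
  case False
  then obtain x where x: "x \<in> carrier_vec n" "M *\<^sub>v x = 0\<^sub>v n" "r \<bullet> x = 0" "x \<noteq> 0\<^sub>v n" by blast
  have wx: "w \<bullet> x \<noteq> 0" using sep x by blast
  define S where "S = (\<Sum>j<n. cmod (w $ j)) + 1"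
  have "0 \<le> (\<Sum>j<n. cmod (w $ j))" by (intro sum_nonneg) auto
  then have S: "S > 0" unfolding S_def by simp
  \<comment> \<open>\<open>S\<close> exceeds the sum by one so that it is positive and the estimate below is strict\<close>
  define d where "d = complex_of_real (e / (2 * S))"
  have d: "d \<noteq> 0" "cmod d = e / (2 * S)" unfolding d_def using e S by (auto simp: norm_divide norm_mult)
  define r' where "r' = r + d \<cdot>\<^sub>v w"
  have r': "r' \<in> carrier_vec n" using r w by (simp add: r'_def)
  have "(\<Sum>j<n. cmod (r' $ j - r $ j)) = (\<Sum>j<n. cmod d * cmod (w $ j))"
    using r w by (intro sum.cong) (auto simp: r'_def norm_mult)
  also have "\<dots> = cmod d * (S - 1)" by (simp add: S_def sum_distrib_left)
  also have "\<dots> < cmod d * (2 * S)" using S d e by (intro mult_strict_left_mono) auto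
  also have "\<dots> = e" using S by (simp add: d)
  finally have small: "(\<Sum>j<n. cmod (r' $ j - r $ j)) < e" .
  have "v = 0\<^sub>v n" if v: "v \<in> carrier_vec n" "M *\<^sub>v v = 0\<^sub>v n" "r' \<bullet> v = 0" for v
  proof -
    define a where "a = (w \<bullet> v) / (w \<bullet> x)"
    have "v - a \<cdot>\<^sub>v x = 0\<^sub>v n"
    proof (rule sep)
      have "M *\<^sub>v (v - a \<cdot>\<^sub>v x) = M *\<^sub>v v - M *\<^sub>v (a \<cdot>\<^sub>v x)"
        using M v x by (intro mult_minus_distrib_mat_vec) auto
      moreover have "a \<cdot>\<^sub>v 0\<^sub>v n = (0\<^sub>v n :: complex vec)" by (intro eq_vecI) auto
      ultimately show "M *\<^sub>v (v - a \<cdot>\<^sub>v x) = 0\<^sub>v n" using M v x by (simp add: mult_mat_vec)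
      have "w \<bullet> (v - a \<cdot>\<^sub>v x) = w \<bullet> v - a * (w \<bullet> x)"
        using w v x by (simp add: scalar_prod_minus_distrib[of _ n])
      then show "w \<bullet> (v - a \<cdot>\<^sub>v x) = 0" using wx by (simp add: a_def)
    qed (use v x in auto)
    then have vi: "v $ i = a * x $ i" if "i < n" for i
      using that v x by (metis carrier_vecD eq_iff_diff_eq_0 index_minus_vec(1) index_smult_vec index_zero_vec(1) smult_carrier_vec)
    have v_eq: "v = a \<cdot>\<^sub>v x" using v x vi by (intro eq_vecI) auto
    have "r' \<bullet> v = a * (r \<bullet> x) + d * (a * (w \<bullet> x))"
      unfolding v_eq r'_def using r w x by (simp add: add_scalar_prod_distrib[of _ n])
    then have "a = 0" using v(3) x(3) d(1) wx by simp
    then show ?thesis using v_eq x by (intro eq_vecI) auto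
  qed
  then show ?thesis using r' small by blast
qed

text \<open>The corner contributes the factor \<open>\<beta>\<close> to the determinant.  The kernel of the bordered matrix is
  spanned by the first basis vector, provided that the first row separates the kernel of the smaller matrix;
  therefore the row is perturbed, too.\<close>

lemma single_block_limit_corner:
  assumes IH: "single_block_limit n A B" and A: "A \<in> carrier_mat n n" and B: "B \<in> carrier_mat n n"
    and r: "r \<in> carrier_vec n" and r': "r' \<in> carrier_vec n"
  shows "single_block_limit (Suc n) (corner_block 0 r A) (corner_block 1 r' B)"
  unfolding single_block_limit_def
proof (intro allI impI)
  fix e :: real assume e: "e > 0"
  obtain A' B' where g: "single_block n A' B'" "mat_l1 (A' - A) < e / 2" "mat_l1 (B' - B) < e / 2"
    using IH e unfolding single_block_limit_def by (meson half_gt_zero)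
  note d = single_blockD[OF g(1)]
  obtain w where w: "w \<in> carrier_vec n" "\<And>v. v \<in> carrier_vec n \<Longrightarrow> A' *\<^sub>v v = 0\<^sub>v n \<Longrightarrow> w \<bullet> v = 0 \<Longrightarrow> v = 0\<^sub>v n"
    using d(4) by blast
  have e2: "e / 2 > 0" using e by simp
  obtain q where q: "q \<in> carrier_vec n" "(\<Sum>j<n. cmod (q $ j - r $ j)) < e / 2"
    "\<And>v. v \<in> carrier_vec n \<Longrightarrow> A' *\<^sub>v v = 0\<^sub>v n \<Longrightarrow> q \<bullet> v = 0 \<Longrightarrow> v = 0\<^sub>v n"
    using separating_row[OF d(1) r w(1) e2 w(2)] by blast
  have "single_block (Suc n) (corner_block 0 q A') (corner_block 1 r' B')"
    unfolding single_block_def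
  proof (intro conjI allI impI)
    show "det (pencil (corner_block 0 q A') (corner_block 1 r' B') \<alpha> \<beta>) \<noteq> 0" if "\<beta> \<noteq> 0" for \<alpha> \<beta>
      unfolding corner_block_pencil[OF q(1) d(1) r' d(2)] using that d(3) q(1) r' d(1,2)
      by (subst det_corner_block[of _ n]) auto
    have "v = 0\<^sub>v (Suc n)" if v: "v \<in> carrier_vec (Suc n)"
      and z: "corner_block 0 q A' *\<^sub>v v = 0\<^sub>v (Suc n)" "unit_vec (Suc n) 0 \<bullet> v = 0" for v
    proof -
      define t where "t = vec n (\<lambda>i. v $ Suc i)"
      have t: "t \<in> carrier_vec n" by (simp add: t_def)
      have v0: "v $ 0 = 0" using z(2) v by simp
      note cb = corner_block_mult_vec[OF q(1) d(1) v, where c = 0, folded t_def]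
      have "q \<bullet> t = 0" using cb(1) z(1) by simp
      moreover have "A' *\<^sub>v t = 0\<^sub>v n" 
      proof (rule eq_vecI)
        fix i assume "i < dim_vec (0\<^sub>v n :: complex vec)"
        then have i: "i < n" by simp
        have "(A' *\<^sub>v t) $ i = (corner_block 0 q A' *\<^sub>v v) $ Suc i" using cb(2)[OF i] by simp
        also have "\<dots> = 0" unfolding z(1) using i by simp
        finally show "(A' *\<^sub>v t) $ i = 0\<^sub>v n $ i" using i by simp
      qed (use d(1) in auto)
      ultimately have t0: "t = 0\<^sub>v n" using q(3)[OF t] by simp
      have "v $ Suc i = 0" if "i < n" for i
      proof -
        have "v $ Suc i = t $ i" using that by (simp add: t_def)
        then show ?thesis using t0 that by simp
      qed
      then have "v $ i = 0" if "i < Suc n" for i using v0 that by (cases i) auto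
      then show ?thesis using v by (intro eq_vecI) auto
    qed
    then show "\<exists>w \<in> carrier_vec (Suc n). \<forall>v \<in> carrier_vec (Suc n).
        corner_block 0 q A' *\<^sub>v v = 0\<^sub>v (Suc n) \<and> w \<bullet> v = 0 \<longrightarrow> v = 0\<^sub>v (Suc n)"
      by (intro bexI[of _ "unit_vec (Suc n) 0"]) auto
  qed (use q r' d in auto)
  moreover have "mat_l1 (corner_block 0 q A' - corner_block 0 r A) < e"
    using mat_l1_corner_block_diff[OF r A q(1) d(1)] q(2) g(2) by simp
  moreover have "mat_l1 (corner_block 1 r' B' - corner_block 1 r' B) < e"
    using mat_l1_corner_block_diff[OF r' B r' d(2)] g(3) e by simp
  ultimately show "\<exists>A' B'. single_block (Suc n) A' B' \<and> mat_l1 (A' - corner_block 0 r A) < e \<and>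
      mat_l1 (B' - corner_block 1 r' B) < e" by blast
qed

text \<open>With \<open>x\<close> and \<open>B x\<close> as first basis vectors of the domain and of the range, \<open>A\<close> and \<open>B\<close> become corner
  matrices with corners \<open>0\<close> and \<open>1\<close>, and the smaller pencil is singular again.\<close>

lemma single_block_limit_deflate:
  assumes IH: "\<And>A B. A \<in> carrier_mat n n \<Longrightarrow> B \<in> carrier_mat n n \<Longrightarrow>
      (\<And>\<mu>. det (pencil A B 1 \<mu>) = 0) \<Longrightarrow> single_block_limit n A B"
    and A: "A \<in> carrier_mat (Suc n) (Suc n)" and B: "B \<in> carrier_mat (Suc n) (Suc n)"
    and sing: "\<And>\<mu>. det (pencil A B 1 \<mu>) = 0"
    and x: "x \<in> carrier_vec (Suc n)" "A *\<^sub>v x = 0\<^sub>v (Suc n)" "B *\<^sub>v x \<noteq> 0\<^sub>v (Suc n)"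
  shows "single_block_limit (Suc n) A B"
proof -
  let ?N = "Suc n"
  have x0: "x \<noteq> 0\<^sub>v ?N" using x B by auto
  obtain V where V: "V \<in> carrier_mat ?N ?N" "det V \<noteq> 0" "col V 0 = x"
    using matrix_with_first_column[OF x(1) x0] by blast
  have Bx: "B *\<^sub>v x \<in> carrier_vec ?N" using B x by auto
  obtain W where W: "W \<in> carrier_mat ?N ?N" "det W \<noteq> 0" "col W 0 = B *\<^sub>v x"
    using matrix_with_first_column[OF Bx x(3)] by blast
  obtain V' where V': "V' \<in> carrier_mat ?N ?N" "V * V' = 1\<^sub>m ?N" "det V' \<noteq> 0"
    using mat_inverse_obtain[OF V(1,2)] by metis
  obtain U where U: "U \<in> carrier_mat ?N ?N" "W * U = 1\<^sub>m ?N" "U * W = 1\<^sub>m ?N" "det U \<noteq> 0"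
    using mat_inverse_obtain[OF W(1,2)] by metis
  define A1 where "A1 = U * A * V"
  define B1 where "B1 = U * B * V"
  have A1: "A1 \<in> carrier_mat ?N ?N" and B1: "B1 \<in> carrier_mat ?N ?N"
    unfolding A1_def B1_def using U A B V by auto
  have cA: "col A1 0 = 0\<^sub>v ?N"
  proof -
    have "col A1 0 = U * A *\<^sub>v col V 0" unfolding A1_def using U A V by (intro col_mult2[of _ ?N ?N]) auto
    also have "\<dots> = U *\<^sub>v (A *\<^sub>v x)" unfolding V(3) by (rule assoc_mult_mat_vec[OF U(1) A x(1)])
    moreover have "U *\<^sub>v 0\<^sub>v ?N = 0\<^sub>v ?N" using U by (intro eq_vecI) auto
    ultimately show ?thesis using x by simp
  qed
  have cB: "col B1 0 = unit_vec ?N 0"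
  proof -
    have "col B1 0 = U * B *\<^sub>v col V 0" unfolding B1_def using U B V by (intro col_mult2[of _ ?N ?N]) auto
    also have "\<dots> = U *\<^sub>v (B *\<^sub>v x)" unfolding V(3) by (rule assoc_mult_mat_vec[OF U(1) B x(1)])
    also have "\<dots> = col (U * W) 0" unfolding W(3)[symmetric] using U W by (intro col_mult2[of _ ?N ?N, symmetric]) auto
    finally show ?thesis using U by simp
  qed
  define A2 where "A2 = mat n n (\<lambda>(i, j). A1 $$ (Suc i, Suc j))"
  define B2 where "B2 = mat n n (\<lambda>(i, j). B1 $$ (Suc i, Suc j))"
  define a where "a = vec n (\<lambda>j. A1 $$ (0, Suc j))"
  define b where "b = vec n (\<lambda>j. B1 $$ (0, Suc j))"
  have c: "A2 \<in> carrier_mat n n" "B2 \<in> carrier_mat n n" "a \<in> carrier_vec n" "b \<in> carrier_vec n"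
    unfolding A2_def B2_def a_def b_def by auto
  have "A1 $$ (i, 0) = (if i = 0 then 0 else 0)" if "i < ?N" for i
    using arg_cong[OF cA, of "\<lambda>v. v $ i"] that A1 by simp
  then have A1b: "A1 = corner_block 0 a A2"
    unfolding a_def A2_def by (rule corner_block_decompose[OF A1])
  have "B1 $$ (i, 0) = (if i = 0 then 1 else 0)" if "i < ?N" for i
    using arg_cong[OF cB, of "\<lambda>v. v $ i"] that B1 by simp
  then have B1b: "B1 = corner_block 1 b B2"
    unfolding b_def B2_def by (rule corner_block_decompose[OF B1])
  have "det (pencil A2 B2 1 \<mu>) = 0" if "\<mu> \<noteq> 0" for \<mu>
  proof -
    have AB: "pencil A B 1 \<mu> \<in> carrier_mat ?N ?N" "U * pencil A B 1 \<mu> \<in> carrier_mat ?N ?N" using A B U by auto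
    have "det (pencil A1 B1 1 \<mu>) = 0"
      unfolding A1_def B1_def pencil_mult[OF A B U(1) V(1)] det_mult[OF AB(2) V(1)] det_mult[OF U(1) AB(1)] sing by simp
    moreover have "det (pencil A1 B1 1 \<mu>) = \<mu> * det (pencil A2 B2 1 \<mu>)"
      unfolding A1b B1b corner_block_pencil[OF c(3,1,4,2)] using c by (subst det_corner_block[of _ n]) auto
    ultimately show ?thesis using that by simp
  qed
  then have "single_block_limit n A2 B2" using det_pencil_zero[OF c(1,2)] c by (intro IH) auto
  then have "single_block_limit ?N A1 B1"
    unfolding A1b B1b using c by (intro single_block_limit_corner) auto
  then have lim: "single_block_limit ?N (W * A1 * V') (W * B1 * V')"
    using A1 B1 W V' by (intro single_block_limit_equivalence) auto
  have inv: "W * (U * X * V) * V' = X" if X: "X \<in> carrier_mat ?N ?N" for X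
  proof -
    have UX: "U * X \<in> carrier_mat ?N ?N" using U X by auto
    have "W * (U * X * V) = W * (U * X) * V" by (rule assoc_mult_mat[OF W(1) UX V(1), symmetric])
    also have "W * (U * X) = W * U * X" by (rule assoc_mult_mat[OF W(1) U(1) X, symmetric])
    also have "\<dots> = X" unfolding U(2) using X by simp
    finally have e: "W * (U * X * V) = X * V" .
    have "W * (U * X * V) * V' = X * V * V'" unfolding e ..
    also have "\<dots> = X * (V * V')" by (rule assoc_mult_mat[OF X V(1) V'(1)])
    finally show ?thesis unfolding V'(2) using X by simp
  qed
  show ?thesis using lim unfolding A1_def B1_def inv[OF A] inv[OF B] .
qed

text \<open>Induction on the size.  Let \<open>A x = 0\<close> and \<open>y\<^sup>T A = 0\<close>.  If \<open>B x \<noteq> 0\<close> or \<open>y\<^sup>T B \<noteq> 0\<close>, the pencil can be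
  deflated.  Otherwise \<open>B\<close> is perturbed by a matrix of rank one that kills \<open>x\<close>, so that the pencil stays
  singular, while its transpose does not kill \<open>y\<close>.\<close>

theorem singular_pencil_single_block_limit:
  assumes "A \<in> carrier_mat n n" "B \<in> carrier_mat n n" "\<And>\<mu>. det (pencil A B 1 \<mu>) = 0"
  shows "single_block_limit n A B"
  using assms
proof (induction n arbitrary: A B)
  case 0
  then have "det (pencil A B 1 0) = 1" by (intro det_dim_zero pencil_carrier)
  then show ?case using 0(3)[of 0] by simp
next
  case (Suc n)
  let ?N = "Suc n"
  note A = Suc.prems(1) and B = Suc.prems(2) and sing = Suc.prems(3)
  have At: "A\<^sup>T \<in> carrier_mat ?N ?N" and Bt: "B\<^sup>T \<in> carrier_mat ?N ?N" using A B by auto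
  have dA: "det A = 0" using sing[of 0] pencil_1_0[OF A B] by simp
  then obtain x where x: "x \<in> carrier_vec ?N" "x \<noteq> 0\<^sub>v ?N" "A *\<^sub>v x = 0\<^sub>v ?N"
    using kernel_vectorE[OF A] by blast
  have row_deflate: "single_block_limit ?N A C"
    if C: "C \<in> carrier_mat ?N ?N" "\<And>\<mu>. det (pencil A C 1 \<mu>) = 0"
      and y: "y \<in> carrier_vec ?N" "A\<^sup>T *\<^sub>v y = 0\<^sub>v ?N" "C\<^sup>T *\<^sub>v y \<noteq> 0\<^sub>v ?N" for C y
  proof (rule single_block_limit_transpose[OF _ A C(1)], rule single_block_limit_deflate[OF Suc.IH At _ _ y])
    show "C\<^sup>T \<in> carrier_mat ?N ?N" using C by auto
    show "det (pencil (A\<^sup>T) (C\<^sup>T) 1 \<mu>) = 0" for \<mu>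
      unfolding pencil_transpose[OF A C(1)] using det_transpose[of "pencil A C 1 \<mu>" ?N] A C by simp
  qed
  show ?case
  proof (cases "B *\<^sub>v x = 0\<^sub>v ?N")
    case False
    then show ?thesis using single_block_limit_deflate[OF Suc.IH A B sing x(1,3)] by blast
  next
    case Bx: True
    show ?thesis
    \<comment> \<open>the zero pencil of size one is the limit of \<open>\<beta> c\<close> for \<open>c \<rightarrow> 0\<close>; the vector \<open>g\<close> below needs a second coordinate\<close>
    proof (cases "n = 0")
      case True
      have x00: "x $ 0 \<noteq> 0"
      proof
        assume "x $ 0 = 0"
        then have "x = 0\<^sub>v ?N" using True by (intro vec_eq_0I[OF x(1)]) auto
        then show False using x(2) by simp
      qed
      have "X = 0\<^sub>m 1 1" if "X \<in> carrier_mat ?N ?N" "X *\<^sub>v x = 0\<^sub>v ?N" for X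
        using arg_cong[OF that(2), of "\<lambda>v. v $ 0"] that(1) x(1) x00 True
        by (intro eq_matI) (auto simp: mult_mat_vec_entry[of _ 1 1] scalar_prod_def)
      then have AB: "A = 0\<^sub>m 1 1" "B = 0\<^sub>m 1 1" using A B x Bx by auto
      show ?thesis unfolding single_block_limit_def
      proof (intro allI impI)
        fix e :: real assume e: "e > 0"
        define c where "c = complex_of_real (e / 2)"
        have c: "c \<noteq> 0" "cmod c = e / 2" using e by (auto simp: c_def)
        have "single_block ?N (0\<^sub>m 1 1) (c \<cdot>\<^sub>m 1\<^sub>m 1)"
          unfolding single_block_def
        proof (intro conjI allI impI)
          have "pencil (0\<^sub>m 1 1) (c \<cdot>\<^sub>m 1\<^sub>m 1) \<alpha> \<beta> = (\<beta> * c) \<cdot>\<^sub>m 1\<^sub>m 1" for \<alpha> \<beta>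
            unfolding pencil_def by (intro eq_matI) auto
          then show "det (pencil (0\<^sub>m 1 1) (c \<cdot>\<^sub>m 1\<^sub>m 1) \<alpha> \<beta>) \<noteq> 0" if "\<beta> \<noteq> 0" for \<alpha> \<beta> using that c by simp
          show "\<exists>w\<in>carrier_vec ?N. \<forall>v\<in>carrier_vec ?N. (0\<^sub>m 1 1 :: complex mat) *\<^sub>v v = 0\<^sub>v ?N \<and> w \<bullet> v = 0 \<longrightarrow> v = 0\<^sub>v ?N"
            using True by (intro bexI[of _ "unit_vec ?N 0 :: complex vec"]) (auto intro!: eq_vecI)
        qed (use True c in auto)
        moreover have "mat_l1 (c \<cdot>\<^sub>m 1\<^sub>m 1 - B) < e" "mat_l1 (0\<^sub>m 1 1 - A) < e"
          using e c AB by (auto simp: mat_l1_def)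
        ultimately show "\<exists>A' B'. single_block ?N A' B' \<and> mat_l1 (A' - A) < e \<and> mat_l1 (B' - B) < e" by blast
      qed
    next
      case n0: False
      have "det (A\<^sup>T) = 0" using det_transpose[OF A] dA by simp
      then obtain y where y: "y \<in> carrier_vec ?N" "y \<noteq> 0\<^sub>v ?N" "A\<^sup>T *\<^sub>v y = 0\<^sub>v ?N"
        using kernel_vectorE[OF At] by blast
      show ?thesis
      proof (cases "B\<^sup>T *\<^sub>v y = 0\<^sub>v ?N")
        case False
        then show ?thesis using row_deflate[OF B sing y(1,3)] by blast
      next
        case By: True
        \<comment> \<open>a nonzero row \<open>g\<close> with \<open>g \<bullet> x = 0\<close>, which exists because the size is at least two\<close>
        define g where "g = (if x $ 0 = 0 then unit_vec ?N 0
          else vec ?N (\<lambda>i. if i = 0 then x $ 1 else if i = 1 then - x $ 0 else 0))"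
        have g: "g \<in> carrier_vec ?N" by (auto simp: g_def)
        have gx: "g \<bullet> x = 0"
        proof (cases "x $ 0 = 0")
          case False
          obtain n' where n': "n = Suc n'" using n0 not0_implies_Suc by blast
          show ?thesis using False x(1) unfolding g_def n'
            by (simp add: scalar_prod_def atLeast0LessThan sum.lessThan_Suc_shift del: sum.lessThan_Suc)
        qed (use x in \<open>simp add: g_def\<close>)
        have g0: "g \<noteq> 0\<^sub>v ?N"
        proof (cases "x $ 0 = 0")
          case True
          then show ?thesis by (simp add: g_def)
        next
          case False
          then have "g $ 1 \<noteq> 0" using n0 by (simp add: g_def)
          then show ?thesis using n0 by auto
        qed
        define u where "u = conjugate y"
        have u: "u \<in> carrier_vec ?N" using y by (simp add: u_def)
        have yu: "u \<bullet> y \<noteq> 0" using y by (simp add: u_def comm_scalar_prod[of _ ?N])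
        define R where "R = mat ?N ?N (\<lambda>(i, j). u $ i * g $ j)"
        have R: "R \<in> carrier_mat ?N ?N" by (simp add: R_def)
        have Rx: "R *\<^sub>v x = (g \<bullet> x) \<cdot>\<^sub>v u"
          unfolding R_def by (rule rank_one_mult_vec(1)[OF u g x(1)])
        have Rty: "R\<^sup>T *\<^sub>v y = (u \<bullet> y) \<cdot>\<^sub>v g"
          unfolding R_def by (rule rank_one_mult_vec(2)[OF u g y(1)])
        show ?thesis
        proof (rule single_block_limit_closed[OF A B])
          fix e :: real assume e: "e > 0"
          define S where "S = mat_l1 R + 1"
          have S: "S > 0" using mat_l1_nonneg[of R] by (simp add: S_def)
          define d where "d = complex_of_real (e / (2 * S))"
          have d: "d \<noteq> 0" "cmod d = e / (2 * S)" unfolding d_def using e S by (auto simp: norm_divide norm_mult)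
          define C where "C = B + d \<cdot>\<^sub>m R"
          have C: "C \<in> carrier_mat ?N ?N" using B R by (simp add: C_def)
          have dR: "d \<cdot>\<^sub>m R \<in> carrier_mat ?N ?N" using R by simp
          have "C - B = d \<cdot>\<^sub>m R" using B R by (intro eq_matI) (auto simp: C_def)
          then have "mat_l1 (C - B) = cmod d * mat_l1 R" by (simp add: mat_l1_smult)
          also have "\<dots> < cmod d * (2 * S)" using S d e mat_l1_nonneg[of R] by (intro mult_strict_left_mono) (auto simp: S_def)
          also have "\<dots> = e" using S by (simp add: d)
          finally have small: "mat_l1 (C - B) < e" .
          have Cx: "C *\<^sub>v x = 0\<^sub>v ?N"
            unfolding C_def add_mult_distrib_mat_vec[OF B dR x(1)] Bx smult_mat_mult_vec[OF R x(1)] Rx gx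
            using u by (intro eq_vecI) auto
          have "det (pencil A C 1 \<mu>) = 0" for \<mu>
          proof -
            have AC: "1 \<cdot>\<^sub>m A \<in> carrier_mat ?N ?N" "\<mu> \<cdot>\<^sub>m C \<in> carrier_mat ?N ?N" using A C by auto
            have "pencil A C 1 \<mu> *\<^sub>v x = 0\<^sub>v ?N"
              unfolding pencil_def add_mult_distrib_mat_vec[OF AC x(1)] smult_mat_mult_vec[OF A x(1)] x(3)
                smult_mat_mult_vec[OF C x(1)] Cx by (intro eq_vecI) auto
            then show ?thesis using det_0_iff_vec_prod_zero[OF pencil_carrier[OF A C]] x by blast
          qed
          moreover have "C\<^sup>T *\<^sub>v y \<noteq> 0\<^sub>v ?N"
          proof
            assume z: "C\<^sup>T *\<^sub>v y = 0\<^sub>v ?N"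
            have Ct: "C\<^sup>T = B\<^sup>T + d \<cdot>\<^sub>m R\<^sup>T" using B R by (intro eq_matI) (auto simp: C_def)
            have Rt: "R\<^sup>T \<in> carrier_mat ?N ?N" "d \<cdot>\<^sub>m R\<^sup>T \<in> carrier_mat ?N ?N" using R by auto
            have "C\<^sup>T *\<^sub>v y = 0\<^sub>v ?N + d \<cdot>\<^sub>v ((u \<bullet> y) \<cdot>\<^sub>v g)"
              unfolding Ct add_mult_distrib_mat_vec[OF Bt Rt(2) y(1)] By smult_mat_mult_vec[OF Rt(1) y(1)] Rty ..
            then have e0: "0\<^sub>v ?N + d \<cdot>\<^sub>v ((u \<bullet> y) \<cdot>\<^sub>v g) = 0\<^sub>v ?N" using z by simp
            have "d * ((u \<bullet> y) * g $ i) = 0" if "i < ?N" for i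
            proof -
              have "(0\<^sub>v ?N + d \<cdot>\<^sub>v ((u \<bullet> y) \<cdot>\<^sub>v g)) $ i = 0" unfolding e0 using that by simp
              then show ?thesis using that g by simp
            qed
            then have "g $ i = 0" if "i < ?N" for i using that d yu by auto
            then have "g = 0\<^sub>v ?N" by (rule vec_eq_0I[OF g])
            then show False using g0 by simp
          qed
          ultimately have "single_block_limit ?N A C" using row_deflate[OF C _ y(1,3)] by blast
          then show "\<exists>B1 \<in> carrier_mat ?N ?N. single_block_limit ?N A B1 \<and> mat_l1 (B1 - B) < e"
            using C small by blast
        qed
      qed
    qed
  qed
qed

section \<open>Singular matrix polynomials as limits of polynomials with a single eigenvalue\<close>

lemma sum_blocks:
  fixes g :: "nat \<Rightarrow> 'a :: comm_monoid_add"
  shows "(\<Sum>q<k * n. g q) = (\<Sum>i<k. \<Sum>b<n. g (i * n + b))"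
proof -
  have "(\<Sum>q<k * n. g q) = (\<Sum>i<k. sum g {i * n..<i * n + n})" by (rule sum.nat_group[symmetric])
  also have "\<dots> = (\<Sum>i<k. \<Sum>b<n. g (i * n + b))"
  proof (rule sum.cong[OF refl])
    fix i
    show "sum g {i * n..<i * n + n} = (\<Sum>b<n. g (i * n + b))"
      using sum.shift_bounds_nat_ivl[of g 0 "i * n" n] by (simp add: atLeast0LessThan add.commute)
  qed
  finally show ?thesis .
qed

lemma block_div_mod:
  assumes "b < (n :: nat)"
  shows "(i * n + b) div n = i" "(i * n + b) mod n = b"
  using assms by simp_all

lemma block_index_less: "i < k \<Longrightarrow> b < n \<Longrightarrow> i * n + b < k * (n :: nat)"
proof -
  assume "i < k" "b < n"
  then have "i * n + b < Suc i * n" by simp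
  also have "\<dots> \<le> k * n" using \<open>i < k\<close> by (intro mult_le_mono1) simp
  finally show ?thesis .
qed

text \<open>The matrix polynomial with coefficients \<open>C\<close> in homogeneous form: \<open>\<alpha> = 1\<close> is evaluation at \<open>\<beta>\<close>, and
  \<open>\<alpha> = 0\<close> gives the leading coefficient.\<close>

definition coeff_eval :: "nat \<Rightarrow> nat \<Rightarrow> (nat \<Rightarrow> complex mat) \<Rightarrow> complex \<Rightarrow> complex \<Rightarrow> complex mat" where
  "coeff_eval n k C \<alpha> \<beta> = mat n n (\<lambda>(a, b). \<Sum>i\<le>k. \<alpha> ^ (k - i) * \<beta> ^ i * C i $$ (a, b))"

lemma coeff_eval_carrier [simp]: "coeff_eval n k C \<alpha> \<beta> \<in> carrier_mat n n"
  by (simp add: coeff_eval_def)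

lemma coeff_eval_1_0:
  assumes "C 0 \<in> carrier_mat n n"
  shows "coeff_eval n k C 1 0 = C 0"
proof (rule eq_matI)
  fix a b assume "a < dim_row (C 0)" "b < dim_col (C 0)"
  then have ab: "a < n" "b < n" using assms by auto
  have "coeff_eval n k C 1 0 $$ (a, b) = (\<Sum>i\<le>k. 0 ^ i * C i $$ (a, b))"
    using ab by (simp add: coeff_eval_def)
  also have "\<dots> = (\<Sum>i\<le>k. if i = 0 then C 0 $$ (a, b) else 0)"
    by (intro sum.cong refl) (auto simp: power_0_left)
  finally show "coeff_eval n k C 1 0 $$ (a, b) = C 0 $$ (a, b)" by simp
qed (use assms in \<open>auto simp: coeff_eval_def\<close>)

text \<open>The companion pencil \<open>comp_const + \<beta> comp_lin\<close> has size \<open>(m + 1) n\<close>.  Applied to the vector with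
  blocks \<open>x, \<beta> x, \<dots>, \<beta>\<^sup>m x\<close> it gives zero in the first \<open>m n\<close> rows and \<open>(\<Sum>i. \<beta>\<^sup>i C\<^sub>i) x\<close> in the last
  \<open>n\<close> rows.\<close>

definition comp_const :: "nat \<Rightarrow> nat \<Rightarrow> (nat \<Rightarrow> complex mat) \<Rightarrow> complex mat" where
  "comp_const n m C = mat (Suc m * n) (Suc m * n) (\<lambda>(p, q).
     if p < m * n then (if q = p + n then 1 else 0) else C (q div n) $$ (p - m * n, q mod n))"

definition comp_lin :: "nat \<Rightarrow> nat \<Rightarrow> (nat \<Rightarrow> complex mat) \<Rightarrow> complex mat" where
  "comp_lin n m C = mat (Suc m * n) (Suc m * n) (\<lambda>(p, q).
     if p < m * n then (if q = p then - 1 else 0)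
     else if m * n \<le> q then C (Suc m) $$ (p - m * n, q - m * n) else 0)"

lemma comp_carrier [simp]:
  "comp_const n m C \<in> carrier_mat (Suc m * n) (Suc m * n)"
  "comp_lin n m C \<in> carrier_mat (Suc m * n) (Suc m * n)"
  by (simp_all add: comp_const_def comp_lin_def)

lemma companion_singular:
  assumes n: "n > 0" and d: "det (coeff_eval n (Suc m) C 1 \<mu>) = 0"
  shows "det (pencil (comp_const n m C) (comp_lin n m C) 1 \<mu>) = 0"
proof -
  let ?N = "Suc m * n"
  obtain x where x: "x \<in> carrier_vec n" "x \<noteq> 0\<^sub>v n" "coeff_eval n (Suc m) C 1 \<mu> *\<^sub>v x = 0\<^sub>v n"
    using kernel_vectorE[OF coeff_eval_carrier d] by blast
  define z where "z = vec ?N (\<lambda>q. \<mu> ^ (q div n) * x $ (q mod n))"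
  have z: "z \<in> carrier_vec ?N" by (simp add: z_def)
  have zi: "z $ (i * n + b) = \<mu> ^ i * x $ b" if "i < Suc m" "b < n" for i b
    using block_index_less[OF that] that n by (simp add: z_def)
  define K where "K = pencil (comp_const n m C) (comp_lin n m C) 1 \<mu>"
  have K: "K \<in> carrier_mat ?N ?N" unfolding K_def by (rule pencil_carrier[OF comp_carrier])
  have Ke: "K $$ (p, q) = comp_const n m C $$ (p, q) + \<mu> * comp_lin n m C $$ (p, q)"
    if "p < ?N" "q < ?N" for p q
    unfolding K_def using pencil_entry[OF comp_carrier that] by simp
  have "(K *\<^sub>v z) $ p = 0" if p: "p < ?N" for p
  proof (cases "p < m * n")
    case True
    have "(K *\<^sub>v z) $ p = (\<Sum>q<?N. (if q = p + n then z $ (p + n) else 0) + (if q = p then - \<mu> * z $ p else 0))"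
      unfolding mult_mat_vec_entry[OF K z p]
      using True p n by (intro sum.cong refl) (auto simp: Ke comp_const_def comp_lin_def simp del: mult_Suc)
    also have "\<dots> = z $ (p + n) - \<mu> * z $ p"
      using True p by (simp add: sum.distrib)
    also have "\<dots> = 0" using True n by (simp add: z_def)
    finally show ?thesis .
  next
    case False
    define a where "a = p - m * n"
    have a: "a < n" using p False by (simp add: a_def)
    have "(K *\<^sub>v z) $ p = (\<Sum>i<Suc m. \<Sum>b<n. K $$ (p, i * n + b) * z $ (i * n + b))"
      unfolding mult_mat_vec_entry[OF K z p] by (rule sum_blocks)
    also have "\<dots> = (\<Sum>i<Suc m. \<Sum>b<n. (C i $$ (a, b) + (if i = m then \<mu> * C (Suc m) $$ (a, b) else 0)) * (\<mu> ^ i * x $ b))"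
    proof (intro sum.cong refl)
      fix i b assume "i \<in> {..<Suc m}" "b \<in> {..<n}"
      then have ib: "i < Suc m" "b < n" by auto
      have l: "i * n + b < ?N" by (rule block_index_less[OF ib])
      have le: "m * n \<le> i * n + b \<longleftrightarrow> i = m"
      proof
        assume "m * n \<le> i * n + b"
        then have "\<not> i < m" using block_index_less[of i m b n] ib by linarith
        then show "i = m" using ib by simp
      qed simp
      show "K $$ (p, i * n + b) * z $ (i * n + b) =
        (C i $$ (a, b) + (if i = m then \<mu> * C (Suc m) $$ (a, b) else 0)) * (\<mu> ^ i * x $ b)"
        unfolding Ke[OF p l] zi[OF ib] using False p l ib le
        by (auto simp: comp_const_def comp_lin_def a_def simp del: mult_Suc)
    qed
    also have "\<dots> = (\<Sum>b<n. \<Sum>i<Suc m. (C i $$ (a, b) + (if i = m then \<mu> * C (Suc m) $$ (a, b) else 0)) * (\<mu> ^ i * x $ b))"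
      by (rule sum.swap)
    also have "\<dots> = (\<Sum>b<n. (\<Sum>i\<le>Suc m. \<mu> ^ i * C i $$ (a, b)) * x $ b)"
    proof (intro sum.cong refl)
      fix b
      have "(\<Sum>i<Suc m. (C i $$ (a, b) + (if i = m then \<mu> * C (Suc m) $$ (a, b) else 0)) * (\<mu> ^ i * x $ b))
        = (\<Sum>i<Suc m. \<mu> ^ i * C i $$ (a, b) * x $ b) + (\<Sum>i<Suc m. if i = m then \<mu> * C (Suc m) $$ (a, b) * (\<mu> ^ m * x $ b) else 0)"
        unfolding sum.distrib[symmetric] by (intro sum.cong refl) (auto simp: algebra_simps)
      also have "(\<Sum>i<Suc m. \<mu> ^ i * C i $$ (a, b) * x $ b) = (\<Sum>i<Suc m. \<mu> ^ i * C i $$ (a, b)) * x $ b"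
        by (rule sum_distrib_right[symmetric])
      also have "(\<Sum>i<Suc m. if i = m then \<mu> * C (Suc m) $$ (a, b) * (\<mu> ^ m * x $ b) else 0) =
          \<mu> ^ Suc m * C (Suc m) $$ (a, b) * x $ b"
        by (simp del: sum.lessThan_Suc)
      finally show "(\<Sum>i<Suc m. (C i $$ (a, b) + (if i = m then \<mu> * C (Suc m) $$ (a, b) else 0)) * (\<mu> ^ i * x $ b))
        = (\<Sum>i\<le>Suc m. \<mu> ^ i * C i $$ (a, b)) * x $ b"
        by (simp add: lessThan_Suc_atMost distrib_right)
    qed
    also have "\<dots> = (coeff_eval n (Suc m) C 1 \<mu> *\<^sub>v x) $ a"
      unfolding mult_mat_vec_entry[OF coeff_eval_carrier x(1) a]
      using a by (intro sum.cong refl) (auto simp: coeff_eval_def)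
    finally show ?thesis using x a by simp
  qed
  then have Kz: "K *\<^sub>v z = 0\<^sub>v ?N" by (rule vec_eq_0I[OF mult_mat_vec_carrier[OF K z]])
  have "z \<noteq> 0\<^sub>v ?N"
  proof
    assume z0: "z = 0\<^sub>v ?N"
    have "x $ b = 0" if "b < n" for b
    proof -
      have "b < ?N" using that by simp
      then have "z $ b = 0" using z0 by (simp del: mult_Suc)
      then show ?thesis using zi[of 0 b] that by simp
    qed
    then show False using x vec_eq_0I[OF x(1)] by simp
  qed
  then show ?thesis using det_0_iff_vec_prod_zero[OF K] z Kz unfolding K_def by blast
qed

text \<open>The analogue of \<open>single_block\<close>: the only eigenvalue is \<open>0\<close>, with infinity (\<open>\<alpha> = 0\<close>) taken into
  account, and its geometric multiplicity is at most one.\<close>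

definition single_eigenvalue :: "nat \<Rightarrow> nat \<Rightarrow> (nat \<Rightarrow> complex mat) \<Rightarrow> bool" where
  "single_eigenvalue n k C \<longleftrightarrow> (\<forall>i\<le>k. C i \<in> carrier_mat n n) \<and>
     (\<forall>\<alpha> \<beta>. \<beta> \<noteq> 0 \<longrightarrow> det (coeff_eval n k C \<alpha> \<beta>) \<noteq> 0) \<and>
     (\<exists>w \<in> carrier_vec n. \<forall>v \<in> carrier_vec n. C 0 *\<^sub>v v = 0\<^sub>v n \<and> w \<bullet> v = 0 \<longrightarrow> v = 0\<^sub>v n)"

text \<open>Let \<open>N\<^sub>0, \<dots>, N\<^sub>m\<close> be the matrices with entries \<open>F i q b\<close> in row \<open>q\<close> and column \<open>b\<close>.  Then
  \<open>pencil_product\<close> is the entry in row \<open>p\<close> and column \<open>b\<close> of the coefficient of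
  \<open>\<alpha>\<^sup>m\<^sup>+\<^sup>1\<^sup>-\<^sup>i \<beta>\<^sup>i\<close> in \<open>(\<alpha> A + \<beta> B) (\<Sum>i. \<alpha>\<^sup>m\<^sup>-\<^sup>i \<beta>\<^sup>i N\<^sub>i)\<close>.\<close>

definition pencil_product :: "nat \<Rightarrow> nat \<Rightarrow> complex mat \<Rightarrow> complex mat \<Rightarrow> (nat \<Rightarrow> nat \<Rightarrow> nat \<Rightarrow> complex) \<Rightarrow>
    nat \<Rightarrow> nat \<Rightarrow> nat \<Rightarrow> complex" where
  "pencil_product n m A B F i p b =
     (if i \<le> m then \<Sum>q<Suc m * n. A $$ (p, q) * F i q b else 0) +
     (if 1 \<le> i then \<Sum>q<Suc m * n. B $$ (p, q) * F (i - 1) q b else 0)"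

lemma pencil_product_sum:
  "(\<Sum>i\<le>Suc m. \<alpha> ^ (Suc m - i) * \<beta> ^ i * pencil_product n m A B F i p b) =
     (\<Sum>q<Suc m * n. (\<alpha> * A $$ (p, q) + \<beta> * B $$ (p, q)) * (\<Sum>i\<le>m. \<alpha> ^ (m - i) * \<beta> ^ i * F i q b))"
proof -
  let ?c = "\<lambda>i. \<alpha> ^ (Suc m - i) * \<beta> ^ i" and ?d = "\<lambda>i. \<alpha> ^ (m - i) * \<beta> ^ i"
  let ?a = "\<lambda>i. \<Sum>q<Suc m * n. A $$ (p, q) * F i q b" and ?b = "\<lambda>i. \<Sum>q<Suc m * n. B $$ (p, q) * F i q b"
  have "(\<Sum>i\<le>Suc m. ?c i * pencil_product n m A B F i p b) =
     (\<Sum>i\<le>Suc m. ?c i * (if i \<le> m then ?a i else 0)) + (\<Sum>i\<le>Suc m. ?c i * (if 1 \<le> i then ?b (i - 1) else 0))"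
    unfolding pencil_product_def by (simp add: distrib_left sum.distrib del: sum.atMost_Suc mult_Suc)
  also have "(\<Sum>i\<le>Suc m. ?c i * (if i \<le> m then ?a i else 0)) = (\<Sum>i\<le>m. \<alpha> * ?d i * ?a i)"
    by (simp add: Suc_diff_le mult.assoc del: mult_Suc)
  also have "(\<Sum>i\<le>Suc m. ?c i * (if 1 \<le> i then ?b (i - 1) else 0)) = (\<Sum>i\<le>m. \<beta> * ?d i * ?b i)"
    unfolding sum.atMost_Suc_shift by (simp add: mult_ac del: mult_Suc)
  also have "(\<Sum>i\<le>m. \<alpha> * ?d i * ?a i) + (\<Sum>i\<le>m. \<beta> * ?d i * ?b i) =
      (\<Sum>i\<le>m. \<Sum>q<Suc m * n. (\<alpha> * A $$ (p, q) + \<beta> * B $$ (p, q)) * (?d i * F i q b))"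
    unfolding sum.distrib[symmetric]
  proof (rule sum.cong[OF refl])
    fix i
    show "\<alpha> * ?d i * ?a i + \<beta> * ?d i * ?b i = (\<Sum>q<Suc m * n. (\<alpha> * A $$ (p, q) + \<beta> * B $$ (p, q)) * (?d i * F i q b))"
      unfolding sum_distrib_left sum.distrib[symmetric] by (rule sum.cong[OF refl]) (simp add: algebra_simps)
  qed
  also have "\<dots> = (\<Sum>q<Suc m * n. (\<alpha> * A $$ (p, q) + \<beta> * B $$ (p, q)) * (\<Sum>i\<le>m. ?d i * F i q b))"
    by (subst sum.swap) (simp add: sum_distrib_left del: mult_Suc)
  finally show ?thesis .
qed

text \<open>The last \<open>n\<close> rows of this product.  For a companion pencil, with \<open>N\<^sub>i\<close> the \<open>i\<close>-th block column of the
  identity matrix, these are the coefficients of the original polynomial.\<close>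

definition recovered_coeff :: "nat \<Rightarrow> nat \<Rightarrow> complex mat \<Rightarrow> complex mat \<Rightarrow> (nat \<Rightarrow> nat \<Rightarrow> nat \<Rightarrow> complex) \<Rightarrow>
    nat \<Rightarrow> complex mat" where
  "recovered_coeff n m A B F i = mat n n (\<lambda>(a, b). pencil_product n m A B F i (m * n + a) b)"

text \<open>A kernel vector \<open>v\<close> of the recovered polynomial lifts to the kernel vector
  \<open>\<Sum>i. \<alpha>\<^sup>m\<^sup>-\<^sup>i \<beta>\<^sup>i N\<^sub>i v\<close> of the pencil, because the first \<open>m n\<close> rows of the product vanish, and the lift
  is injective, because the \<open>N\<^sub>i\<close> form an invertible matrix.\<close>

lemma single_eigenvalue_recovered:
  assumes n: "n > 0" and g: "single_block (Suc m * n) A B"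
    and eqs: "\<And>i p b. i \<le> Suc m \<Longrightarrow> p < m * n \<Longrightarrow> b < n \<Longrightarrow> pencil_product n m A B F i p b = 0"
    and inj: "det (mat (Suc m * n) (Suc m * n) (\<lambda>(q, c). F (c div n) q (c mod n))) \<noteq> 0"
  shows "single_eigenvalue n (Suc m) (recovered_coeff n m A B F)"
proof -
  let ?N = "Suc m * n"
  note d = single_blockD[OF g]
  let ?C = "recovered_coeff n m A B F"
  have C: "?C i \<in> carrier_mat n n" for i by (simp add: recovered_coeff_def)
  define T where "T = mat ?N ?N (\<lambda>(q, c). F (c div n) q (c mod n))"
  have T: "T \<in> carrier_mat ?N ?N" by (simp add: T_def)
  \<comment> \<open>\<open>stack f\<close> is the vector with the blocks \<open>f 0, \<dots>, f m\<close>; multiplied by \<open>T\<close> it gives \<open>\<Sum>i. N\<^sub>i (f i)\<close>\<close>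
  define stack where "stack = (\<lambda>f :: nat \<Rightarrow> nat \<Rightarrow> complex. vec ?N (\<lambda>c. f (c div n) (c mod n)))"
  have stack: "stack f \<in> carrier_vec ?N" for f by (simp add: stack_def)
  have stack_i: "stack f $ (i * n + b) = f i b" if "i \<le> m" "b < n" for f i b
    using block_index_less[of i "Suc m" b n] that by (simp add: stack_def del: mult_Suc)
  have Ts: "(T *\<^sub>v stack f) $ q = (\<Sum>i\<le>m. \<Sum>b<n. F i q b * f i b)" if q: "q < ?N" for f q
  proof -
    have "(T *\<^sub>v stack f) $ q = (\<Sum>i<Suc m. \<Sum>b<n. T $$ (q, i * n + b) * stack f $ (i * n + b))"
      unfolding mult_mat_vec_entry[OF T stack q] by (rule sum_blocks)
    also have "\<dots> = (\<Sum>i<Suc m. \<Sum>b<n. F i q b * f i b)"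
    proof (intro sum.cong refl)
      fix i b assume "i \<in> {..<Suc m}" "b \<in> {..<n}"
      then have ib: "i < Suc m" "b < n" by auto
      show "T $$ (q, i * n + b) * stack f $ (i * n + b) = F i q b * f i b"
        using block_index_less[OF ib] q ib stack_i[of i b f] by (simp add: T_def del: mult_Suc)
    qed
    finally show ?thesis by (simp add: lessThan_Suc_atMost)
  qed
  have stack0: "f i b = 0" if "T *\<^sub>v stack f = 0\<^sub>v ?N" "i \<le> m" "b < n" for f i b
  proof -
    have "stack f = 0\<^sub>v ?N" using mult_vec_eq_0_imp[OF T _ stack that(1)] inj by (simp add: T_def del: mult_Suc)
    then show ?thesis using stack_i[OF that(2,3), of f] block_index_less[of i "Suc m" b n] that
      by (simp del: mult_Suc)
  qed
  define lift where "lift = (\<lambda>\<alpha> \<beta> v. T *\<^sub>v stack (\<lambda>i b. \<alpha> ^ (m - i) * \<beta> ^ i * v $ b))"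
  have lift: "lift \<alpha> \<beta> v \<in> carrier_vec ?N" for \<alpha> \<beta> v unfolding lift_def using T stack by auto
  have lift_q: "lift \<alpha> \<beta> v $ q = (\<Sum>b<n. (\<Sum>i\<le>m. \<alpha> ^ (m - i) * \<beta> ^ i * F i q b) * v $ b)" if "q < ?N" for \<alpha> \<beta> v q
    unfolding lift_def Ts[OF that] by (subst sum.swap) (simp add: sum_distrib_right sum_distrib_left mult_ac)
  have lift_0: "v = 0\<^sub>v n" if v: "v \<in> carrier_vec n" and z: "lift \<alpha> \<beta> v = 0\<^sub>v ?N" and ne: "\<alpha> \<noteq> 0 \<or> \<beta> \<noteq> 0" for \<alpha> \<beta> v
  proof (rule vec_eq_0I[OF v])
    fix b assume b: "b < n"
    show "v $ b = 0"
    proof (cases "\<alpha> = 0")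
      case True
      then show ?thesis using stack0[OF z[unfolded lift_def], of m b] b ne by simp
    next
      case False
      then show ?thesis using stack0[OF z[unfolded lift_def], of 0 b] b by simp
    qed
  qed
  have pencil_lift: "pencil A B \<alpha> \<beta> *\<^sub>v lift \<alpha> \<beta> v = 0\<^sub>v ?N"
    if v: "v \<in> carrier_vec n" and z: "coeff_eval n (Suc m) ?C \<alpha> \<beta> *\<^sub>v v = 0\<^sub>v n" for \<alpha> \<beta> v
  proof (rule vec_eq_0I)
    fix p assume p: "p < ?N"
    define S where "S = (\<lambda>q b. \<Sum>i\<le>m. \<alpha> ^ (m - i) * \<beta> ^ i * F i q b)"
    let ?e = "\<lambda>q. \<alpha> * A $$ (p, q) + \<beta> * B $$ (p, q)"
    have "(pencil A B \<alpha> \<beta> *\<^sub>v lift \<alpha> \<beta> v) $ p = (\<Sum>q<?N. ?e q * (\<Sum>b<n. S q b * v $ b))"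
      unfolding mult_mat_vec_entry[OF pencil_carrier[OF d(1,2)] lift p] S_def
      using p by (intro sum.cong refl) (auto simp: pencil_entry[OF d(1,2)] lift_q simp del: mult_Suc)
    also have "\<dots> = (\<Sum>q<?N. \<Sum>b<n. ?e q * S q b * v $ b)"
      by (simp add: sum_distrib_left mult.assoc del: mult_Suc)
    also have "\<dots> = (\<Sum>b<n. (\<Sum>q<?N. ?e q * S q b) * v $ b)"
      by (subst sum.swap) (simp add: sum_distrib_right del: mult_Suc)
    also have "\<dots> = (\<Sum>b<n. (\<Sum>i\<le>Suc m. \<alpha> ^ (Suc m - i) * \<beta> ^ i * pencil_product n m A B F i p b) * v $ b)"
      unfolding S_def by (simp only: pencil_product_sum)
    also have "\<dots> = 0"
    proof (cases "p < m * n")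
      case True
      then show ?thesis using eqs by (intro sum.neutral) (auto intro!: sum.neutral simp del: sum.atMost_Suc)
    next
      case False
      define a where "a = p - m * n"
      have a: "a < n" "p = m * n + a" using p False by (auto simp: a_def)
      have "(\<Sum>b<n. (\<Sum>i\<le>Suc m. \<alpha> ^ (Suc m - i) * \<beta> ^ i * pencil_product n m A B F i p b) * v $ b) =
          (coeff_eval n (Suc m) ?C \<alpha> \<beta> *\<^sub>v v) $ a"
        unfolding mult_mat_vec_entry[OF coeff_eval_carrier v a(1)] using a
        by (intro sum.cong) (auto simp: recovered_coeff_def coeff_eval_def simp del: sum.atMost_Suc)
      then show ?thesis using z a by simp
    qed
    finally show "(pencil A B \<alpha> \<beta> *\<^sub>v lift \<alpha> \<beta> v) $ p = 0" .
  qed (use mult_mat_vec_carrier[OF pencil_carrier[OF d(1,2)] lift] in simp)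
  have "det (coeff_eval n (Suc m) ?C \<alpha> \<beta>) \<noteq> 0" if \<beta>: "\<beta> \<noteq> 0" for \<alpha> \<beta>
  proof (rule det_nonzeroI[OF coeff_eval_carrier])
    fix v assume v: "v \<in> carrier_vec n" "coeff_eval n (Suc m) ?C \<alpha> \<beta> *\<^sub>v v = 0\<^sub>v n"
    have "lift \<alpha> \<beta> v = 0\<^sub>v ?N"
      by (rule mult_vec_eq_0_imp[OF pencil_carrier[OF d(1,2)] d(3)[OF \<beta>] lift pencil_lift[OF v]])
    then show "v = 0\<^sub>v n" using lift_0[OF v(1)] \<beta> by blast
  qed
  moreover have "\<exists>w \<in> carrier_vec n. \<forall>v \<in> carrier_vec n. ?C 0 *\<^sub>v v = 0\<^sub>v n \<and> w \<bullet> v = 0 \<longrightarrow> v = 0\<^sub>v n"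
  proof -
    obtain w where w: "w \<in> carrier_vec ?N" "\<And>v. v \<in> carrier_vec ?N \<Longrightarrow> A *\<^sub>v v = 0\<^sub>v ?N \<Longrightarrow> w \<bullet> v = 0 \<Longrightarrow> v = 0\<^sub>v ?N"
      using d(4) by blast
    define S where "S = (\<lambda>q b. \<Sum>i\<le>m. 1 ^ (m - i) * 0 ^ i * F i q b)"
    define u where "u = vec n (\<lambda>b. \<Sum>q<?N. w $ q * S q b)"
    have "v = 0\<^sub>v n" if v: "v \<in> carrier_vec n" "?C 0 *\<^sub>v v = 0\<^sub>v n" "u \<bullet> v = 0" for v
    proof -
      have "w \<bullet> lift 1 0 v = (\<Sum>q<?N. w $ q * (\<Sum>b<n. S q b * v $ b))"
        unfolding scalar_prod_def S_def using carrier_vecD[OF lift]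
        by (intro sum.cong) (auto simp: lift_q atLeast0LessThan simp del: mult_Suc)
      also have "\<dots> = (\<Sum>q<?N. \<Sum>b<n. w $ q * S q b * v $ b)" by (simp add: sum_distrib_left mult.assoc del: mult_Suc)
      also have "\<dots> = u \<bullet> v"
        using v(1) by (subst sum.swap) (auto simp: u_def scalar_prod_def atLeast0LessThan sum_distrib_right simp del: mult_Suc intro!: sum.cong)
      finally have "w \<bullet> lift 1 0 v = 0" using v(3) by simp
      moreover have "A *\<^sub>v lift 1 0 v = 0\<^sub>v ?N"
        using pencil_lift[OF v(1), of 1 0] v(2) coeff_eval_1_0[OF C, of "Suc m"] pencil_1_0[OF d(1,2)] by (simp del: mult_Suc)
      ultimately have "lift 1 0 v = 0\<^sub>v ?N" by (intro w(2)[OF lift])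
      then show ?thesis using lift_0[OF v(1), of 1 0] by simp
    qed
    then show ?thesis by (intro bexI[of _ u]) (auto simp: u_def)
  qed
  ultimately show ?thesis using C unfolding single_eigenvalue_def by blast
qed

text \<open>The linear system for one column of \<open>N\<^sub>0, \<dots>, N\<^sub>m\<close>, stacked into a vector.  The first \<open>n\<close> rows fix the
  top block of \<open>N\<^sub>0\<close>, which makes the system square; the others state that the first \<open>m n\<close> rows of
  \<open>(\<alpha> A + \<beta> B) (\<Sum>i. \<alpha>\<^sup>m\<^sup>-\<^sup>i \<beta>\<^sup>i N\<^sub>i)\<close> vanish.\<close>

definition block_system :: "nat \<Rightarrow> nat \<Rightarrow> complex mat \<Rightarrow> complex mat \<Rightarrow> complex mat" where
  "block_system n m A B = mat (Suc m * (Suc m * n)) (Suc m * (Suc m * n)) (\<lambda>(e, c).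
     if e < n then (if c = e then 1 else 0)
     else let i = (e - n) div (m * n); p = (e - n) mod (m * n); j = c div (Suc m * n); q = c mod (Suc m * n)
       in if j = i then A $$ (p, q) else if Suc j = i then B $$ (p, q) else 0)"

lemma block_system_carrier [simp]:
  "block_system n m A B \<in> carrier_mat (Suc m * (Suc m * n)) (Suc m * (Suc m * n))"
  by (simp add: block_system_def)

lemma block_system_row_less:
  assumes "i \<le> Suc m" "p < m * n"
  shows "n + (i * (m * n) + p) < Suc m * (Suc m * n)"
proof -
  have "i * (m * n) + p < Suc (Suc m) * (m * n)" using assms by (intro block_index_less) auto
  then have "n + (i * (m * n) + p) < n + Suc (Suc m) * (m * n)" by simp
  also have "\<dots> = Suc m * (Suc m * n)" by (simp add: algebra_simps)
  finally show ?thesis .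
qed

lemma block_system_mult:
  assumes n: "n > 0" and v: "v \<in> carrier_vec (Suc m * (Suc m * n))"
    and F: "\<And>i q. i \<le> m \<Longrightarrow> q < Suc m * n \<Longrightarrow> F i q b = v $ (i * (Suc m * n) + q)"
  shows "e < n \<Longrightarrow> (block_system n m A B *\<^sub>v v) $ e = v $ e"
    and "i \<le> Suc m \<Longrightarrow> p < m * n \<Longrightarrow>
      (block_system n m A B *\<^sub>v v) $ (n + (i * (m * n) + p)) = pencil_product n m A B F i p b"
proof -
  let ?N = "Suc m * n"
  let ?G = "block_system n m A B"
  show "(?G *\<^sub>v v) $ e = v $ e" if e: "e < n"
  proof -
    have l: "e < Suc m * ?N" using e by simp
    have "(?G *\<^sub>v v) $ e = (\<Sum>c<Suc m * ?N. if c = e then v $ e else 0)"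
      unfolding mult_mat_vec_entry[OF block_system_carrier v l]
      using e l by (intro sum.cong refl) (auto simp: block_system_def simp del: mult_Suc)
    then show ?thesis using l by (simp del: mult_Suc)
  qed
  show "(?G *\<^sub>v v) $ (n + (i * (m * n) + p)) = pencil_product n m A B F i p b"
    if i: "i \<le> Suc m" and p: "p < m * n"
  proof -
    let ?e = "n + (i * (m * n) + p)"
    have l: "?e < Suc m * ?N" by (rule block_system_row_less[OF i p])
    have dm: "(i * (m * n) + p) div (m * n) = i" "(i * (m * n) + p) mod (m * n) = p"
      using block_div_mod[OF p, of i] by simp_all
    have G: "?G $$ (?e, j * ?N + q) = (if j = i then A $$ (p, q) else if Suc j = i then B $$ (p, q) else 0)"
      if "j < Suc m" "q < ?N" for j q
      using l block_index_less[OF that] that dm block_div_mod[OF that(2), of j]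
      by (simp add: block_system_def Let_def del: mult_Suc)
    have "(?G *\<^sub>v v) $ ?e = (\<Sum>j<Suc m. \<Sum>q<?N. ?G $$ (?e, j * ?N + q) * v $ (j * ?N + q))"
      unfolding mult_mat_vec_entry[OF block_system_carrier v l] by (rule sum_blocks)
    also have "\<dots> = (\<Sum>j<Suc m. (if j = i then \<Sum>q<?N. A $$ (p, q) * F i q b else 0) +
        (if Suc j = i then \<Sum>q<?N. B $$ (p, q) * F j q b else 0))"
      using F by (intro sum.cong refl) (auto simp: G simp del: mult_Suc)
    also have "\<dots> = (\<Sum>j<Suc m. if j = i then \<Sum>q<?N. A $$ (p, q) * F i q b else 0) +
        (\<Sum>j<Suc m. if Suc j = i then \<Sum>q<?N. B $$ (p, q) * F j q b else 0)"
      by (rule sum.distrib)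
    also have "(\<Sum>j<Suc m. if j = i then \<Sum>q<?N. A $$ (p, q) * F i q b else 0) =
        (if i \<le> m then \<Sum>q<?N. A $$ (p, q) * F i q b else 0)"
      by (simp add: less_Suc_eq_le del: mult_Suc sum.lessThan_Suc)
    also have "(\<Sum>j<Suc m. if Suc j = i then \<Sum>q<?N. B $$ (p, q) * F j q b else 0) =
        (if 1 \<le> i then \<Sum>q<?N. B $$ (p, q) * F (i - 1) q b else 0)"
    proof (cases i)
      case (Suc i')
      then show ?thesis using i by (simp del: mult_Suc sum.lessThan_Suc)
    qed (simp del: mult_Suc)
    finally show ?thesis unfolding pencil_product_def .
  qed
qed

lemma pencil_product_companion:
  assumes i: "i \<le> Suc m" and p: "p < m * n"
  shows "pencil_product n m (comp_const n m C) (comp_lin n m C) F i p b =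
    (if i \<le> m then F i (p + n) b else 0) - (if 1 \<le> i then F (i - 1) p b else 0)"
proof -
  let ?N = "Suc m * n"
  have pl: "p < ?N" "p + n < ?N" using p by auto
  have "(\<Sum>q<?N. comp_const n m C $$ (p, q) * F i q b) = (\<Sum>q<?N. if q = p + n then F i (p + n) b else 0)" for i
    using p pl by (intro sum.cong refl) (auto simp: comp_const_def simp del: mult_Suc)
  moreover have "(\<Sum>q<?N. comp_lin n m C $$ (p, q) * F i q b) = (\<Sum>q<?N. if q = p then - F i p b else 0)" for i
    using p pl by (intro sum.cong refl) (auto simp: comp_lin_def simp del: mult_Suc)
  ultimately show ?thesis using pl unfolding pencil_product_def by (simp del: mult_Suc)
qed

text \<open>For the companion pencil the homogeneous system says that \<open>N\<^sub>i\<close> is \<open>N\<^sub>i\<^sub>-\<^sub>1\<close> shifted down by one block,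
  with an arbitrary top block, that \<open>N\<^sub>0\<close> vanishes and that all but the last block of \<open>N\<^sub>m\<close> vanishes.  The blocks on and below the
  diagonal are therefore zero by ascending, those above it by descending induction on \<open>i\<close>.\<close>

lemma det_block_system_companion:
  assumes n: "n > 0"
  shows "det (block_system n m (comp_const n m C) (comp_lin n m C)) \<noteq> 0"
proof (rule det_nonzeroI[OF block_system_carrier])
  let ?N = "Suc m * n"
  let ?G = "block_system n m (comp_const n m C) (comp_lin n m C)"
  fix v assume v: "v \<in> carrier_vec (Suc m * ?N)" "?G *\<^sub>v v = 0\<^sub>v (Suc m * ?N)"
  define F where "F = (\<lambda>i q (b :: nat). v $ (i * ?N + q))"
  note sys = block_system_mult[OF n v(1), of F 0, unfolded F_def, OF refl, folded F_def]
  have top: "F 0 q 0 = 0" if "q < n" for q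
  proof -
    have "q < Suc m * ?N" using that by simp
    then have "v $ q = 0" using sys(1)[OF that, of "comp_const n m C" "comp_lin n m C"] v(2) by (simp del: mult_Suc)
    then show ?thesis by (simp add: F_def)
  qed
  have eq: "(if i \<le> m then F i (p + n) 0 else 0) = (if 1 \<le> i then F (i - 1) p 0 else 0)"
    if "i \<le> Suc m" "p < m * n" for i p
    using sys(2)[OF that, of "comp_const n m C" "comp_lin n m C"] v(2) block_system_row_less[OF that]
      pencil_product_companion[OF that, of C F 0] by (simp del: mult_Suc)
  have low: "F i q 0 = 0" if "i \<le> m" "q < ?N" "i * n \<le> q" for i q
    using that
  proof (induction i arbitrary: q)
    case 0
    show ?case
    proof (cases "q < n")
      case False
      then show ?thesis using eq[of 0 "q - n"] 0 by simp
    qed (rule top)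
  next
    case (Suc i)
    have "F (Suc i) q 0 = F i (q - n) 0" using eq[of "Suc i" "q - n"] Suc.prems by simp
    also have "\<dots> = 0" using Suc.prems by (intro Suc.IH) auto
    finally show ?case .
  qed
  have up: "F (m - j) q 0 = 0" if "j \<le> m" "q < (m - j) * n" for j q
    using that
  proof (induction j arbitrary: q)
    case 0
    then show ?case using eq[of "Suc m" q] by simp
  next
    case (Suc j)
    have j: "m - j = Suc (m - Suc j)" using Suc.prems by simp
    have "(m - Suc j) * n \<le> m * n" by (intro mult_le_mono1) simp
    then have q: "q < m * n" using Suc.prems by linarith
    have "F (m - j) (q + n) 0 = F (m - j - 1) q 0" using eq[of "m - j" q] q Suc.prems(1) by simp
    then have "F (m - Suc j) q 0 = F (m - j) (q + n) 0" by simp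
    also have "\<dots> = 0" using Suc.prems j by (intro Suc.IH) auto
    finally show ?case .
  qed
  have all: "F i q 0 = 0" if "i \<le> m" "q < ?N" for i q
  proof (cases "i * n \<le> q")
    case False
    then show ?thesis using up[of "m - i" q] that by simp
  qed (use low that in auto)
  have "v $ c = 0" if c: "c < Suc m * ?N" for c
  proof -
    have N: "?N > 0" using n by simp
    have "c div ?N < Suc m" using c N by (simp add: div_less_iff_less_mult mult.commute del: mult_Suc)
    moreover have "c mod ?N < ?N" using N by (rule mod_less_divisor)
    ultimately have F0: "F (c div ?N) (c mod ?N) 0 = 0" using all by (simp del: mult_Suc)
    have e: "c div ?N * ?N + c mod ?N = c" by (rule div_mult_mod_eq)
    show ?thesis using F0 unfolding F_def e .
  qed
  then show "v = 0\<^sub>v (Suc m * ?N)" by (rule vec_eq_0I[OF v(1)])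
qed

text \<open>The first \<open>n\<close> columns of the adjugate solve the block system up to the factor \<open>det G\<close>.  They are used instead
  of the solution itself because they are polynomials in the entries of the system, hence continuous.\<close>

lemma adj_block_system_companion:
  fixes C :: "nat \<Rightarrow> complex mat"
  assumes n: "n > 0" and i: "i \<le> m" and q: "q < Suc m * n" and b: "b < n"
  defines "G \<equiv> block_system n m (comp_const n m C) (comp_lin n m C)"
  shows "adj_mat G $$ (i * (Suc m * n) + q, b) = (if q = i * n + b then det G else 0)"
proof -
  let ?N = "Suc m * n"
  have N: "?N > 0" using n by simp
  have G: "G \<in> carrier_mat (Suc m * ?N) (Suc m * ?N)" unfolding G_def by (rule block_system_carrier)
  define F where "F = (\<lambda>i q b. if q = i * n + b then 1 else (0 :: complex))"
  define v where "v = vec (Suc m * ?N) (\<lambda>c. F (c div ?N) (c mod ?N) b)"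
  have v: "v \<in> carrier_vec (Suc m * ?N)" by (simp add: v_def)
  have vF: "F i q b = v $ (i * ?N + q)" if "i \<le> m" "q < ?N" for i q
    using block_index_less[of i "Suc m" q ?N] that block_div_mod[of q ?N i] by (simp add: v_def del: mult_Suc)
  have bN: "b < ?N" "b < Suc m * ?N" using b by auto
  have "G *\<^sub>v v = unit_vec (Suc m * ?N) b"
  proof (rule eq_vecI)
    fix e assume "e < dim_vec (unit_vec (Suc m * ?N) b :: complex vec)"
    then have e: "e < Suc m * ?N" by simp
    show "(G *\<^sub>v v) $ e = unit_vec (Suc m * ?N) b $ e"
    proof (cases "e < n")
      case True
      then have "e < ?N" by simp
      then have "v $ e = F 0 e b" using vF[of 0 e] by simp
      then show ?thesis using block_system_mult(1)[of n v m F b e, OF n v vF True] True e bN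
        unfolding G_def by (simp add: F_def del: mult_Suc)
    next
      case False
      define j where "j = (e - n) div (m * n)"
      define p where "p = (e - n) mod (m * n)"
      have "e - n < Suc (Suc m) * (m * n)" using e False by (simp add: algebra_simps)
      then have mn: "m * n > 0" by (cases "m * n = 0") auto
      have p: "p < m * n" unfolding p_def using mn by (rule mod_less_divisor)
      have "j < Suc (Suc m)" unfolding j_def using \<open>e - n < Suc (Suc m) * (m * n)\<close> mn
        by (simp add: div_less_iff_less_mult mult.commute del: mult_Suc)
      then have j: "j \<le> Suc m" by simp
      have "e - n = j * (m * n) + p" unfolding j_def p_def by (rule div_mult_mod_eq[symmetric])
      then have ee: "e = n + (j * (m * n) + p)" using False by simp
      have "(G *\<^sub>v v) $ e = pencil_product n m (comp_const n m C) (comp_lin n m C) F j p b"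
        unfolding G_def ee by (rule block_system_mult(2)[where F = F and b = b, OF n v vF j p])
      also have "\<dots> = (if j \<le> m then F j (p + n) b else 0) - (if 1 \<le> j then F (j - 1) p b else 0)"
        by (rule pencil_product_companion[OF j p])
      also have "\<dots> = 0"
      proof (cases j)
        case 0
        then show ?thesis using b by (simp add: F_def)
      next
        case (Suc j')
        show ?thesis
        proof (cases "j \<le> m")
          case True
          then show ?thesis using Suc by (auto simp: F_def)
        next
          case False
          then have "j' = m" using j Suc by simp
          then show ?thesis using p Suc by (auto simp: F_def)
        qed
      qed
      finally show ?thesis using False b e by simp
    qed
  qed (use G in auto)
  then have "adj_mat G *\<^sub>v unit_vec (Suc m * ?N) b = adj_mat G *\<^sub>v (G *\<^sub>v v)" by simp
  also have "\<dots> = (adj_mat G * G) *\<^sub>v v"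
    by (rule assoc_mult_mat_vec[symmetric, OF adj_mat(1)[OF G] G v])
  also have "\<dots> = (det G \<cdot>\<^sub>m 1\<^sub>m (Suc m * ?N)) *\<^sub>v v" by (simp only: adj_mat(3)[OF G])
  also have "\<dots> = det G \<cdot>\<^sub>v v" using v by (subst smult_mat_mult_vec[of _ "Suc m * ?N" "Suc m * ?N"]) auto
  finally have e: "adj_mat G *\<^sub>v unit_vec (Suc m * ?N) b = det G \<cdot>\<^sub>v v" .
  have l: "i * ?N + q < Suc m * ?N" using i q by (intro block_index_less) auto
  have "(adj_mat G *\<^sub>v unit_vec (Suc m * ?N) b) $ (i * ?N + q) = adj_mat G $$ (i * ?N + q, b)"
    using adj_mat(1)[OF G] l bN by simp
  moreover have "(det G \<cdot>\<^sub>v v) $ (i * ?N + q) = det G * F i q b" using vF[OF i q] l v by simp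
  ultimately have "adj_mat G $$ (i * ?N + q, b) = det G * F i q b" using e by metis
  then show ?thesis by (simp add: F_def del: mult_Suc)
qed

lemma tendsto_det:
  fixes X :: "nat \<Rightarrow> complex mat"
  assumes "\<And>t. X t \<in> carrier_mat n n" "L \<in> carrier_mat n n"
    and "\<And>i j. i < n \<Longrightarrow> j < n \<Longrightarrow> (\<lambda>t. X t $$ (i, j)) \<longlonglongrightarrow> L $$ (i, j)"
  shows "(\<lambda>t. det (X t)) \<longlonglongrightarrow> det L"
proof -
  have "(\<lambda>t. \<Sum>p | p permutes {0..<n}. signof p * (\<Prod>i = 0..<n. X t $$ (i, p i))) \<longlonglongrightarrow>
    (\<Sum>p | p permutes {0..<n}. signof p * (\<Prod>i = 0..<n. L $$ (i, p i)))"
  proof (intro tendsto_sum tendsto_mult tendsto_const tendsto_prod assms(3))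
    fix p i assume "p \<in> {p. p permutes {0..<n}}" "i \<in> {0..<n}"
    then show "i < n" "p i < n" using permutes_in_image[of p "{0..<n}" i] by auto
  qed
  then show ?thesis unfolding det_def'[OF assms(1)] det_def'[OF assms(2)] .
qed

lemma tendsto_adj_mat:
  fixes X :: "nat \<Rightarrow> complex mat"
  assumes "\<And>t. X t \<in> carrier_mat n n" "L \<in> carrier_mat n n"
    and lim: "\<And>i j. i < n \<Longrightarrow> j < n \<Longrightarrow> (\<lambda>t. X t $$ (i, j)) \<longlonglongrightarrow> L $$ (i, j)" and ij: "i < n" "j < n"
  shows "(\<lambda>t. adj_mat (X t) $$ (i, j)) \<longlonglongrightarrow> adj_mat L $$ (i, j)"
proof -
  have e: "adj_mat Y $$ (i, j) = (-1) ^ (j + i) * det (mat_delete Y j i)" if "Y \<in> carrier_mat n n" for Y :: "complex mat"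
    using that ij by (auto simp: adj_mat_def cofactor_def)
  have "(\<lambda>t. det (mat_delete (X t) j i)) \<longlonglongrightarrow> det (mat_delete L j i)"
  proof (rule tendsto_det)
    show "(\<lambda>t. mat_delete (X t) j i $$ (a, b)) \<longlonglongrightarrow> mat_delete L j i $$ (a, b)" if "a < n - 1" "b < n - 1" for a b
    proof -
      have d: "mat_delete Y j i $$ (a, b) = Y $$ (if a < j then a else Suc a, if b < i then b else Suc b)"
        if "Y \<in> carrier_mat n n" for Y :: "complex mat"
        using that \<open>a < n - 1\<close> \<open>b < n - 1\<close> by (auto simp: mat_delete_def)
      show ?thesis unfolding d[OF assms(1)] d[OF assms(2)] using that by (intro lim) auto
    qed
  qed (rule mat_delete_carrier[OF assms(1)], rule mat_delete_carrier[OF assms(2)])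
  then show ?thesis unfolding e[OF assms(1)] e[OF assms(2)] by (intro tendsto_mult tendsto_const)
qed

text \<open>The companion pencil is singular, hence a limit of pencils with a single Jordan block.  The block system of
  such a pencil is close to the one of the companion pencil, so its solution is close to the block columns of
  the identity matrix, and the recovered polynomial is close to the given one.\<close>

theorem singular_coeffs_limit:
  assumes n: "n > 0" and C: "\<And>i. i \<le> Suc m \<Longrightarrow> C i \<in> carrier_mat n n"
    and sing: "\<And>\<mu>. det (coeff_eval n (Suc m) C 1 \<mu>) = 0"
  shows "\<exists>S. (\<forall>t. single_eigenvalue n (Suc m) (S t)) \<and>
    (\<forall>i\<le>Suc m. \<forall>a<n. \<forall>b<n. (\<lambda>t. S t i $$ (a, b)) \<longlonglongrightarrow> C i $$ (a, b))"
proof -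
  let ?N = "Suc m * n"
  let ?A = "comp_const n m C" and ?B = "comp_lin n m C"
  have "single_block_limit ?N ?A ?B"
    using companion_singular[OF n sing] by (intro singular_pencil_single_block_limit comp_carrier)
  then have "\<forall>t. \<exists>A B. single_block ?N A B \<and> mat_l1 (A - ?A) < 1 / real (Suc t) \<and> mat_l1 (B - ?B) < 1 / real (Suc t)"
    unfolding single_block_limit_def by (simp del: mult_Suc of_nat_Suc)
  then obtain A B where g: "\<And>t. single_block ?N (A t) (B t)"
    and smallA: "\<And>t. mat_l1 (A t - ?A) < 1 / real (Suc t)" and smallB: "\<And>t. mat_l1 (B t - ?B) < 1 / real (Suc t)"
    by metis
  note cA = single_blockD(1)[OF g] and cB = single_blockD(2)[OF g]
  have conv: "(\<lambda>t. X t $$ (p, q)) \<longlonglongrightarrow> L $$ (p, q)"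
    if X: "\<And>t. X t \<in> carrier_mat ?N ?N" "L \<in> carrier_mat ?N ?N" "\<And>t. mat_l1 (X t - L) < 1 / real (Suc t)"
      and pq: "p < ?N" "q < ?N" for X :: "nat \<Rightarrow> complex mat" and L p q
  proof -
    have "norm (X t $$ (p, q) - L $$ (p, q)) \<le> 1 / real (Suc t)" for t
      using cmod_entry_le_mat_l1[of p "X t - L" q] X(1)[of t] X(2) X(3)[of t] pq
      by (simp del: mult_Suc of_nat_Suc)
    then have "(\<lambda>t. X t $$ (p, q) - L $$ (p, q)) \<longlonglongrightarrow> 0"
      by (intro tendsto_0_le[OF LIMSEQ_inverse_real_of_nat, of _ 1])
        (auto simp: inverse_eq_divide simp del: of_nat_Suc mult_Suc)
    then show ?thesis by (rule LIM_zero_cancel)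
  qed
  note convA = conv[OF cA comp_carrier(1) smallA] and convB = conv[OF cB comp_carrier(2) smallB]
  define G where "G = (\<lambda>t. block_system n m (A t) (B t))"
  define G0 where "G0 = block_system n m ?A ?B"
  have cG: "G t \<in> carrier_mat (Suc m * ?N) (Suc m * ?N)" for t unfolding G_def by (rule block_system_carrier)
  have cG0: "G0 \<in> carrier_mat (Suc m * ?N) (Suc m * ?N)" unfolding G0_def by (rule block_system_carrier)
  have convG: "(\<lambda>t. G t $$ (e, c)) \<longlonglongrightarrow> G0 $$ (e, c)" if ec: "e < Suc m * ?N" "c < Suc m * ?N" for e c
  proof (cases "e < n")
    case True
    then show ?thesis using ec by (simp add: G_def G0_def block_system_def del: mult_Suc)
  next
    case False
    define i p j q where "i = (e - n) div (m * n)" and "p = (e - n) mod (m * n)"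
      and "j = c div ?N" and "q = c mod ?N"
    have "e - n < Suc (Suc m) * (m * n)" using ec False by (simp add: algebra_simps)
    then have mn: "m * n > 0" by (cases "m * n = 0") auto
    then have "p < m * n" unfolding p_def by (rule mod_less_divisor)
    then have p: "p < ?N" by simp
    have q: "q < ?N" unfolding q_def using n by (intro mod_less_divisor) simp
    have e: "block_system n m X Y $$ (e, c) = (if j = i then X $$ (p, q) else if Suc j = i then Y $$ (p, q) else 0)" for X Y
      using ec False unfolding block_system_def i_def p_def j_def q_def Let_def by (simp del: mult_Suc)
    show ?thesis unfolding G_def G0_def e using convA[OF p q] convB[OF p q] by auto
  qed
  define d where "d = det G0"
  have d: "d \<noteq> 0" unfolding d_def G0_def by (rule det_block_system_companion[OF n])
  \<comment> \<open>dividing by the limit \<open>d\<close> of the determinants keeps the solutions continuous without a division by \<open>det (G t)\<close>\<close>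
  define F where "F = (\<lambda>t i q b. adj_mat (G t) $$ (i * ?N + q, b) / d)"
  define F0 where "F0 = (\<lambda>i q b. if q = i * n + b then 1 else (0 :: complex))"
  have convF: "(\<lambda>t. F t i q b) \<longlonglongrightarrow> F0 i q b" if "i \<le> m" "q < ?N" "b < n" for i q b
  proof -
    have l: "i * ?N + q < Suc m * ?N" "b < Suc m * ?N" using that block_index_less[of i "Suc m" q ?N] by auto
    have "(\<lambda>t. adj_mat (G t) $$ (i * ?N + q, b) / d) \<longlonglongrightarrow> adj_mat G0 $$ (i * ?N + q, b) / d"
      using d by (intro tendsto_divide tendsto_const tendsto_adj_mat[OF cG cG0 convG l]) auto
    moreover have "adj_mat G0 $$ (i * ?N + q, b) / d = F0 i q b"
      using adj_block_system_companion[OF n that, of C, folded G0_def, folded d_def] d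
      by (simp add: F0_def del: mult_Suc)
    ultimately show ?thesis unfolding F_def by (simp only:)
  qed
  have eqs: "pencil_product n m (A t) (B t) (F t) i p b = 0" if ipb: "i \<le> Suc m" "p < m * n" "b < n" for t i p b
  proof -
    define v where "v = (1 / d) \<cdot>\<^sub>v col (adj_mat (G t)) b"
    have adj: "adj_mat (G t) \<in> carrier_mat (Suc m * ?N) (Suc m * ?N)" by (rule adj_mat(1)[OF cG])
    have bN: "b < Suc m * ?N" using ipb by simp
    have v: "v \<in> carrier_vec (Suc m * ?N)" unfolding v_def using col_carrier_vec[OF bN adj] by simp
    have vF: "F t i q b = v $ (i * ?N + q)" if "i \<le> m" "q < ?N" for i q
      using block_index_less[of i "Suc m" q ?N] that adj bN by (simp add: v_def F_def del: mult_Suc)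
    let ?e = "n + (i * (m * n) + p)"
    have l: "?e < Suc m * ?N" by (rule block_system_row_less[OF ipb(1,2)])
    have "pencil_product n m (A t) (B t) (F t) i p b = (G t *\<^sub>v v) $ ?e"
      unfolding G_def by (rule block_system_mult(2)[where F = "F t" and b = b, OF n v vF ipb(1,2), symmetric])
    also have "G t *\<^sub>v v = (1 / d) \<cdot>\<^sub>v (G t *\<^sub>v col (adj_mat (G t)) b)"
      unfolding v_def by (rule mult_mat_vec[OF cG col_carrier_vec[OF bN adj]])
    also have "G t *\<^sub>v col (adj_mat (G t)) b = col (G t * adj_mat (G t)) b"
      using bN by (intro col_mult2[symmetric, OF cG adj])
    also have "\<dots> = col (det (G t) \<cdot>\<^sub>m 1\<^sub>m (Suc m * ?N)) b" by (simp only: adj_mat(2)[OF cG])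
    also have "((1 / d) \<cdot>\<^sub>v \<dots>) $ ?e = 0" using l bN ipb by (simp del: mult_Suc)
    finally show ?thesis .
  qed
  \<comment> \<open>the matrix \<open>[N\<^sub>0, \<dots>, N\<^sub>m]\<close>, which tends to the identity matrix\<close>
  define T where "T = (\<lambda>t. mat ?N ?N (\<lambda>(q, c). F t (c div n) q (c mod n)))"
  have "(\<lambda>t. det (T t)) \<longlonglongrightarrow> det (1\<^sub>m ?N)"
  proof (rule tendsto_det)
    fix q c assume qc: "q < ?N" "c < ?N"
    have "c div n \<le> m" using qc n by (simp add: div_less_iff_less_mult flip: less_Suc_eq_le)
    then have "(\<lambda>t. F t (c div n) q (c mod n)) \<longlonglongrightarrow> F0 (c div n) q (c mod n)" using qc n by (intro convF) auto
    then show "(\<lambda>t. T t $$ (q, c)) \<longlonglongrightarrow> 1\<^sub>m ?N $$ (q, c)"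
      using qc by (simp add: T_def F0_def del: mult_Suc)
  qed (auto simp: T_def)
  then have "(\<lambda>t. det (T t)) \<longlonglongrightarrow> 1" by simp
  then have "eventually (\<lambda>t. det (T t) \<noteq> 0) sequentially" by (rule tendsto_imp_eventually_ne) simp
  then obtain t0 where t0: "\<And>t. t \<ge> t0 \<Longrightarrow> det (T t) \<noteq> 0" by (auto simp: eventually_sequentially)
  define S0 where "S0 = (\<lambda>t. recovered_coeff n m (A t) (B t) (F t))"
  have good: "single_eigenvalue n (Suc m) (S0 (t + t0))" for t
    unfolding S0_def using t0[of "t + t0", unfolded T_def] by (intro single_eigenvalue_recovered[OF n g eqs]) auto
  have "(\<lambda>t. S0 t i $$ (a, b)) \<longlonglongrightarrow> C i $$ (a, b)" if i: "i \<le> Suc m" and ab: "a < n" "b < n" for i a b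
  proof -
    let ?p = "m * n + a"
    have p: "?p < ?N" using ab by simp
    have l1: "(\<lambda>t. \<Sum>q<?N. A t $$ (?p, q) * F t i q b) \<longlonglongrightarrow> (\<Sum>q<?N. ?A $$ (?p, q) * F0 i q b)" if "i \<le> m" for i
      using that ab p by (intro tendsto_sum tendsto_mult convA convF) auto
    have l2: "(\<lambda>t. \<Sum>q<?N. B t $$ (?p, q) * F t i q b) \<longlonglongrightarrow> (\<Sum>q<?N. ?B $$ (?p, q) * F0 i q b)" if "i \<le> m" for i
      using that ab p by (intro tendsto_sum tendsto_mult convB convF) auto
    have "(\<lambda>t. pencil_product n m (A t) (B t) (F t) i ?p b) \<longlonglongrightarrow> pencil_product n m ?A ?B F0 i ?p b"
      unfolding pencil_product_def using i by (intro tendsto_add) (auto intro!: l1 l2 simp del: mult_Suc)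
    moreover have "pencil_product n m ?A ?B F0 i ?p b = C i $$ (a, b)"
    proof -
      have s: "(\<Sum>q<?N. X $$ (?p, q) * F0 i q b) = X $$ (?p, i * n + b)" if "i \<le> m" for i and X :: "complex mat"
      proof -
        have "i * n + b < ?N" using that ab by (intro block_index_less) auto
        moreover have "(\<Sum>q<?N. X $$ (?p, q) * F0 i q b) = (\<Sum>q<?N. if q = i * n + b then X $$ (?p, i * n + b) else 0)"
          by (intro sum.cong refl) (auto simp: F0_def)
        ultimately show ?thesis by (simp del: mult_Suc)
      qed
      have A: "?A $$ (?p, i * n + b) = C i $$ (a, b)" if "i \<le> m" for i
        using that p ab block_index_less[of i "Suc m" b n] by (simp add: comp_const_def del: mult_Suc)
      have B: "?B $$ (?p, i * n + b) = (if i = m then C (Suc m) $$ (a, b) else 0)" if "i \<le> m" for i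
      proof -
        have "m * n \<le> i * n + b \<longleftrightarrow> i = m" using that block_index_less[of i m b n] ab by (cases "i < m") auto
        then show ?thesis using that p ab block_index_less[of i "Suc m" b n] by (auto simp: comp_lin_def simp del: mult_Suc)
      qed
      show ?thesis
      proof (cases "i \<le> m")
        case True
        have "(if 1 \<le> i then \<Sum>q<?N. ?B $$ (?p, q) * F0 (i - 1) q b else 0) = 0"
          using s[of "i - 1" ?B] B[of "i - 1"] True by auto
        then show ?thesis unfolding pencil_product_def using True s[OF True, of ?A] A[OF True] by (simp del: mult_Suc)
      next
        case False
        then have "i = Suc m" using i by simp
        then show ?thesis unfolding pencil_product_def using s[of m ?B] B[of m] by (simp del: mult_Suc)
      qed
    qed
    ultimately show ?thesis unfolding S0_def recovered_coeff_def using ab by simp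
  qed
  then have "(\<lambda>t. S0 (t + t0) i $$ (a, b)) \<longlonglongrightarrow> C i $$ (a, b)" if "i \<le> Suc m" "a < n" "b < n" for i a b
    using that by (intro LIMSEQ_ignore_initial_segment) auto
  with good show ?thesis by (intro exI[of _ "\<lambda>t. S0 (t + t0)"]) auto
qed

section \<open>Elementary divisors and root vectors\<close>

definition taylor_coeff :: "complex \<Rightarrow> complex poly \<Rightarrow> nat \<Rightarrow> complex" where
  "taylor_coeff z q i = coeff (q \<circ>\<^sub>p [:z, 1:]) i"

lemma taylor_coeff_sum: "taylor_coeff z (\<Sum>x\<in>I. f x) i = (\<Sum>x\<in>I. taylor_coeff z (f x) i)"
  by (simp add: taylor_coeff_def pcompose_sum coeff_sum)

lemma taylor_coeff_monom: "taylor_coeff z (monom c l) i = c * taylor_coeff z (monom 1 l) i"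
proof -
  have "monom c l = smult c (monom 1 l)" by (simp add: smult_monom)
  then show ?thesis by (simp add: taylor_coeff_def pcompose_smult)
qed

lemma taylor_coeff_mult:
  "taylor_coeff z (p * q) j = (\<Sum>i\<le>j. taylor_coeff z p i * taylor_coeff z q (j - i))"
  by (simp add: taylor_coeff_def pcompose_mult coeff_mult)

lemma taylor_coeff_0 [simp]: "taylor_coeff z q 0 = poly q z"
  by (simp add: taylor_coeff_def poly_0_coeff_0[symmetric] poly_pcompose)

lemma taylor_coeff_at_0: "taylor_coeff 0 q i = coeff q i"
  by (simp add: taylor_coeff_def pcompose_idR)

lemma taylor_coeff_eq_0:
  assumes "degree q < i"
  shows "taylor_coeff z q i = 0"
proof -
  have "degree (q \<circ>\<^sub>p [:z, 1:]) \<le> degree q * degree [:z, 1:]" by (rule degree_pcompose_le)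
  then show ?thesis using assms unfolding taylor_coeff_def by (intro coeff_eq_0) simp
qed

lemma taylor_coeff_higher_pderiv: "taylor_coeff z q i = poly ((pderiv ^^ i) q) z / fact i"
proof -
  have "(pderiv ^^ i) (q \<circ>\<^sub>p [:z, 1:]) = ((pderiv ^^ i) q) \<circ>\<^sub>p [:z, 1:]"
    by (induction i) (simp_all add: pderiv_pcompose pderiv_pCons)
  moreover have "poly ((pderiv ^^ i) (q \<circ>\<^sub>p [:z, 1:])) 0 = fact i * coeff (q \<circ>\<^sub>p [:z, 1:]) i"
    by (simp add: poly_0_coeff_0 coeff_higher_pderiv pochhammer_fact)
  ultimately show ?thesis by (simp add: taylor_coeff_def poly_pcompose)
qed

lemma shift_back: "(q \<circ>\<^sub>p [:z, 1:]) \<circ>\<^sub>p [:-z, 1:] = (q :: complex poly)"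
  "(q \<circ>\<^sub>p [:-z, 1:]) \<circ>\<^sub>p [:z, 1:] = q"
proof -
  have "[:z, 1:] \<circ>\<^sub>p [:-z, 1:] = [:0, 1:]" "[:-z, 1:] \<circ>\<^sub>p [:z, 1:] = [:0, 1:]"
    by (simp_all add: pcompose_pCons)
  then show "(q \<circ>\<^sub>p [:z, 1:]) \<circ>\<^sub>p [:-z, 1:] = q" "(q \<circ>\<^sub>p [:-z, 1:]) \<circ>\<^sub>p [:z, 1:] = q"
    by (simp_all add: pcompose_assoc[symmetric] pcompose_idR)
qed

text \<open>Substituting \<open>\<lambda> + z\<close> for \<open>\<lambda>\<close> turns the power of \<open>\<lambda> - z\<close> into a monomial.\<close>

lemma linear_power_dvd_iff:
  "[:-z, 1:] ^ m dvd q \<longleftrightarrow> (\<forall>j<m. taylor_coeff z q j = 0)"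
proof -
  have h: "([:-z, 1:] ^ m) \<circ>\<^sub>p [:z, 1:] = monom 1 m"
    by (simp add: pcompose_hom.hom_power pcompose_pCons monom_altdef)
  have "[:-z, 1:] ^ m dvd q \<longleftrightarrow> monom 1 m dvd q \<circ>\<^sub>p [:z, 1:]"
  proof
    assume "[:-z, 1:] ^ m dvd q"
    then obtain g where "q = [:-z, 1:] ^ m * g" by (elim dvdE)
    then have "q \<circ>\<^sub>p [:z, 1:] = monom 1 m * (g \<circ>\<^sub>p [:z, 1:])" by (simp add: pcompose_mult h)
    then show "monom 1 m dvd q \<circ>\<^sub>p [:z, 1:]" by simp
  next
    assume "monom 1 m dvd q \<circ>\<^sub>p [:z, 1:]"
    then obtain g where g: "q \<circ>\<^sub>p [:z, 1:] = monom 1 m * g" by (elim dvdE)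
    have "q = (q \<circ>\<^sub>p [:z, 1:]) \<circ>\<^sub>p [:-z, 1:]" by (simp add: shift_back)
    also have "\<dots> = (([:-z, 1:] ^ m) \<circ>\<^sub>p [:z, 1:]) \<circ>\<^sub>p [:-z, 1:] * (g \<circ>\<^sub>p [:-z, 1:])"
      unfolding g h by (simp add: pcompose_mult)
    finally show "[:-z, 1:] ^ m dvd q" unfolding shift_back by (metis dvd_triv_left)
  qed
  then show ?thesis by (simp add: monom_1_dvd_iff' taylor_coeff_def)
qed

lemma poly_taylor:
  assumes "degree q \<le> k"
  shows "poly q (z + \<mu>) = (\<Sum>i\<le>k. \<mu> ^ i * taylor_coeff z q i)"
proof -
  have "degree (q \<circ>\<^sub>p [:z, 1:]) \<le> k" using degree_pcompose_le[of q "[:z, 1:]"] assms by simp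
  then have s: "(\<Sum>i\<le>k. monom (taylor_coeff z q i) i) = q \<circ>\<^sub>p [:z, 1:]"
    unfolding taylor_coeff_def by (rule poly_as_sum_of_monoms')
  have "poly q (z + \<mu>) = poly (q \<circ>\<^sub>p [:z, 1:]) \<mu>" by (simp add: poly_pcompose)
  also have "\<dots> = (\<Sum>i\<le>k. \<mu> ^ i * taylor_coeff z q i)"
    unfolding s[symmetric] by (simp add: poly_sum poly_monom mult.commute)
  finally show ?thesis .
qed

lemma matrix_poly_carrier [simp]: "matrix_poly n k C \<in> carrier_mat n n"
  by (simp add: matrix_poly_def)

lemma matrix_poly_entry:
  "a < n \<Longrightarrow> b < n \<Longrightarrow> matrix_poly n k C $$ (a, b) = (\<Sum>l\<le>k. monom (C l $$ (a, b)) l)"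
  by (simp add: matrix_poly_def)

lemma degree_matrix_poly:
  assumes "a < n" "b < n"
  shows "degree (matrix_poly n k C $$ (a, b)) \<le> k"
  unfolding matrix_poly_entry[OF assms]
  by (intro degree_sum_le) (auto intro: order.trans[OF degree_monom_le])

lemma coeff_matrix_poly:
  assumes "a < n" "b < n" "l \<le> k"
  shows "coeff (matrix_poly n k C $$ (a, b)) l = C l $$ (a, b)"
proof -
  have "coeff (matrix_poly n k C $$ (a, b)) l = (\<Sum>l'\<le>k. if l' = l then C l $$ (a, b) else 0)"
    unfolding matrix_poly_entry[OF assms(1,2)] coeff_sum by (intro sum.cong refl) auto
  then show ?thesis using assms by simp
qed

lemma eval_mp_mult:
  assumes "A \<in> carrier_mat n m" "B \<in> carrier_mat m l"
  shows "eval_mp (A * B) z = eval_mp A z * eval_mp B z"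
proof -
  have "semiring_hom (\<lambda>q :: complex poly. poly q z)" by unfold_locales auto
  then show ?thesis unfolding eval_mp_def by (rule semiring_hom.mat_hom_mult[OF _ assms])
qed

lemma eval_mp_carrier [simp]: "A \<in> carrier_mat n m \<Longrightarrow> eval_mp A z \<in> carrier_mat n m"
  by (simp add: eval_mp_def)

lemma det_eval_mp: "det (eval_mp A z) = poly (det A) z"
proof -
  have "comm_ring_hom (\<lambda>q :: complex poly. poly q z)" by unfold_locales auto
  then show ?thesis unfolding eval_mp_def by (rule comm_ring_hom.hom_det)
qed

lemma mult_mat_smult_vec:
  fixes A :: "'a :: comm_semiring_0 mat"
  assumes "A \<in> carrier_mat n m" "v \<in> carrier_vec m"
  shows "A *\<^sub>v (d \<cdot>\<^sub>v v) = d \<cdot>\<^sub>v (A *\<^sub>v v)"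
  using assms by (auto intro!: eq_vecI sum.cong simp: scalar_prod_def sum_distrib_left mult.left_commute)

lemma det_mat_diag: "det (mat_diag n f :: 'a :: idom mat) = (\<Prod>i<n. f i)"
proof -
  have "det (mat_diag n f) = prod_list (diag_mat (mat_diag n f))"
    by (rule det_lower_triangular[of n]) (auto simp: mat_diag_def)
  also have "diag_mat (mat_diag n f) = map f [0..<n]"
    unfolding diag_mat_def by (auto simp: mat_diag_def)
  also have "prod_list (map f [0..<n]) = (\<Prod>i<n. f i)"
    by (simp add: prod.distinct_set_conv_list[symmetric] atLeast0LessThan)
  finally show ?thesis .
qed

lemma smith_formE:
  assumes "smith_form Q ds" and Q: "Q \<in> carrier_mat n n"
  obtains E F where "unimodular n E" "unimodular n F" "length ds \<le> n" "\<And>d. d \<in> set ds \<Longrightarrow> lead_coeff d = 1"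
    "Q = E * mat_diag n (\<lambda>i. if i < length ds then ds ! i else 0) * F"
  using assms unfolding smith_form_def by auto

lemma smith_form_regular:
  assumes s: "smith_form Q ds" and Q: "Q \<in> carrier_mat n n" and d: "det Q \<noteq> 0"
  obtains E F where "unimodular n E" "unimodular n F" "length ds = n" "Q = E * mat_diag n ((!) ds) * F"
proof -
  obtain E F where ef: "unimodular n E" "unimodular n F" "length ds \<le> n"
    "Q = E * mat_diag n (\<lambda>i. if i < length ds then ds ! i else 0) * F"
    using smith_formE[OF s Q] by metis
  note c = unimodularD(1)[OF ef(1)] unimodularD(1)[OF ef(2)]
  have "det Q = det E * (\<Prod>i<n. if i < length ds then ds ! i else 0) * det F"
    unfolding ef(4) using c by (simp add: det_mult[of _ n] det_mat_diag)
  then have "(\<Prod>i<n. if i < length ds then ds ! i else 0) \<noteq> 0" using d by auto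
  then have "(if i < length ds then ds ! i else 0) \<noteq> 0" if "i < n" for i
    using that by (simp add: prod_zero_iff del: if_split)
  then have "\<forall>i<n. i < length ds" by (meson)
  then have l: "length ds = n" using ef(3) by (meson leI le_antisym less_irrefl)
  have "mat_diag n (\<lambda>i. if i < length ds then ds ! i else 0) = mat_diag n ((!) ds)"
    by (intro eq_matI) (auto simp: mat_diag_def l)
  then show ?thesis using that ef l by simp
qed

lemma elementary_divisorI:
  assumes "smith_form Q ds" "d \<in> set ds" "m \<le> order z d" "1 \<le> m"
  shows "\<exists>j\<ge>m. [:- z, 1:] ^ j \<in> elementary_divisors Q"
proof -
  have "[:- z, 1:] ^ order z d \<in> elementary_divisors Q"
    unfolding elementary_divisors_def using assms by (intro CollectI exI[of _ z] exI[of _ d]) auto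
  then show ?thesis using assms(3) by blast
qed

lemma linear_power_eq_iff:
  assumes "[:- z, 1:] ^ j = ([:- w, 1:] ^ l :: complex poly)" "1 \<le> l"
  shows "w = z \<and> j = l"
proof -
  have "degree ([:- z, 1:] ^ j :: complex poly) = degree ([:- w, 1:] ^ l :: complex poly)" using assms by simp
  then have jl: "j = l" by (simp add: degree_linear_power)
  have "poly ([:- w, 1:] ^ l) w = 0" using assms by (simp add: poly_power)
  then have "poly ([:- z, 1:] ^ j) w = 0" using assms(1) by simp
  then show ?thesis using jl by (simp add: poly_power)
qed

text \<open>The polynomial vector \<open>y\<close> is a root vector of \<open>Q\<close> at \<open>z\<close> of order at least \<open>m\<close>; its first \<open>m\<close> Taylor
  coefficients at \<open>z\<close> are a Jordan chain.\<close>

definition has_chain :: "nat \<Rightarrow> nat \<Rightarrow> complex \<Rightarrow> complex poly mat \<Rightarrow> complex poly vec \<Rightarrow> bool" where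
  "has_chain n m z Q y \<longleftrightarrow> y \<in> carrier_vec n \<and> (\<exists>b<n. poly (y $ b) z \<noteq> 0) \<and>
     (\<forall>a<n. [:- z, 1:] ^ m dvd (Q *\<^sub>v y) $ a)"

text \<open>In \<open>Q = E D F\<close> the column of \<open>F\<inverse>\<close> at the position of the diagonal entry \<open>d\<close> is mapped by \<open>Q\<close> to
  \<open>d\<close> times a column of \<open>E\<close>, and it does not vanish at \<open>z\<close> because \<open>F\<close> is unimodular.\<close>

lemma elementary_divisor_imp_chain:
  assumes Q: "Q \<in> carrier_mat n n" and ed: "[:- z, 1:] ^ j \<in> elementary_divisors Q" and m: "m \<le> j" "1 \<le> m"
  shows "\<exists>y. has_chain n m z Q y"
proof -
  obtain w d ds where d: "[:- z, 1:] ^ j = [:- w, 1:] ^ order w d" "smith_form Q ds" "d \<in> set ds" "1 \<le> order w d"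
    using ed unfolding elementary_divisors_def by auto
  have "w = z" "j = order z d" using linear_power_eq_iff[OF d(1,4)] by auto
  then have dvd: "[:- z, 1:] ^ m dvd d" using m order_divides[of z m d] by auto
  obtain E F where ef: "unimodular n E" "unimodular n F" "length ds \<le> n"
    "Q = E * mat_diag n (\<lambda>i. if i < length ds then ds ! i else 0) * F"
    using smith_formE[OF d(2) Q] by metis
  obtain t where t: "t < length ds" "ds ! t = d" using d(3) by (auto simp: in_set_conv_nth)
  have tn: "t < n" using t ef by simp
  define D where "D = mat_diag n (\<lambda>i. if i < length ds then ds ! i else 0)"
  have D: "D \<in> carrier_mat n n" unfolding D_def by simp
  obtain F' where F': "unimodular n F'" "F * F' = 1\<^sub>m n" using unimodular_inverse[OF ef(2)] by metis
  note c = unimodularD(1)[OF ef(1)] unimodularD(1)[OF ef(2)] unimodularD(1)[OF F'(1)]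
  define y where "y = col F' t"
  have y: "y \<in> carrier_vec n" unfolding y_def using c tn by auto
  have Fy: "F *\<^sub>v y = unit_vec n t"
    using col_mult2[OF c(2,3) tn] F'(2) tn by (simp add: y_def)
  have "(D *\<^sub>v unit_vec n t) $ i = (if i = t then d else 0)" if "i < n" for i
    using that tn t D by (simp add: D_def mat_diag_def)
  then have De: "D *\<^sub>v unit_vec n t = d \<cdot>\<^sub>v unit_vec n t" using D tn by (intro eq_vecI) auto
  have ED: "E * D \<in> carrier_mat n n" using c D by auto
  have "Q *\<^sub>v y = E *\<^sub>v (D *\<^sub>v (F *\<^sub>v y))"
    unfolding ef(4) D_def[symmetric] using assoc_mult_mat_vec[OF ED c(2) y] assoc_mult_mat_vec[OF c(1) D, of "F *\<^sub>v y"] c y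
    by simp
  also have "\<dots> = d \<cdot>\<^sub>v (E *\<^sub>v unit_vec n t)" unfolding Fy De by (rule mult_mat_smult_vec[OF c(1)]) simp
  finally have Qy: "(Q *\<^sub>v y) $ a = d * (E *\<^sub>v unit_vec n t) $ a" if "a < n" for a
    using that c by simp
  have "\<exists>b<n. poly (y $ b) z \<noteq> 0"
  proof (rule ccontr)
    assume "\<not> ?thesis"
    then have z0: "\<forall>b<n. poly (y $ b) z = 0" by auto
    have "poly ((F *\<^sub>v y) $ t) z = 0"
      unfolding mult_mat_vec_entry[OF c(2) y tn] poly_sum using z0 by (intro sum.neutral) auto
    then show False unfolding Fy using tn by simp
  qed
  then show ?thesis unfolding has_chain_def using y Qy dvd by (intro exI[of _ y]) (auto intro: dvd_mult2)
qed

text \<open>Let \<open>Q = E D F\<close> and \<open>x = F y\<close>.  Some entry \<open>x\<^sub>i\<close> does not vanish at \<open>z\<close>, and the power of \<open>\<lambda> - z\<close>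
  divides \<open>d\<^sub>i x\<^sub>i\<close>, hence \<open>d\<^sub>i\<close>.\<close>

lemma chain_imp_elementary_divisor:
  assumes Q: "Q \<in> carrier_mat n n" and d: "det Q \<noteq> 0" and ch: "has_chain n m z Q y" and m: "1 \<le> m"
  shows "\<exists>j\<ge>m. [:- z, 1:] ^ j \<in> elementary_divisors Q"
proof -
  obtain ds where s: "smith_form Q ds" using smith_form_exists[OF Q] by blast
  obtain E F where ef: "unimodular n E" "unimodular n F" "length ds = n" "Q = E * mat_diag n ((!) ds) * F"
    using smith_form_regular[OF s Q d] by metis
  define D where "D = mat_diag n ((!) ds)"
  have D: "D \<in> carrier_mat n n" unfolding D_def by simp
  obtain E' where E': "unimodular n E'" "E' * E = 1\<^sub>m n" using unimodular_inverse[OF ef(1)] by metis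
  obtain F' where F': "unimodular n F'" "F' * F = 1\<^sub>m n" using unimodular_inverse[OF ef(2)] by metis
  note c = unimodularD(1)[OF ef(1)] unimodularD(1)[OF ef(2)] unimodularD(1)[OF E'(1)] unimodularD(1)[OF F'(1)]
  have y: "y \<in> carrier_vec n" and y0: "\<exists>b<n. poly (y $ b) z \<noteq> 0"
    and dvd: "\<And>a. a < n \<Longrightarrow> [:- z, 1:] ^ m dvd (Q *\<^sub>v y) $ a"
    using ch unfolding has_chain_def by auto
  define x where "x = F *\<^sub>v y"
  have x: "x \<in> carrier_vec n" unfolding x_def using c y by auto
  have Dx: "D *\<^sub>v x \<in> carrier_vec n" using D x by auto
  have ED: "E * D \<in> carrier_mat n n" using c D by auto
  have "Q *\<^sub>v y = E *\<^sub>v (D *\<^sub>v x)"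
    unfolding ef(4) D_def[symmetric] x_def using assoc_mult_mat_vec[OF ED c(2) y] assoc_mult_mat_vec[OF c(1) D, of "F *\<^sub>v y"] c y
    by simp
  then have "E' *\<^sub>v (Q *\<^sub>v y) = E' * E *\<^sub>v (D *\<^sub>v x)" using assoc_mult_mat_vec[OF c(3,1) Dx] by simp
  then have DE: "D *\<^sub>v x = E' *\<^sub>v (Q *\<^sub>v y)" using E' Dx by simp
  have Qy: "Q *\<^sub>v y \<in> carrier_vec n" using Q y by auto
  have dvdD: "[:- z, 1:] ^ m dvd ds ! i * x $ i" if i: "i < n" for i
  proof -
    have "(D *\<^sub>v x) $ i = (\<Sum>j<n. if j = i then ds ! i * x $ i else 0)"
      unfolding mult_mat_vec_entry[OF D x i] using i by (intro sum.cong refl) (auto simp: D_def mat_diag_def)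
    then have "ds ! i * x $ i = (\<Sum>a<n. E' $$ (i, a) * (Q *\<^sub>v y) $ a)"
      using i mult_mat_vec_entry[OF c(3) Qy i] DE by simp
    then show ?thesis using dvd by (auto intro!: dvd_sum dvd_mult)
  qed
  have "\<exists>i<n. poly (x $ i) z \<noteq> 0"
  proof (rule ccontr)
    assume "\<not> ?thesis"
    then have z0: "\<forall>b<n. poly (x $ b) z = 0" by auto
    have yx: "y = F' *\<^sub>v x" unfolding x_def using assoc_mult_mat_vec[OF c(4,2) y] F' y by simp
    have "poly (y $ b) z = 0" if "b < n" for b
      unfolding yx mult_mat_vec_entry[OF c(4) x that] poly_sum using z0 by (intro sum.neutral) auto
    then show False using y0 by auto
  qed
  then obtain i where i: "i < n" "poly (x $ i) z \<noteq> 0" by blast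
  have di: "ds ! i \<in> set ds" using i ef(3) by simp
  then have "lead_coeff (ds ! i) = 1" using smith_formE[OF s Q] by metis
  then have d0: "ds ! i \<noteq> 0" by auto
  have x0: "x $ i \<noteq> 0" using i by auto
  have "m \<le> order z (ds ! i * x $ i)" using dvdD[OF i(1)] d0 x0 order_divides[of z m] by auto
  also have "\<dots> = order z (ds ! i) + order z (x $ i)" using d0 x0 by (intro order_mult) auto
  also have "order z (x $ i) = 0" using i by (intro order_0I)
  finally show ?thesis using elementary_divisorI[OF s di _ m] by simp
qed

text \<open>The determinant of the reversed polynomial is, at \<open>t \<noteq> 0\<close>, the value \<open>t\<^sup>k\<^sup>n p(1 / t)\<close>.  If \<open>p\<close> had
  smaller degree, it would vanish at \<open>t = 0\<close>, where it is the determinant of the leading coefficient.\<close>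

lemma degree_det_ge:
  assumes Q: "Q \<in> carrier_mat n n" and S: "\<And>\<mu>. poly (det Q) (z + \<mu>) = det (coeff_eval n k S 1 \<mu>)"
    and k: "det (coeff_eval n k S 0 1) \<noteq> 0"
  shows "k * n \<le> degree (det Q \<circ>\<^sub>p [:z, 1:])"
proof (rule ccontr)
  let ?p = "det Q \<circ>\<^sub>p [:z, 1:]"
  assume "\<not> ?thesis"
  then have lt: "degree ?p < k * n" by simp
  \<comment> \<open>\<open>R\<close> is the reversed polynomial\<close>
  define R where "R = mat n n (\<lambda>(a, b). \<Sum>i\<le>k. monom (S i $$ (a, b)) (k - i))"
  have R: "R \<in> carrier_mat n n" by (simp add: R_def)
  have dR: "poly (det R) t = det (coeff_eval n k S t 1)" for t
    by (rule poly_det_cong[OF coeff_eval_carrier R]) (simp add: R_def coeff_eval_def poly_sum poly_monom mult.commute)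
  define e where "e = k * n - degree ?p"
  have "det R - monom 1 e * reflect_poly ?p = 0"
  proof (rule poly_eq_0_off_0)
    fix t :: complex assume t: "t \<noteq> 0"
    have "coeff_eval n k S t 1 = t ^ k \<cdot>\<^sub>m coeff_eval n k S 1 (inverse t)"
    proof (rule eq_matI)
      fix a b assume "a < dim_row (t ^ k \<cdot>\<^sub>m coeff_eval n k S 1 (inverse t))" "b < dim_col (t ^ k \<cdot>\<^sub>m coeff_eval n k S 1 (inverse t))"
      then have ab: "a < n" "b < n" by (auto simp: coeff_eval_def)
      have "t ^ (k - i) = t ^ k * inverse t ^ i" if "i \<le> k" for i
        using that t by (simp add: power_diff power_inverse divide_inverse)
      then have "(\<Sum>i\<le>k. t ^ (k - i) * S i $$ (a, b)) = (\<Sum>i\<le>k. t ^ k * (inverse t ^ i * S i $$ (a, b)))"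
        by (intro sum.cong refl) simp
      then show "coeff_eval n k S t 1 $$ (a, b) = (t ^ k \<cdot>\<^sub>m coeff_eval n k S 1 (inverse t)) $$ (a, b)"
        using ab by (simp add: coeff_eval_def sum_distrib_left)
    qed (auto simp: coeff_eval_def)
    then have "poly (det R) t = (t ^ k) ^ n * poly ?p (inverse t)"
      unfolding dR det_smult poly_pcompose using S[of "inverse t"] by (simp add: carrier_matD[OF coeff_eval_carrier])
    also have "\<dots> = t ^ (e + degree ?p) * poly ?p (inverse t)" using lt by (simp add: e_def power_mult)
    also have "\<dots> = poly (monom 1 e * reflect_poly ?p) t"
      using t by (simp add: poly_monom poly_reflect_poly_nz power_add)
    finally show "poly (det R - monom 1 e * reflect_poly ?p) t = 0" by simp
  qed
  moreover have "e > 0" using lt by (simp add: e_def)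
  ultimately have "poly (det R) 0 = 0" by (simp add: poly_monom)
  then show False using dR k by simp
qed

lemma order_of_single_root:
  fixes p :: "complex poly"
  assumes "\<And>\<mu>. \<mu> \<noteq> 0 \<Longrightarrow> poly p \<mu> \<noteq> 0"
  shows "degree p \<le> order 0 p"
proof (cases "poly p 0 = 0")
  case True
  then have "{z. poly p z = 0} = {0}" using assms by auto
  then have "smult (lead_coeff p) ([:-0, 1:] ^ order 0 p) = p" using complex_poly_decompose[of p] by simp
  then have "degree p = degree (smult (lead_coeff p) ([:-0, 1:] ^ order 0 p))" by simp
  also have "\<dots> \<le> degree ([:-0, 1:] ^ order 0 p :: complex poly)" by (rule degree_smult_le)
  also have "\<dots> = order 0 p" by (rule degree_linear_power)
  finally show ?thesis .
next
  case False
  then have "poly p z \<noteq> 0" for z using assms by (cases "z = 0") auto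
  then have "{z. poly p z = 0} = {}" by simp
  then have "smult (lead_coeff p) 1 = p" using complex_poly_decompose[of p] by simp
  then have "degree p = degree (smult (lead_coeff p) (1 :: complex poly))" by simp
  also have "\<dots> = 0" by simp
  finally show ?thesis by simp
qed

lemma order_prod:
  fixes f :: "'b \<Rightarrow> complex poly"
  assumes "finite I" "\<And>i. i \<in> I \<Longrightarrow> f i \<noteq> 0"
  shows "order z (\<Prod>i\<in>I. f i) = (\<Sum>i\<in>I. order z (f i))"
  using assms
proof (induction rule: finite_induct)
  case (insert i I)
  have "f i * prod f I \<noteq> 0" using insert by (simp add: prod_zero_iff)
  then show ?case using insert by (simp add: order_mult)
qed simp

text \<open>The determinant of \<open>Q\<close> has degree at least \<open>k n\<close> and no root besides \<open>z\<close>, hence is divisible by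
  \<open>(\<lambda> - z)\<^sup>k\<^sup>n\<close>.  Since the kernel of \<open>Q(z)\<close> is at most
  one-dimensional, only one diagonal entry of the Smith form vanishes at \<open>z\<close>, and it carries the whole
  multiplicity.\<close>

lemma single_eigenvalue_elementary_divisor:
  assumes Q: "Q \<in> carrier_mat n n" and g: "single_eigenvalue n k S"
    and T: "\<And>\<mu>. eval_mp Q (z + \<mu>) = coeff_eval n k S 1 \<mu>"
    and m: "1 \<le> m" "m \<le> k * n"
  shows "\<exists>j\<ge>m. [:- z, 1:] ^ j \<in> elementary_divisors Q"
proof -
  have S: "\<And>i. i \<le> k \<Longrightarrow> S i \<in> carrier_mat n n"
    and inv: "\<And>\<alpha> \<beta>. \<beta> \<noteq> 0 \<Longrightarrow> det (coeff_eval n k S \<alpha> \<beta>) \<noteq> 0" using g unfolding single_eigenvalue_def by auto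
  obtain w where w: "w \<in> carrier_vec n" "\<And>v. v \<in> carrier_vec n \<Longrightarrow> S 0 *\<^sub>v v = 0\<^sub>v n \<Longrightarrow> w \<bullet> v = 0 \<Longrightarrow> v = 0\<^sub>v n"
    using g unfolding single_eigenvalue_def by blast
  have pd: "poly (det Q) (z + \<mu>) = det (coeff_eval n k S 1 \<mu>)" for \<mu> using T[of \<mu>] det_eval_mp[of Q] by metis
  have d: "det Q \<noteq> 0" using pd[of 1] inv[of 1 1] by auto
  let ?p = "det Q \<circ>\<^sub>p [:z, 1:]"
  have "k * n \<le> degree ?p" by (rule degree_det_ge[OF Q pd inv]) simp
  also have "\<dots> \<le> order 0 ?p"
    by (rule order_of_single_root) (use inv in \<open>simp add: poly_pcompose pd\<close>)
  finally have "monom 1 (k * n) dvd ?p" using order_divides[of 0 "k * n" ?p] by (auto simp: monom_altdef)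
  then have dvd: "[:- z, 1:] ^ (k * n) dvd det Q"
    unfolding linear_power_dvd_iff monom_1_dvd_iff' taylor_coeff_def .
  obtain ds where s: "smith_form Q ds" using smith_form_exists[OF Q] by blast
  obtain E F where ef: "unimodular n E" "unimodular n F" "length ds = n" "Q = E * mat_diag n ((!) ds) * F"
    using smith_form_regular[OF s Q d] by metis
  note c = unimodularD(1)[OF ef(1)] unimodularD(1)[OF ef(2)]
  have ds0: "ds ! i \<noteq> 0" if "i < n" for i
  proof -
    have "lead_coeff (ds ! i) = 1" using smith_formE[OF s Q] that ef(3) by (metis nth_mem)
    then show ?thesis by auto
  qed
  obtain ce cf where cc: "det E = [:ce:]" "ce \<noteq> 0" "det F = [:cf:]" "cf \<noteq> 0"
    using unimodularD(2)[OF ef(1)] unimodularD(2)[OF ef(2)] by auto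
  have "det Q = smult (ce * cf) (\<Prod>i<n. ds ! i)"
    unfolding ef(4) using c by (simp add: det_mult[of _ n] det_mat_diag cc mult.commute)
  then have "[:- z, 1:] ^ (k * n) dvd (\<Prod>i<n. ds ! i)" using dvd cc by (simp add: dvd_smult_iff)
  moreover have "(\<Prod>i<n. ds ! i) \<noteq> 0" using ds0 by (simp add: prod_zero_iff)
  ultimately have "k * n \<le> order z (\<Prod>i<n. ds ! i)" using order_divides[of z "k * n"] by auto
  also have "\<dots> = (\<Sum>i<n. order z (ds ! i))" using ds0 by (intro order_prod) auto
  finally have sum: "k * n \<le> (\<Sum>i<n. order z (ds ! i))" .
  \<comment> \<open>if two diagonal entries vanish at \<open>z\<close>, the kernel of \<open>Q(z)\<close> contains a plane, and in it a nonzero vector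
    \<open>F(z)\<inverse> u\<close> on which the functional \<open>w\<close> vanishes\<close>
  have uniq: "i = i'" if i: "i < n" "poly (ds ! i) z = 0" and i': "i' < n" "poly (ds ! i') z = 0" for i i'
  proof (rule ccontr)
    assume ne: "i \<noteq> i'"
    define Fz where "Fz = eval_mp F z"
    define Dz where "Dz = eval_mp (mat_diag n ((!) ds)) z"
    define Ez where "Ez = eval_mp E z"
    have cz: "Ez \<in> carrier_mat n n" "Dz \<in> carrier_mat n n" "Fz \<in> carrier_mat n n"
      unfolding Ez_def Dz_def Fz_def using c by auto
    have "det Fz \<noteq> 0" unfolding Fz_def det_eval_mp cc by (simp add: cc)
    then obtain G where G: "G \<in> carrier_mat n n" "Fz * G = 1\<^sub>m n" using mat_inverse_obtain[OF cz(3)] by metis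
    have S0: "S 0 = Ez * Dz * Fz"
    proof -
      have "S 0 = coeff_eval n k S 1 0" using coeff_eval_1_0[of S n k] S[of 0] by simp
      also have "\<dots> = eval_mp Q z" using T[of 0] by simp
      also have "\<dots> = eval_mp (E * mat_diag n ((!) ds)) z * eval_mp F z"
        unfolding ef(4) by (rule eval_mp_mult[of _ n n _ n]) (use c in auto)
      also have "eval_mp (E * mat_diag n ((!) ds)) z = Ez * Dz"
        unfolding Ez_def Dz_def by (rule eval_mp_mult[of _ n n _ n]) (use c in auto)
      finally show ?thesis by (simp add: Fz_def)
    qed
    define \<alpha> where "\<alpha> = (w \<bullet> (G *\<^sub>v unit_vec n i'))"
    define \<beta> where "\<beta> = (w \<bullet> (G *\<^sub>v unit_vec n i))"
    define u where "u = (if \<alpha> = 0 \<and> \<beta> = 0 then unit_vec n i else \<alpha> \<cdot>\<^sub>v unit_vec n i - \<beta> \<cdot>\<^sub>v unit_vec n i')"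
    have u: "u \<in> carrier_vec n" by (simp add: u_def)
    have ue: "u $ a = (if \<alpha> = 0 \<and> \<beta> = 0 then (if a = i then 1 else 0)
        else (if a = i then \<alpha> else if a = i' then - \<beta> else 0))" if "a < n" for a
      using that i i' ne by (auto simp: u_def)
    have u0: "u \<noteq> 0\<^sub>v n"
    proof
      assume "u = 0\<^sub>v n"
      then have "u $ i = 0" "u $ i' = 0" using i i' by auto
      then show False using ue[OF i(1)] ue[OF i'(1)] ne by (auto split: if_splits)
    qed
    have Du: "Dz *\<^sub>v u = 0\<^sub>v n"
    proof (rule eq_vecI)
      fix a assume "a < dim_vec (0\<^sub>v n :: complex vec)"
      then have a: "a < n" by simp
      have "(Dz *\<^sub>v u) $ a = (\<Sum>b<n. if b = a then poly (ds ! a) z * u $ a else 0)"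
        unfolding mult_mat_vec_entry[OF cz(2) u a] using a
        by (intro sum.cong refl) (auto simp: Dz_def eval_mp_def mat_diag_def)
      also have "\<dots> = poly (ds ! a) z * u $ a" using a by simp
      also have "\<dots> = 0" using ue[OF a] i i' by auto
      finally show "(Dz *\<^sub>v u) $ a = 0\<^sub>v n $ a" using a by simp
    qed (use cz in auto)
    have Gu: "G *\<^sub>v u \<in> carrier_vec n" using G u by auto
    have FGu: "Fz *\<^sub>v (G *\<^sub>v u) = u" using assoc_mult_mat_vec[OF cz(3) G(1) u] G u by simp
    have ED: "Ez * Dz \<in> carrier_mat n n" using cz by auto
    have "S 0 *\<^sub>v (G *\<^sub>v u) = 0\<^sub>v n"
    proof -
      have "S 0 *\<^sub>v (G *\<^sub>v u) = Ez * Dz *\<^sub>v u" unfolding S0 using assoc_mult_mat_vec[OF ED cz(3) Gu] FGu by simp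
      also have "\<dots> = Ez *\<^sub>v (Dz *\<^sub>v u)" by (rule assoc_mult_mat_vec[OF cz(1,2) u])
      also have "\<dots> = 0\<^sub>v n" unfolding Du using cz by (intro eq_vecI) auto
      finally show ?thesis .
    qed
    moreover have "w \<bullet> (G *\<^sub>v u) = 0"
    proof (cases "\<alpha> = 0 \<and> \<beta> = 0")
      case True
      then show ?thesis by (simp add: u_def \<beta>_def)
    next
      case False
      have ui: "G *\<^sub>v unit_vec n i \<in> carrier_vec n" "G *\<^sub>v unit_vec n i' \<in> carrier_vec n" using G by auto
      have "G *\<^sub>v u = G *\<^sub>v (\<alpha> \<cdot>\<^sub>v unit_vec n i) - G *\<^sub>v (\<beta> \<cdot>\<^sub>v unit_vec n i')"
        using False G by (simp only: u_def if_False) (intro mult_minus_distrib_mat_vec, auto)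
      also have "\<dots> = \<alpha> \<cdot>\<^sub>v (G *\<^sub>v unit_vec n i) - \<beta> \<cdot>\<^sub>v (G *\<^sub>v unit_vec n i')"
        using G by (simp only: mult_mat_vec[OF G(1) unit_vec_carrier])
      finally have "w \<bullet> (G *\<^sub>v u) = \<alpha> * (w \<bullet> (G *\<^sub>v unit_vec n i)) - \<beta> * (w \<bullet> (G *\<^sub>v unit_vec n i'))"
        using w(1) ui by (simp only: scalar_prod_minus_distrib[OF w(1) smult_carrier_vec[THEN iffD2, OF ui(1)]
            smult_carrier_vec[THEN iffD2, OF ui(2)]] scalar_prod_smult_distrib[OF w(1) ui(1)] scalar_prod_smult_distrib[OF w(1) ui(2)])
      then show ?thesis by (simp add: \<alpha>_def \<beta>_def)
    qed
    ultimately have "G *\<^sub>v u = 0\<^sub>v n" using w(2)[OF Gu] by simp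
    then have "u = Fz *\<^sub>v 0\<^sub>v n" using FGu by simp
    also have "\<dots> = 0\<^sub>v n" using cz by (intro eq_vecI) auto
    finally show False using u0 by simp
  qed
  have "\<exists>i<n. m \<le> order z (ds ! i)"
  proof (cases "\<exists>i<n. poly (ds ! i) z = 0")
    case True
    then obtain i where i: "i < n" "poly (ds ! i) z = 0" by blast
    have "(\<Sum>i'<n. order z (ds ! i')) = (\<Sum>i'<n. if i' = i then order z (ds ! i) else 0)"
    proof (rule sum.cong[OF refl])
      fix i' assume "i' \<in> {..<n}"
      then show "order z (ds ! i') = (if i' = i then order z (ds ! i) else 0)"
        using uniq[OF i, of i'] order_0I[of "ds ! i'" z] by auto
    qed
    then have "k * n \<le> order z (ds ! i)" using sum i by simp
    then show ?thesis using i m by (intro exI[of _ i]) auto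
  next
    case False
    then have "(\<Sum>i<n. order z (ds ! i)) = 0" by (auto simp: order_0I)
    then have "k * n = 0" using sum by (metis le_zero_eq)
    then show ?thesis using m by linarith
  qed
  then obtain i where i: "i < n" "m \<le> order z (ds ! i)" by blast
  then show ?thesis using elementary_divisorI[OF s _ i(2) m(1)] ef(3) by simp
qed

lemma block_row_carrier [simp]: "block_row n m B \<in> carrier_mat n (m * n)"
  by (simp add: block_row_def)

lemma block_row_entry:
  assumes "a < n" "i < m" "b < n"
  shows "block_row n m B $$ (a, i * n + b) = B i $$ (a, b)"
  using assms block_index_less[of i m b n] block_div_mod[of b n i] by (simp add: block_row_def)

lemma mat_l1_block_row_diff:
  "mat_l1 (block_row n m B - block_row n m C) = (\<Sum>a<n. \<Sum>i<m. \<Sum>b<n. cmod (B i $$ (a, b) - C i $$ (a, b)))"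
proof -
  have "mat_l1 (block_row n m B - block_row n m C) =
      (\<Sum>a<n. \<Sum>c<m * n. cmod (block_row n m B $$ (a, c) - block_row n m C $$ (a, c)))"
    unfolding mat_l1_def by (auto simp: block_row_def intro!: sum.cong)
  also have "\<dots> = (\<Sum>a<n. \<Sum>i<m. \<Sum>b<n. cmod (B i $$ (a, b) - C i $$ (a, b)))"
    unfolding sum_blocks by (intro sum.cong refl) (auto simp: block_row_entry)
  finally show ?thesis .
qed

text \<open>The Taylor coefficients at \<open>z\<close> form a singular family, too, and are approximated by families with the
  single eigenvalue \<open>0\<close>; returning to the usual coefficients is a fixed linear map, hence continuous.\<close>

theorem singular_matrix_poly_limit:
  assumes n: "n > 0" and k: "k > 0" and sing: "det (matrix_poly n k C) = 0"
    and m: "1 \<le> m" "m \<le> k * n" and e: "e > 0"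
  shows "\<exists>C'. (\<forall>i\<le>k. C' i \<in> carrier_mat n n) \<and>
    (\<exists>j\<ge>m. [:- z, 1:] ^ j \<in> elementary_divisors (matrix_poly n k C')) \<and>
    mat_l1 (block_row n (Suc k) C' - block_row n (Suc k) C) < e"
proof -
  obtain k' where k': "k = Suc k'" using k gr0_implies_Suc by blast
  define Q where "Q = matrix_poly n k C"
  define T where "T = (\<lambda>i. mat n n (\<lambda>(a, b). taylor_coeff z (Q $$ (a, b)) i))"
  have Q: "Q \<in> carrier_mat n n" unfolding Q_def by simp
  have degQ: "a < n \<Longrightarrow> b < n \<Longrightarrow> degree (Q $$ (a, b)) \<le> k" for a b
    unfolding Q_def by (rule degree_matrix_poly)
  have "eval_mp Q (z + \<mu>) = coeff_eval n k T 1 \<mu>" for \<mu>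
    unfolding eval_mp_def coeff_eval_def using Q
    by (intro eq_matI) (auto simp: T_def poly_taylor[OF degQ])
  then have "det (coeff_eval n k T 1 \<mu>) = 0" for \<mu>
    using det_eval_mp[of Q "z + \<mu>"] sing unfolding Q_def by simp
  moreover have "T i \<in> carrier_mat n n" for i by (simp add: T_def)
  ultimately obtain S where S: "\<And>t. single_eigenvalue n k (S t)"
    and lim: "\<And>i a b. i \<le> k \<Longrightarrow> a < n \<Longrightarrow> b < n \<Longrightarrow> (\<lambda>t. S t i $$ (a, b)) \<longlonglongrightarrow> T i $$ (a, b)"
    using singular_coeffs_limit[OF n, of k' T] unfolding k' by blast
  \<comment> \<open>the polynomial with the given Taylor coefficients at \<open>z\<close>\<close>
  define g where "g = (\<lambda>S a b. (\<Sum>i\<le>k. monom (S i $$ (a, b)) i) \<circ>\<^sub>p [:- z, 1:] :: complex poly)"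
  define C' where "C' = (\<lambda>t l. mat n n (\<lambda>(a, b). coeff (g (S t) a b) l))"
  have deg: "degree (g X a b) \<le> k" for X :: "nat \<Rightarrow> complex mat" and a b
  proof -
    have "degree (g X a b) \<le> degree (\<Sum>i\<le>k. monom (X i $$ (a, b)) i) * degree [:- z, 1:]"
      unfolding g_def by (rule degree_pcompose_le)
    moreover have "degree (\<Sum>i\<le>k. monom (X i $$ (a, b)) i) \<le> k"
      by (intro degree_sum_le) (auto intro: order.trans[OF degree_monom_le])
    ultimately show ?thesis by simp
  qed
  have mp: "matrix_poly n k (C' t) $$ (a, b) = g (S t) a b" if "a < n" "b < n" for t a b
    unfolding matrix_poly_entry[OF that] using that by (simp add: C'_def poly_as_sum_of_monoms'[OF deg])
  have "eval_mp (matrix_poly n k (C' t)) (z + \<mu>) = coeff_eval n k (S t) 1 \<mu>" for t \<mu>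
  proof (rule eq_matI)
    fix a b assume "a < dim_row (coeff_eval n k (S t) 1 \<mu>)" "b < dim_col (coeff_eval n k (S t) 1 \<mu>)"
    then have ab: "a < n" "b < n" by (auto simp: coeff_eval_def)
    have "eval_mp (matrix_poly n k (C' t)) (z + \<mu>) $$ (a, b) = poly (matrix_poly n k (C' t) $$ (a, b)) (z + \<mu>)"
      using ab by (simp add: eval_mp_def carrier_matD[OF matrix_poly_carrier])
    also have "\<dots> = (\<Sum>i\<le>k. \<mu> ^ i * S t i $$ (a, b))"
      unfolding mp[OF ab] g_def by (simp add: poly_pcompose poly_sum poly_monom mult.commute)
    finally show "eval_mp (matrix_poly n k (C' t)) (z + \<mu>) $$ (a, b) = coeff_eval n k (S t) 1 \<mu> $$ (a, b)"
      using ab by (simp add: coeff_eval_def)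
  qed (auto simp: coeff_eval_def eval_mp_def matrix_poly_def)
  then have ed: "\<exists>j\<ge>m. [:- z, 1:] ^ j \<in> elementary_divisors (matrix_poly n k (C' t))" for t
    using single_eigenvalue_elementary_divisor[OF matrix_poly_carrier S _ m] by blast
  have "(\<lambda>t. C' t l $$ (a, b)) \<longlonglongrightarrow> C l $$ (a, b)" if l: "l \<le> k" and ab: "a < n" "b < n" for l a b
  proof -
    have cf: "coeff (g X a b) l = (\<Sum>i\<le>k. X i $$ (a, b) * taylor_coeff (- z) (monom 1 i) l)" for X :: "nat \<Rightarrow> complex mat"
    proof -
      have "coeff (g X a b) l = taylor_coeff (- z) (\<Sum>i\<le>k. monom (X i $$ (a, b)) i) l"
        by (simp add: g_def taylor_coeff_def)
      also have "\<dots> = (\<Sum>i\<le>k. X i $$ (a, b) * taylor_coeff (- z) (monom 1 i) l)"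
        unfolding taylor_coeff_sum by (intro sum.cong refl) (rule taylor_coeff_monom)
      finally show ?thesis .
    qed
    have "(\<lambda>t. coeff (g (S t) a b) l) \<longlonglongrightarrow> coeff (g T a b) l"
      unfolding cf using ab by (intro tendsto_sum tendsto_mult tendsto_const lim) auto
    moreover have "g T a b = Q $$ (a, b)"
    proof -
      have "degree (Q $$ (a, b) \<circ>\<^sub>p [:z, 1:]) \<le> k"
        using degree_pcompose_le[of "Q $$ (a, b)" "[:z, 1:]"] degree_matrix_poly[OF ab, of k C] by (simp add: Q_def)
      then have "(\<Sum>i\<le>k. monom (T i $$ (a, b)) i) = Q $$ (a, b) \<circ>\<^sub>p [:z, 1:]"
        using ab poly_as_sum_of_monoms'[of "Q $$ (a, b) \<circ>\<^sub>p [:z, 1:]" k] by (simp add: T_def taylor_coeff_def)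
      then show ?thesis unfolding g_def by (simp add: shift_back)
    qed
    ultimately show ?thesis using ab l by (simp add: C'_def Q_def coeff_matrix_poly)
  qed
  then have "(\<lambda>t. mat_l1 (block_row n (Suc k) (C' t) - block_row n (Suc k) C)) \<longlonglongrightarrow>
      (\<Sum>a<n. \<Sum>i<Suc k. \<Sum>b<n. cmod (C i $$ (a, b) - C i $$ (a, b)))"
    unfolding mat_l1_block_row_diff by (intro tendsto_sum tendsto_norm tendsto_diff tendsto_const) auto
  then have "(\<lambda>t. mat_l1 (block_row n (Suc k) (C' t) - block_row n (Suc k) C)) \<longlonglongrightarrow> 0" by simp
  then have "eventually (\<lambda>t. mat_l1 (block_row n (Suc k) (C' t) - block_row n (Suc k) C) < e) sequentially"
    using e by (rule order_tendstoD(2))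
  then obtain t where "mat_l1 (block_row n (Suc k) (C' t) - block_row n (Suc k) C) < e"
    by (auto simp: eventually_sequentially)
  moreover have "\<forall>i\<le>k. C' t i \<in> carrier_mat n n" by (simp add: C'_def)
  ultimately show ?thesis using ed[of t] by blast
qed

section \<open>Distance to a polynomial with a prescribed elementary divisor\<close>

lemma pert_norm_block_row:
  assumes "\<And>i. i \<le> k \<Longrightarrow> C i \<in> carrier_mat n n"
  shows "pert_norm s n k C = mat_norm s (block_row n (Suc k) C)"
proof (cases s)
  case Frobenius
  have "(\<Sum>i\<le>k. (frobenius_norm (C i))\<^sup>2) = (\<Sum>i\<le>k. \<Sum>a<n. \<Sum>b<n. (cmod (C i $$ (a, b)))\<^sup>2)"
  proof (rule sum.cong[OF refl])
    fix i assume "i \<in> {..k}"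
    then have "C i \<in> carrier_mat n n" using assms by simp
    then show "(frobenius_norm (C i))\<^sup>2 = (\<Sum>a<n. \<Sum>b<n. (cmod (C i $$ (a, b)))\<^sup>2)"
      unfolding frobenius_norm_def by (subst real_sqrt_pow2) (auto intro!: sum_nonneg)
  qed
  also have "\<dots> = (\<Sum>a<n. \<Sum>i<Suc k. \<Sum>b<n. (cmod (C i $$ (a, b)))\<^sup>2)"
    unfolding lessThan_Suc_atMost by (rule sum.swap)
  also have "\<dots> = (\<Sum>a<n. \<Sum>c<Suc k * n. (cmod (block_row n (Suc k) C $$ (a, c)))\<^sup>2)"
    unfolding sum_blocks by (intro sum.cong refl) (auto simp: block_row_entry)
  finally show ?thesis using Frobenius
    by (simp add: frobenius_norm_def carrier_matD[OF block_row_carrier] del: mult_Suc)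
qed simp

lemma M_mat_carrier [simp]: "M_mat n k p z \<in> carrier_mat (Suc k * n) (Suc p * n)"
  by (simp add: M_mat_def kronecker_def H_mat_def)

lemma M_mat_entry:
  assumes "l \<le> k" "i \<le> p" "b' < n" "b < n"
  shows "M_mat n k p z $$ (l * n + b', i * n + b) = (if b' = b then taylor_coeff z (monom 1 l) i else 0)"
proof -
  have "l * n + b' < (k + 1) * n" "i * n + b < (p + 1) * n"
    using assms block_index_less[of l "k + 1" b' n] block_index_less[of i "p + 1" b n] by auto
  moreover note block_div_mod[OF assms(3), of l] block_div_mod[OF assms(4), of i]
  moreover have "H_mat k p z $$ (l, i) = taylor_coeff z (monom 1 l) i"
    using assms by (simp add: H_mat_def taylor_coeff_higher_pderiv)
  moreover have "dim_row (H_mat k p z) = k + 1" "dim_col (H_mat k p z) = p + 1" by (auto simp: H_mat_def)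
  ultimately show ?thesis unfolding M_mat_def kronecker_def using assms by simp
qed

lemma taylor_coeff_matrix_poly:
  assumes "a < n" "b < n"
  shows "taylor_coeff z (matrix_poly n k C $$ (a, b)) i = (\<Sum>l\<le>k. C l $$ (a, b) * taylor_coeff z (monom 1 l) i)"
  unfolding matrix_poly_entry[OF assms] taylor_coeff_sum by (intro sum.cong refl) (rule taylor_coeff_monom)

text \<open>Multiplication by \<open>M_mat\<close> turns coefficients into Taylor coefficients at \<open>z\<close>.\<close>

lemma block_row_M_mat_entry:
  assumes "a < n" "i \<le> p" "b < n"
  shows "(block_row n (Suc k) C * M_mat n k p z) $$ (a, i * n + b) = taylor_coeff z (matrix_poly n k C $$ (a, b)) i"
proof -
  have l: "i * n + b < Suc p * n" using assms by (intro block_index_less) auto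
  have "(block_row n (Suc k) C * M_mat n k p z) $$ (a, i * n + b) =
      (\<Sum>l<Suc k. \<Sum>b'<n. block_row n (Suc k) C $$ (a, l * n + b') * M_mat n k p z $$ (l * n + b', i * n + b))"
    unfolding mult_mat_entry[OF block_row_carrier M_mat_carrier assms(1) l] by (rule sum_blocks)
  also have "\<dots> = (\<Sum>l<Suc k. C l $$ (a, b) * taylor_coeff z (monom 1 l) i)"
  proof (rule sum.cong[OF refl])
    fix l assume "l \<in> {..<Suc k}"
    then have l: "l < Suc k" "l \<le> k" by auto
    have "(\<Sum>b'<n. block_row n (Suc k) C $$ (a, l * n + b') * M_mat n k p z $$ (l * n + b', i * n + b))
      = (\<Sum>b'<n. if b' = b then C l $$ (a, b) * taylor_coeff z (monom 1 l) i else 0)"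
      using assms l by (intro sum.cong refl) (auto simp: block_row_entry M_mat_entry)
    then show "(\<Sum>b'<n. block_row n (Suc k) C $$ (a, l * n + b') * M_mat n k p z $$ (l * n + b', i * n + b))
      = C l $$ (a, b) * taylor_coeff z (monom 1 l) i" using assms by simp
  qed
  finally show ?thesis unfolding taylor_coeff_matrix_poly[OF assms(1,3)] by (simp add: lessThan_Suc_atMost)
qed

lemma block_row_eqI:
  assumes X: "X \<in> carrier_mat n (m * n)" and n: "n > 0"
    and e: "\<And>a i b. a < n \<Longrightarrow> i < m \<Longrightarrow> b < n \<Longrightarrow> X $$ (a, i * n + b) = B i $$ (a, b)"
  shows "block_row n m B = X"
proof (rule eq_matI)
  fix a c assume "a < dim_row X" "c < dim_col X"
  then have ac: "a < n" "c < m * n" using X by auto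
  have i: "c div n < m" using ac n by (simp add: div_less_iff_less_mult)
  have b: "c mod n < n" using n by simp
  have "block_row n m B $$ (a, c) = B (c div n) $$ (a, c mod n)" using ac by (simp add: block_row_def)
  also have "\<dots> = X $$ (a, c)" using e[OF ac(1) i b] by simp
  finally show "block_row n m B $$ (a, c) = X $$ (a, c)" .
qed (use X in \<open>auto simp: block_row_def\<close>)

lemma block_row_derivatives:
  assumes n: "n > 0"
  shows "block_row n (Suc p) (\<lambda>i. (1 / fact i) \<cdot>\<^sub>m eval_mp (deriv_mp i (matrix_poly n k C)) z)
    = block_row n (Suc k) C * M_mat n k p z"
proof (rule block_row_eqI[OF _ n])
  show "block_row n (Suc k) C * M_mat n k p z \<in> carrier_mat n (Suc p * n)"
    by (rule mult_carrier_mat[OF block_row_carrier M_mat_carrier])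
  fix a i b assume "a < n" "i < Suc p" "b < n"
  then show "(block_row n (Suc k) C * M_mat n k p z) $$ (a, i * n + b) =
      ((1 / fact i) \<cdot>\<^sub>m eval_mp (deriv_mp i (matrix_poly n k C)) z) $$ (a, b)"
    using carrier_matD[OF matrix_poly_carrier[of n k C]]
    by (simp add: block_row_M_mat_entry taylor_coeff_higher_pderiv eval_mp_def deriv_mp_def)
qed

lemma toeplitz_like_carrier [simp]: "toeplitz_like n p r \<gamma> x \<in> carrier_mat (Suc p * n) (Suc r)"
  by (simp add: toeplitz_like_def)

lemma toeplitz_like_entry:
  assumes "i \<le> p" "b < n" "j \<le> r"
  shows "toeplitz_like n p r \<gamma> x $$ (i * n + b, j) =
    (if i \<le> j then complex_of_real (\<Prod>l = j - i + 1..j. \<gamma> l) * (x (j - i) $ b) else 0)"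
  using assms block_index_less[of i "Suc p" b n] block_div_mod[of b n i]
  by (simp add: toeplitz_like_def Let_def)

text \<open>The Toeplitz structure is the Cauchy product: up to the factor \<open>\<gamma>\<^sub>1 \<cdots> \<gamma>\<^sub>j\<close>, column \<open>j\<close> of the product is
  the \<open>j\<close>-th Taylor coefficient of \<open>Q y\<close>.  Truncation at block row \<open>p\<close> loses nothing because the Taylor
  coefficients of \<open>Q\<close> of index above \<open>k\<close> are zero.\<close>

lemma toeplitz_product_entry:
  assumes p: "p = min r k" and \<gamma>: "\<And>l. l \<in> {1..r} \<Longrightarrow> \<gamma> l > 0" and y: "y \<in> carrier_vec n"
    and xy: "\<And>j b. j \<le> r \<Longrightarrow> b < n \<Longrightarrow> x j $ b = complex_of_real (\<Prod>l = 1..j. \<gamma> l) * taylor_coeff z (y $ b) j"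
    and aj: "a < n" "j \<le> r"
  shows "(block_row n (Suc k) C * M_mat n k p z * toeplitz_like n p r \<gamma> x) $$ (a, j) =
    complex_of_real (\<Prod>l = 1..j. \<gamma> l) * taylor_coeff z ((matrix_poly n k C *\<^sub>v y) $ a) j"
proof -
  let ?Q = "matrix_poly n k C" and ?G = "\<lambda>j. complex_of_real (\<Prod>l = 1..j. \<gamma> l)"
  have W: "block_row n (Suc k) C * M_mat n k p z \<in> carrier_mat n (Suc p * n)"
    by (rule mult_carrier_mat[OF block_row_carrier M_mat_carrier])
  have jr: "j < Suc r" using aj by simp
  define f where "f = (\<lambda>i. \<Sum>b<n. taylor_coeff z (?Q $$ (a, b)) i * taylor_coeff z (y $ b) (j - i))"
  have X: "toeplitz_like n p r \<gamma> x $$ (i * n + b, j) = (if i \<le> j then ?G j * taylor_coeff z (y $ b) (j - i) else 0)"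
    if "i \<le> p" "b < n" for i b
  proof (cases "i \<le> j")
    case True
    then have e: "j = (j - i) + i" by simp
    have "(\<Prod>l = 1..j. \<gamma> l) = (\<Prod>l = 1..j - i. \<gamma> l) * (\<Prod>l = j - i + 1..j. \<gamma> l)"
      using prod.ub_add_nat[of 1 "j - i" \<gamma> i] True by simp
    moreover have "x (j - i) $ b = ?G (j - i) * taylor_coeff z (y $ b) (j - i)" using aj that by (intro xy) auto
    ultimately show ?thesis using True that aj by (simp add: toeplitz_like_entry)
  qed (use that aj in \<open>simp add: toeplitz_like_entry\<close>)
  have "(block_row n (Suc k) C * M_mat n k p z * toeplitz_like n p r \<gamma> x) $$ (a, j) =
      (\<Sum>i<Suc p. \<Sum>b<n. (block_row n (Suc k) C * M_mat n k p z) $$ (a, i * n + b) * toeplitz_like n p r \<gamma> x $$ (i * n + b, j))"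
    unfolding mult_mat_entry[OF W toeplitz_like_carrier aj(1) jr] by (rule sum_blocks)
  also have "\<dots> = (\<Sum>i\<le>p. if i \<le> j then ?G j * f i else 0)"
    unfolding lessThan_Suc_atMost
  proof (rule sum.cong[OF refl])
    fix i assume "i \<in> {..p}"
    then have i: "i \<le> p" by simp
    have "(\<Sum>b<n. (block_row n (Suc k) C * M_mat n k p z) $$ (a, i * n + b) * toeplitz_like n p r \<gamma> x $$ (i * n + b, j))
      = (\<Sum>b<n. taylor_coeff z (?Q $$ (a, b)) i * (if i \<le> j then ?G j * taylor_coeff z (y $ b) (j - i) else 0))"
      using i aj by (intro sum.cong refl) (simp add: block_row_M_mat_entry X)
    then show "(\<Sum>b<n. (block_row n (Suc k) C * M_mat n k p z) $$ (a, i * n + b) * toeplitz_like n p r \<gamma> x $$ (i * n + b, j))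
      = (if i \<le> j then ?G j * f i else 0)" by (simp add: f_def sum_distrib_left mult_ac)
  qed
  also have "\<dots> = (\<Sum>i\<in>{..min p j}. ?G j * f i)"
    by (intro sum.mono_neutral_cong_right) auto
  also have "\<dots> = (\<Sum>i\<le>j. ?G j * f i)"
  proof (intro sum.mono_neutral_left ballI)
    fix i assume i: "i \<in> {..j} - {..min p j}"
    then have "k < i" using p aj by auto
    then have "taylor_coeff z (?Q $$ (a, b)) i = 0" if "b < n" for b
      using degree_matrix_poly[OF aj(1) that, of k C] by (intro taylor_coeff_eq_0) simp
    then show "?G j * f i = 0" by (simp add: f_def)
  qed auto
  also have "\<dots> = ?G j * (\<Sum>b<n. \<Sum>i\<le>j. taylor_coeff z (?Q $$ (a, b)) i * taylor_coeff z (y $ b) (j - i))"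
    unfolding f_def sum_distrib_left[symmetric] by (subst sum.swap) simp
  also have "(\<Sum>b<n. \<Sum>i\<le>j. taylor_coeff z (?Q $$ (a, b)) i * taylor_coeff z (y $ b) (j - i)) = taylor_coeff z ((?Q *\<^sub>v y) $ a) j"
    unfolding mult_mat_vec_entry[OF matrix_poly_carrier y aj(1)] taylor_coeff_sum taylor_coeff_mult ..
  finally show ?thesis .
qed

lemma toeplitz_product_zero_iff:
  assumes p: "p = min r k" and \<gamma>: "\<And>l. l \<in> {1..r} \<Longrightarrow> \<gamma> l > 0" and y: "y \<in> carrier_vec n"
    and xy: "\<And>j b. j \<le> r \<Longrightarrow> b < n \<Longrightarrow> x j $ b = complex_of_real (\<Prod>l = 1..j. \<gamma> l) * taylor_coeff z (y $ b) j"
  shows "block_row n (Suc k) C * M_mat n k p z * toeplitz_like n p r \<gamma> x = 0\<^sub>m n (Suc r) \<longleftrightarrow>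
    (\<forall>a<n. [:- z, 1:] ^ Suc r dvd (matrix_poly n k C *\<^sub>v y) $ a)"
proof -
  let ?Z = "block_row n (Suc k) C * M_mat n k p z * toeplitz_like n p r \<gamma> x"
  have Z: "?Z \<in> carrier_mat n (Suc r)"
    by (rule mult_carrier_mat[OF mult_carrier_mat[OF block_row_carrier M_mat_carrier] toeplitz_like_carrier])
  have G: "complex_of_real (\<Prod>l = 1..j. \<gamma> l) \<noteq> 0" if "j \<le> r" for j
  proof -
    have "(\<Prod>l = 1..j. \<gamma> l) > 0" using \<gamma> that by (intro prod_pos) auto
    then show ?thesis by (simp only: of_real_eq_0_iff)
  qed
  have e: "?Z $$ (a, j) = 0 \<longleftrightarrow> taylor_coeff z ((matrix_poly n k C *\<^sub>v y) $ a) j = 0" if "a < n" "j \<le> r" for a j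
  proof -
    have "?Z $$ (a, j) = complex_of_real (\<Prod>l = 1..j. \<gamma> l) * taylor_coeff z ((matrix_poly n k C *\<^sub>v y) $ a) j"
      by (rule toeplitz_product_entry[where \<gamma> = \<gamma> and x = x, OF p \<gamma> y xy that])
    then show ?thesis using G[OF that(2)] by (simp only: mult_eq_0_iff simp_thms)
  qed
  have "?Z = 0\<^sub>m n (Suc r) \<longleftrightarrow> (\<forall>a<n. \<forall>j<Suc r. ?Z $$ (a, j) = 0)"
  proof
    assume "\<forall>a<n. \<forall>j<Suc r. ?Z $$ (a, j) = 0"
    then show "?Z = 0\<^sub>m n (Suc r)" using Z by (intro eq_matI) auto
  qed simp
  also have "\<dots> \<longleftrightarrow> (\<forall>a<n. \<forall>j<Suc r. taylor_coeff z ((matrix_poly n k C *\<^sub>v y) $ a) j = 0)"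
    using e by (metis less_Suc_eq_le)
  finally show ?thesis unfolding linear_power_dvd_iff .
qed

lemma matrix_poly_add:
  assumes "\<And>i. i \<le> k \<Longrightarrow> A i \<in> carrier_mat n n" "\<And>i. i \<le> k \<Longrightarrow> B i \<in> carrier_mat n n"
  shows "matrix_poly n k A + matrix_poly n k B = matrix_poly n k (\<lambda>i. A i + B i)"
proof (rule eq_matI)
  fix a b assume "a < dim_row (matrix_poly n k (\<lambda>i. A i + B i))" "b < dim_col (matrix_poly n k (\<lambda>i. A i + B i))"
  then have ab: "a < n" "b < n" by (auto simp: matrix_poly_def)
  have "matrix_poly n k (\<lambda>i. A i + B i) $$ (a, b) = (\<Sum>l\<le>k. monom (A l $$ (a, b)) l + monom (B l $$ (a, b)) l)"
    unfolding matrix_poly_entry[OF ab]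
  proof (rule sum.cong[OF refl])
    fix l assume "l \<in> {..k}"
    then have "A l \<in> carrier_mat n n" "B l \<in> carrier_mat n n" using assms by auto
    then show "monom ((A l + B l) $$ (a, b)) l = monom (A l $$ (a, b)) l + monom (B l $$ (a, b)) l"
      using ab by (simp add: add_monom)
  qed
  then show "(matrix_poly n k A + matrix_poly n k B) $$ (a, b) = matrix_poly n k (\<lambda>i. A i + B i) $$ (a, b)"
    using ab by (simp add: matrix_poly_entry sum.distrib carrier_matD[OF matrix_poly_carrier])
qed (auto simp: matrix_poly_def)

lemma block_row_add:
  assumes "\<And>i. i < m \<Longrightarrow> A i \<in> carrier_mat n n" "\<And>i. i < m \<Longrightarrow> B i \<in> carrier_mat n n" and n: "n > 0"
  shows "block_row n m (\<lambda>i. A i + B i) = block_row n m A + block_row n m B"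
proof (rule block_row_eqI[OF _ n])
  fix a i b assume ib: "a < n" "i < m" "b < n"
  then have "i * n + b < m * n" by (intro block_index_less)
  then show "(block_row n m A + block_row n m B) $$ (a, i * n + b) = (A i + B i) $$ (a, b)"
    using ib assms(1)[OF ib(2)] assms(2)[OF ib(2)]
    by (simp add: block_row_entry carrier_matD[OF block_row_carrier])
qed simp

lemma elementary_divisor_imp_toeplitz_zero:
  assumes p: "p = min r k" and ed: "[:- z, 1:] ^ j \<in> elementary_divisors (matrix_poly n k C)" and j: "Suc r \<le> j"
  shows "\<exists>X\<in>toeplitz_set n p r. block_row n (Suc k) C * M_mat n k p z * X = 0\<^sub>m n (Suc r)"
proof -
  obtain y where y: "has_chain n (Suc r) z (matrix_poly n k C) y"
    using elementary_divisor_imp_chain[OF matrix_poly_carrier ed j] by auto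
  then have yc: "y \<in> carrier_vec n" and y0: "\<exists>b<n. poly (y $ b) z \<noteq> 0"
    and dvd: "\<forall>a<n. [:- z, 1:] ^ Suc r dvd (matrix_poly n k C *\<^sub>v y) $ a"
    unfolding has_chain_def by auto
  define x where "x = (\<lambda>j. vec n (\<lambda>b. taylor_coeff z (y $ b) j))"
  define \<gamma> where "\<gamma> = (\<lambda>l :: nat. 1 :: real)"
  have "block_row n (Suc k) C * M_mat n k p z * toeplitz_like n p r \<gamma> x = 0\<^sub>m n (Suc r)"
    using dvd by (subst toeplitz_product_zero_iff[OF p _ yc]) (auto simp: \<gamma>_def x_def)
  moreover have "toeplitz_like n p r \<gamma> x \<in> toeplitz_set n p r"
  proof -
    have "x 0 \<noteq> 0\<^sub>v n"
    proof
      assume "x 0 = 0\<^sub>v n"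
      then have "x 0 $ b = 0" if "b < n" for b using that by simp
      then show False using y0 by (auto simp: x_def)
    qed
    moreover have "\<forall>i\<le>r. x i \<in> carrier_vec n" "\<forall>l\<in>{1..r}. \<gamma> l > 0" by (auto simp: x_def \<gamma>_def)
    ultimately show ?thesis unfolding toeplitz_set_def by blast
  qed
  ultimately show ?thesis by blast
qed

lemma toeplitz_zero_imp_chain:
  assumes p: "p = min r k" and X: "X \<in> toeplitz_set n p r"
    and z: "block_row n (Suc k) C * M_mat n k p z * X = 0\<^sub>m n (Suc r)"
  shows "\<exists>y. has_chain n (Suc r) z (matrix_poly n k C) y"
proof -
  obtain \<gamma> x where x: "X = toeplitz_like n p r \<gamma> x" "\<And>i. i \<le> r \<Longrightarrow> x i \<in> carrier_vec n" "x 0 \<noteq> 0\<^sub>v n"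
    "\<And>l. l \<in> {1..r} \<Longrightarrow> \<gamma> l > 0"
    using X unfolding toeplitz_set_def by auto
  let ?G = "\<lambda>j. complex_of_real (\<Prod>l = 1..j. \<gamma> l)"
  have G: "?G j \<noteq> 0" if "j \<le> r" for j
  proof -
    have "(\<Prod>l = 1..j. \<gamma> l) > 0" using x(4) that by (intro prod_pos) auto
    then show ?thesis by (simp only: of_real_eq_0_iff)
  qed
  define y where "y = vec n (\<lambda>b. (\<Sum>j\<le>r. monom (x j $ b / ?G j) j) \<circ>\<^sub>p [:- z, 1:])"
  have y: "y \<in> carrier_vec n" by (simp add: y_def)
  have ty: "taylor_coeff z (y $ b) j = x j $ b / ?G j" if "j \<le> r" "b < n" for j b
  proof -
    have "taylor_coeff z (y $ b) j = (\<Sum>j'\<le>r. if j' = j then x j $ b / ?G j else 0)"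
      using that by (auto simp: y_def taylor_coeff_def shift_back coeff_sum intro!: sum.cong)
    then show ?thesis using that by simp
  qed
  have "x j $ b = ?G j * taylor_coeff z (y $ b) j" if "j \<le> r" "b < n" for j b
    using ty[OF that] G[OF that(1)] by simp
  then have "\<forall>a<n. [:- z, 1:] ^ Suc r dvd (matrix_poly n k C *\<^sub>v y) $ a"
    using toeplitz_product_zero_iff[where \<gamma> = \<gamma> and x = x and C = C and z = z, OF p x(4) y] z x(1) by blast
  moreover have "\<exists>b<n. poly (y $ b) z \<noteq> 0"
  proof (rule ccontr)
    assume "\<not> ?thesis"
    then have "x 0 $ b = 0" if "b < n" for b using ty[of 0 b] that by simp
    then have "x 0 = 0\<^sub>v n" using x(2)[of 0] by (intro eq_vecI) auto
    then show False using x(3) by simp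
  qed
  ultimately show ?thesis unfolding has_chain_def using y by blast
qed

lemma toeplitz_set_carrier: "X \<in> toeplitz_set n p r \<Longrightarrow> X \<in> carrier_mat (Suc p * n) (Suc r)"
  unfolding toeplitz_set_def by (auto simp del: mult_Suc)

lemma pinv_projection:
  fixes Y :: "complex mat"
  assumes Y: "Y \<in> carrier_mat m c"
  shows "Y * pinv Y \<in> carrier_mat m m" "mat_adjoint (Y * pinv Y) = Y * pinv Y"
    "Y * pinv Y * (Y * pinv Y) = Y * pinv Y" "Y * pinv Y * Y = Y"
proof -
  have Z: "pinv Y \<in> carrier_mat c m" using Y by simp
  note d = is_pinv_pinv[of Y, unfolded is_pinv_def]
  show P: "Y * pinv Y \<in> carrier_mat m m" using Y Z by auto
  show "mat_adjoint (Y * pinv Y) = Y * pinv Y" "Y * pinv Y * Y = Y" using d by auto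
  then show "Y * pinv Y * (Y * pinv Y) = Y * pinv Y" using assoc_mult_mat[OF P Y Z] by simp
qed

text \<open>In terms of coefficient rows, an admissible perturbation \<open>D\<close> satisfies \<open>(A + D) Y = 0\<close> for some \<open>Y = M X\<close>
  and is at least as large as its projection \<open>D Y Y\<^sup>\<dagger> = - A Y Y\<^sup>\<dagger>\<close> (\<open>lower\<close>).  Conversely \<open>- A Y Y\<^sup>\<dagger>\<close> is
  itself admissible if the perturbed polynomial is regular, and a limit of admissible perturbations if it is
  singular (\<open>upper\<close>).\<close>

lemma dist_ed_eq_projection:
  assumes A: "\<And>i. i \<le> k \<Longrightarrow> A i \<in> carrier_mat n n" and P: "P = matrix_poly n k A"
    and r: "r < k * n" and p: "p = min r k"
  shows "dist_ed s k P z (Suc r) = (INF X\<in>toeplitz_set n p r.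
     mat_norm s (block_row n (Suc k) A * M_mat n k p z * X * pinv (M_mat n k p z * X)))"
proof -
  have n: "n > 0" and k: "k > 0" using r by (auto intro: gr0I)
  let ?R = "block_row n (Suc k)" and ?M = "M_mat n k p z"
  define f where "f = (\<lambda>X. mat_norm s (?R A * ?M * X * pinv (?M * X)))"
  define S where "S = {pert_norm s n k dA | dA. (\<forall>i\<le>k. dA i \<in> carrier_mat n n) \<and>
     (\<exists>j\<ge>Suc r. [:- z, 1:] ^ j \<in> elementary_divisors (P + matrix_poly n k dA))}"
  have dist: "dist_ed s k P z (Suc r) = Inf S"
    unfolding dist_ed_def S_def P using carrier_matD[OF matrix_poly_carrier[of n k A]] by simp
  have Y: "?M * X \<in> carrier_mat (Suc k * n) (Suc r)" if "X \<in> toeplitz_set n p r" for X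
    by (rule mult_carrier_mat[OF M_mat_carrier toeplitz_set_carrier[OF that]])
  have assoc: "?R C * ?M * X = ?R C * (?M * X)" if "X \<in> toeplitz_set n p r" for C X
    by (rule assoc_mult_mat[OF block_row_carrier M_mat_carrier toeplitz_set_carrier[OF that]])
  have fX: "f X = mat_norm s (?R A * ((?M * X) * pinv (?M * X)))" if X: "X \<in> toeplitz_set n p r" for X
    unfolding f_def assoc[OF X] using assoc_mult_mat[OF block_row_carrier Y[OF X] pinv_carrier[OF Y[OF X]]] by simp
  have SI: "pert_norm s n k D \<in> S"
    if "\<And>i. i \<le> k \<Longrightarrow> D i \<in> carrier_mat n n" "Suc r \<le> j"
      "[:- z, 1:] ^ j \<in> elementary_divisors (P + matrix_poly n k D)" for D j
    unfolding S_def using that by blast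
  have lower: "\<exists>X\<in>toeplitz_set n p r. f X \<le> d" if d: "d \<in> S" for d
  proof -
    obtain dA j where dA: "d = pert_norm s n k dA" "\<And>i. i \<le> k \<Longrightarrow> dA i \<in> carrier_mat n n"
      and j: "Suc r \<le> j" "[:- z, 1:] ^ j \<in> elementary_divisors (P + matrix_poly n k dA)"
      using d unfolding S_def by auto
    have "P + matrix_poly n k dA = matrix_poly n k (\<lambda>i. A i + dA i)"
      unfolding P using A dA by (intro matrix_poly_add) auto
    then obtain X where X: "X \<in> toeplitz_set n p r" "?R (\<lambda>i. A i + dA i) * ?M * X = 0\<^sub>m n (Suc r)"
      using elementary_divisor_imp_toeplitz_zero[OF p _ j(1), of z n "\<lambda>i. A i + dA i"] j(2) by auto
    define Z where "Z = ?M * X"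
    have Z: "Z \<in> carrier_mat (Suc k * n) (Suc r)" unfolding Z_def by (rule Y[OF X(1)])
    note pr = pinv_projection[OF Z]
    have "?R (\<lambda>i. A i + dA i) = ?R A + ?R dA" using A dA n by (intro block_row_add) auto
    moreover have "?R (\<lambda>i. A i + dA i) * Z = 0\<^sub>m n (Suc r)" unfolding Z_def assoc[OF X(1), symmetric] by (rule X(2))
    ultimately have "(?R A + ?R dA) * Z = 0\<^sub>m n (Suc r)" by (simp only:)
    then have z0: "?R A * Z + ?R dA * Z = 0\<^sub>m n (Suc r)"
      using add_mult_distrib_mat[OF block_row_carrier block_row_carrier Z] by simp
    have c1: "?R A * Z \<in> carrier_mat n (Suc r)" "?R dA * Z \<in> carrier_mat n (Suc r)"
      using mult_carrier_mat[OF block_row_carrier Z] by auto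
    have neg: "?R A * Z = - (?R dA * Z)"
    proof (rule eq_matI)
      fix a b assume "a < dim_row (- (?R dA * Z))" "b < dim_col (- (?R dA * Z))"
      then have ab: "a < n" "b < Suc r" using c1 by auto
      have "(?R A * Z + ?R dA * Z) $$ (a, b) = 0" unfolding z0 using ab by simp
      then have "(?R A * Z) $$ (a, b) + (?R dA * Z) $$ (a, b) = 0"
        using ab carrier_matD[OF c1(2)] by (simp del: index_mult_mat(1))
      then show "(?R A * Z) $$ (a, b) = (- (?R dA * Z)) $$ (a, b)"
        using ab carrier_matD[OF c1(2)] by (simp add: eq_neg_iff_add_eq_0 del: index_mult_mat(1))
    qed (auto simp: block_row_def)
    have "?R A * (Z * pinv Z) = ?R A * Z * pinv Z"
      by (rule assoc_mult_mat[OF block_row_carrier Z pinv_carrier[OF Z], symmetric])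
    also have "\<dots> = - (?R dA * Z * pinv Z)"
      unfolding neg by (rule uminus_mult_left_mat) (use c1 pinv_carrier[OF Z] in auto)
    also have "?R dA * Z * pinv Z = ?R dA * (Z * pinv Z)"
      by (rule assoc_mult_mat[OF block_row_carrier Z pinv_carrier[OF Z]])
    finally have "f X = mat_norm s (?R dA * (Z * pinv Z))"
      unfolding fX[OF X(1)] Z_def[symmetric] by (simp add: mat_norm_uminus)
    also have "\<dots> \<le> mat_norm s (?R dA)"
      by (rule mat_norm_mult_projection[OF block_row_carrier pr(1,2,3)])
    also have "\<dots> = d" unfolding dA(1) using dA(2) by (rule pert_norm_block_row[symmetric])
    finally show ?thesis using X by blast
  qed
  have upper: "\<exists>d\<in>S. d \<le> f X + e" if X: "X \<in> toeplitz_set n p r" and e: "e > 0" for X e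
  proof -
    define Z where "Z = ?M * X"
    have Z: "Z \<in> carrier_mat (Suc k * n) (Suc r)" unfolding Z_def by (rule Y[OF X])
    note pr = pinv_projection[OF Z]
    have RP: "?R A * (Z * pinv Z) \<in> carrier_mat n (Suc k * n)" by (rule mult_carrier_mat[OF block_row_carrier pr(1)])
    define D where "D = - (?R A * (Z * pinv Z))"
    have D: "D \<in> carrier_mat n (Suc k * n)" unfolding D_def using RP by simp
    define dA where "dA = (\<lambda>i. mat n n (\<lambda>(a, b). D $$ (a, i * n + b)))"
    have dA: "dA i \<in> carrier_mat n n" for i by (simp add: dA_def)
    have RD: "?R dA = D" by (rule block_row_eqI[OF D n]) (simp add: dA_def)
    define C where "C = (\<lambda>i. A i + dA i)"
    have C: "C i \<in> carrier_mat n n" if "i \<le> k" for i using A that dA by (simp add: C_def)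
    have RC: "?R C = ?R A + D" unfolding C_def RD[symmetric] using A dA n by (intro block_row_add) auto
    have normD: "mat_norm s D = f X" unfolding D_def mat_norm_uminus fX[OF X] Z_def ..
    have RZ: "?R A * Z \<in> carrier_mat n (Suc r)" by (rule mult_carrier_mat[OF block_row_carrier Z])
    have "?R C * ?M * X = ?R C * Z" unfolding Z_def by (rule assoc[OF X])
    also have "\<dots> = (?R A + D) * Z" unfolding RC ..
    also have "\<dots> = ?R A * Z + D * Z" by (rule add_mult_distrib_mat[OF block_row_carrier D Z])
    also have "D * Z = - (?R A * (Z * pinv Z) * Z)"
      unfolding D_def by (rule uminus_mult_left_mat) (use RP Z in auto)
    also have "?R A * (Z * pinv Z) * Z = ?R A * (Z * pinv Z * Z)"
      by (rule assoc_mult_mat[OF block_row_carrier pr(1) Z])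
    also have "?R A * Z + - (?R A * (Z * pinv Z * Z)) = 0\<^sub>m n (Suc r)"
      unfolding pr(4) using carrier_matD[OF RZ] by (intro eq_matI) (auto simp del: index_mult_mat)
    finally have zero: "?R C * ?M * X = 0\<^sub>m n (Suc r)" .
    obtain y where y: "has_chain n (Suc r) z (matrix_poly n k C) y"
      using toeplitz_zero_imp_chain[OF p X zero] by blast
    have PC: "P + matrix_poly n k (\<lambda>i. B i - A i) = matrix_poly n k B"
      if B: "\<And>i. i \<le> k \<Longrightarrow> B i \<in> carrier_mat n n" for B
    proof -
      have "P + matrix_poly n k (\<lambda>i. B i - A i) = matrix_poly n k (\<lambda>i. A i + (B i - A i))"
        unfolding P using A B by (intro matrix_poly_add minus_carrier_mat) auto
      also have "\<dots> = matrix_poly n k B"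
        using carrier_matD[OF A] carrier_matD[OF B] by (intro eq_matI) (auto simp: matrix_poly_def intro!: sum.cong)
      finally show ?thesis .
    qed
    show ?thesis
    proof (cases "det (matrix_poly n k C) = 0")
      case False
      then obtain j where j: "Suc r \<le> j" "[:- z, 1:] ^ j \<in> elementary_divisors (matrix_poly n k C)"
        using chain_imp_elementary_divisor[OF matrix_poly_carrier False y] by auto
      have "P + matrix_poly n k dA = matrix_poly n k C"
        unfolding P C_def using A dA by (intro matrix_poly_add) auto
      then have "pert_norm s n k dA \<in> S" using SI[of dA j] dA j by simp
      moreover have "pert_norm s n k dA = f X" using pert_norm_block_row[of k dA n s, OF dA] RD normD by simp
      ultimately show ?thesis using e by (intro bexI[of _ "pert_norm s n k dA"]) auto
    next
      case True
      obtain B j where B: "\<And>i. i \<le> k \<Longrightarrow> B i \<in> carrier_mat n n" "Suc r \<le> j"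
        "[:- z, 1:] ^ j \<in> elementary_divisors (matrix_poly n k B)" "mat_l1 (?R B - ?R C) < e"
        using singular_matrix_poly_limit[OF n k True, of "Suc r" e z] r e by auto
      define dB where "dB = (\<lambda>i. B i - A i)"
      have dB: "dB i \<in> carrier_mat n n" if "i \<le> k" for i
        unfolding dB_def using A that by (intro minus_carrier_mat) auto
      have "P + matrix_poly n k dB = matrix_poly n k B" unfolding dB_def by (rule PC[OF B(1)])
      then have "pert_norm s n k dB \<in> S" using SI[of dB j] dB B(2,3) by simp
      moreover have "pert_norm s n k dB \<le> f X + e"
      proof -
        have "?R dB = D + (?R B - ?R C)"
        proof (rule block_row_eqI[OF _ n])
          show "D + (?R B - ?R C) \<in> carrier_mat n (Suc k * n)"
            by (intro add_carrier_mat minus_carrier_mat block_row_carrier)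
          fix a i b assume ib: "a < n" "i < Suc k" "b < n"
          then have l: "i * n + b < Suc k * n" by (intro block_index_less)
          have "(D + (?R B - ?R C)) $$ (a, i * n + b) = D $$ (a, i * n + b) + (B i $$ (a, b) - C i $$ (a, b))"
            using ib l carrier_matD[OF block_row_carrier[of n "Suc k" B]] carrier_matD[OF block_row_carrier[of n "Suc k" C]]
            by (simp add: block_row_entry del: mult_Suc)
          also have "C i $$ (a, b) = A i $$ (a, b) + D $$ (a, i * n + b)"
            using ib A[of i] by (simp add: C_def dA_def)
          finally show "(D + (?R B - ?R C)) $$ (a, i * n + b) = dB i $$ (a, b)"
            using ib A[of i] B(1)[of i] by (simp add: dB_def)
        qed
        then have "pert_norm s n k dB = mat_norm s (D + (?R B - ?R C))"
          using pert_norm_block_row[of k dB n s] dB by simp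
        also have "\<dots> \<le> mat_norm s D + mat_norm s (?R B - ?R C)"
          by (rule mat_norm_add[OF D]) (rule minus_carrier_mat[OF block_row_carrier])
        also have "mat_norm s (?R B - ?R C) \<le> mat_l1 (?R B - ?R C)" by (rule mat_norm_le_mat_l1)
        finally show ?thesis using B(4) normD by simp
      qed
      ultimately show ?thesis by blast
    qed
  qed
  have T0: "toeplitz_set n p r \<noteq> {}"
  proof -
    have "unit_vec n 0 \<noteq> (0\<^sub>v n :: complex vec)" using n by (metis index_unit_vec(1) index_zero_vec(1) zero_neq_one)
    then have "toeplitz_like n p r (\<lambda>_. 1) (\<lambda>_. unit_vec n 0) \<in> toeplitz_set n p r"
      unfolding toeplitz_set_def
      by (intro CollectI exI[of _ "\<lambda>_. 1"] exI[of _ "\<lambda>_. unit_vec n 0"] conjI refl) auto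
    then show ?thesis by blast
  qed
  then obtain X0 where X0: "X0 \<in> toeplitz_set n p r" by blast
  have S0: "S \<noteq> {}" using upper[OF X0, of 1] by auto
  have Sb: "bdd_below S"
  proof (rule bdd_belowI)
    fix d assume "d \<in> S"
    then obtain dA where "d = pert_norm s n k dA" "\<And>i. i \<le> k \<Longrightarrow> dA i \<in> carrier_mat n n" unfolding S_def by auto
    then show "0 \<le> d" using pert_norm_block_row[of k dA n s] mat_norm_nonneg by simp
  qed
  have fb: "bdd_below (f ` toeplitz_set n p r)"
    by (rule bdd_belowI[of _ 0]) (auto simp: f_def mat_norm_nonneg)
  have "Inf S = (INF X\<in>toeplitz_set n p r. f X)"
  proof (rule antisym)
    show "(INF X\<in>toeplitz_set n p r. f X) \<le> Inf S"
    proof (rule cInf_greatest[OF S0])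
      fix d assume "d \<in> S"
      then obtain X where "X \<in> toeplitz_set n p r" "f X \<le> d" using lower by blast
      then show "(INF X\<in>toeplitz_set n p r. f X) \<le> d" using cINF_lower[OF fb] by (meson order.trans)
    qed
    show "Inf S \<le> (INF X\<in>toeplitz_set n p r. f X)"
    proof (rule cINF_greatest[OF T0])
      fix X assume X: "X \<in> toeplitz_set n p r"
      show "Inf S \<le> f X"
      proof (rule field_le_epsilon)
        fix e :: real assume "e > 0"
        then obtain d where "d \<in> S" "d \<le> f X + e" using upper[OF X] by blast
        then show "Inf S \<le> f X + e" using cInf_lower[OF _ Sb] by (meson order.trans)
      qed
    qed
  qed
  then show ?thesis unfolding dist f_def .
qed

text \<open>The coordinate embedding for \<open>m \<le> l\<close>; for \<open>l \<le> m\<close> this is its adjoint, the coordinate projection.\<close>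

definition embedding :: "nat \<Rightarrow> nat \<Rightarrow> complex mat" where
  "embedding l m = mat l m (\<lambda>(i, j). if i = j then 1 else 0)"

lemma embedding_carrier [simp]: "embedding l m \<in> carrier_mat l m" "(embedding l m)\<^sup>T = embedding m l"
  by (auto simp: embedding_def)

lemma embedding_mult_vec:
  assumes "v \<in> carrier_vec m" "i < l"
  shows "(embedding l m *\<^sub>v v) $ i = (if i < m then v $ i else 0)"
proof -
  have "(embedding l m *\<^sub>v v) $ i = (\<Sum>j<m. if j = i then v $ i else 0)"
    unfolding mult_mat_vec_entry[OF embedding_carrier(1) assms] using assms
    by (intro sum.cong refl) (auto simp: embedding_def)
  then show ?thesis by simp
qed

lemma contraction_embedding: "contraction (embedding l m)"
  unfolding contraction_def
proof
  fix v :: "complex vec" assume "v \<in> carrier_vec (dim_col (embedding l m))"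
  then have v: "v \<in> carrier_vec m" by (simp add: embedding_def)
  have "(vec_norm2 (embedding l m *\<^sub>v v))\<^sup>2 = (\<Sum>i<l. if i < m then (cmod (v $ i))\<^sup>2 else 0)"
    unfolding vec_norm2_sq using v
    by (auto simp: embedding_mult_vec carrier_matD[OF embedding_carrier(1)] simp del: index_mult_mat_vec intro!: sum.cong)
  also have "\<dots> = (\<Sum>i\<in>{..<l} \<inter> {..<m}. (cmod (v $ i))\<^sup>2)"
    by (simp add: sum.If_cases lessThan_def Int_def)
  also have "\<dots> \<le> (\<Sum>i<m. (cmod (v $ i))\<^sup>2)" by (intro sum_mono2) auto
  also have "\<dots> = (vec_norm2 v)\<^sup>2" using v by (simp add: vec_norm2_sq)
  finally show "vec_norm2 (embedding l m *\<^sub>v v) \<le> vec_norm2 v"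
    by (rule power2_le_imp_le) (rule vec_norm2_nonneg)
qed

lemma embedding_left_inverse: "m \<le> l \<Longrightarrow> embedding m l * embedding l m = 1\<^sub>m m"
proof (rule eq_matI)
  fix i j assume ml: "m \<le> l" and "i < dim_row (1\<^sub>m m :: complex mat)" "j < dim_col (1\<^sub>m m :: complex mat)"
  then have ij: "i < m" "j < m" by auto
  have "(embedding m l * embedding l m) $$ (i, j) = (\<Sum>a<l. if a = i then (if i = j then 1 else 0) else 0)"
    unfolding mult_mat_entry[OF embedding_carrier(1) embedding_carrier(1) ij] using ij
    by (intro sum.cong refl) (auto simp: embedding_def)
  then show "(embedding m l * embedding l m) $$ (i, j) = 1\<^sub>m m $$ (i, j)" using ij ml by simp
qed (auto simp: embedding_def)

lemma mat_adjoint_embedding: "mat_adjoint (embedding l m) = embedding m l"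
proof (rule eq_matI)
  fix i j assume "i < dim_row (embedding m l)" "j < dim_col (embedding m l)"
  then have "i < m" "j < l" by (auto simp: embedding_def)
  then show "mat_adjoint (embedding l m) $$ (i, j) = embedding m l $$ (i, j)"
    unfolding mat_adjoint_entry[OF embedding_carrier(1) \<open>i < m\<close> \<open>j < l\<close>] by (simp add: embedding_def)
qed (auto simp: embedding_def)

text \<open>Multiplying by the projection from the right appends zero columns.\<close>

lemma mat_norm_mult_embedding:
  assumes "Z \<in> carrier_mat n m" "m \<le> l"
  shows "mat_norm s (Z * embedding m l) = mat_norm s Z"
proof (rule antisym)
  show "mat_norm s (Z * embedding m l) \<le> mat_norm s Z"
    by (rule mat_norm_mult_contraction[OF assms(1) embedding_carrier(1) contraction_embedding])
      (simp add: contraction_embedding)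
  have "Z = Z * embedding m l * embedding l m"
    using assoc_mult_mat[OF assms(1) embedding_carrier(1) embedding_carrier(1), of l m]
      embedding_left_inverse[OF assms(2)] assms(1) by simp
  then have "mat_norm s Z = mat_norm s (Z * embedding m l * embedding l m)" by simp
  also have "\<dots> \<le> mat_norm s (Z * embedding m l)"
    by (rule mat_norm_mult_contraction[OF mult_carrier_mat[OF assms(1) embedding_carrier(1)] embedding_carrier(1) contraction_embedding])
      (simp add: contraction_embedding)
  finally show "mat_norm s Z \<le> mat_norm s (Z * embedding m l)" .
qed

text \<open>The embedding is an isometry, so its adjoint undoes it in all four Penrose equations.\<close>

lemma pinv_embedding_mult:
  assumes X: "X \<in> carrier_mat m c" and ml: "m \<le> l"
  shows "pinv (embedding l m * X) = pinv X * embedding m l"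
proof (rule pinv_eqI)
  let ?J = "embedding l m" and ?K = "embedding m l"
  note d = is_pinv_pinv[of X, unfolded is_pinv_def]
  have P: "pinv X \<in> carrier_mat c m" using X by simp
  have J: "?J \<in> carrier_mat l m" and K: "?K \<in> carrier_mat m l" by auto
  have KJ: "?K * ?J = 1\<^sub>m m" by (rule embedding_left_inverse[OF ml])
  have JX: "?J * X \<in> carrier_mat l c" and PK: "pinv X * ?K \<in> carrier_mat c l" and XP: "X * pinv X \<in> carrier_mat m m"
    by (rule mult_carrier_mat[OF J X], rule mult_carrier_mat[OF P K], rule mult_carrier_mat[OF X P])
  have JXP: "?J * (X * pinv X) \<in> carrier_mat l m" by (rule mult_carrier_mat[OF J XP])
  have PX: "pinv X * X \<in> carrier_mat c c" by (rule mult_carrier_mat[OF P X])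
  have l1: "?J * X * (pinv X * ?K) = ?J * (X * pinv X) * ?K"
    using assoc_mult_mat[OF JX P K] assoc_mult_mat[OF J X P] by simp
  have KJX: "?K * (?J * X) = X" using assoc_mult_mat[OF K J X] KJ X by simp
  have l2: "pinv X * ?K * (?J * X) = pinv X * X"
    using assoc_mult_mat[OF P K JX] KJX by simp
  have r1: "?J * X * (pinv X * ?K) * (?J * X) = ?J * X"
  proof -
    have "?J * X * (pinv X * ?K) * (?J * X) = ?J * X * (pinv X * ?K * (?J * X))"
      by (rule assoc_mult_mat[OF JX PK JX])
    also have "\<dots> = ?J * (X * (pinv X * X))" unfolding l2 by (rule assoc_mult_mat[OF J X PX])
    also have "X * (pinv X * X) = X" using d assoc_mult_mat[OF X P X] by simp
    finally show ?thesis .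
  qed
  have r2: "pinv X * ?K * (?J * X) * (pinv X * ?K) = pinv X * ?K"
  proof -
    have "pinv X * X * (pinv X * ?K) = pinv X * X * pinv X * ?K"
      by (rule assoc_mult_mat[OF PX P K, symmetric])
    then show ?thesis unfolding l2 using d by simp
  qed
  have a1: "mat_adjoint (?J * X * (pinv X * ?K)) = ?J * X * (pinv X * ?K)"
  proof -
    have "mat_adjoint (?J * (X * pinv X) * ?K) = mat_adjoint ?K * mat_adjoint (?J * (X * pinv X))"
      by (rule mat_adjoint_mult[OF JXP K])
    also have "mat_adjoint (?J * (X * pinv X)) = mat_adjoint (X * pinv X) * mat_adjoint ?J"
      by (rule mat_adjoint_mult[OF J XP])
    also have "mat_adjoint (X * pinv X) = X * pinv X" using d by simp
    also have "mat_adjoint ?K * (X * pinv X * mat_adjoint ?J) = ?J * (X * pinv X) * ?K"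
      unfolding mat_adjoint_embedding by (rule assoc_mult_mat[OF J XP K, symmetric])
    finally show ?thesis unfolding l1 .
  qed
  have a2: "mat_adjoint (pinv X * ?K * (?J * X)) = pinv X * ?K * (?J * X)" unfolding l2 using d by simp
  show "is_pinv (?J * X) (pinv X * ?K)"
    unfolding is_pinv_def using r1 r2 a1 a2 PK JX by (simp add: carrier_matD[OF JX] del: index_mult_mat)
qed

lemma M_mat_at_0:
  assumes n: "n > 0"
  shows "M_mat n k p 0 = embedding (Suc k * n) (Suc p * n)"
proof (rule eq_matI)
  fix c d assume "c < dim_row (embedding (Suc k * n) (Suc p * n))" "d < dim_col (embedding (Suc k * n) (Suc p * n))"
  then have cd: "c < Suc k * n" "d < Suc p * n" by (auto simp: embedding_def)
  have l: "c div n \<le> k" "d div n \<le> p" using cd n by (simp_all add: div_less_iff_less_mult flip: less_Suc_eq_le)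
  have b: "c mod n < n" "d mod n < n" using n by auto
  have "M_mat n k p 0 $$ (c div n * n + c mod n, d div n * n + d mod n) =
      (if c mod n = d mod n then taylor_coeff 0 (monom 1 (c div n)) (d div n) else 0)"
    by (rule M_mat_entry[OF l b])
  then have "M_mat n k p 0 $$ (c, d) = (if c mod n = d mod n \<and> c div n = d div n then 1 else 0)"
    by (simp add: taylor_coeff_at_0)
  also have "c mod n = d mod n \<and> c div n = d div n \<longleftrightarrow> c = d" by (metis div_mult_mod_eq)
  finally show "M_mat n k p 0 $$ (c, d) = embedding (Suc k * n) (Suc p * n) $$ (c, d)"
    using cd by (simp add: embedding_def del: mult_Suc)
qed (auto simp: embedding_def carrier_matD[OF M_mat_carrier] simp del: mult_Suc)

lemma block_row_embedding:
  assumes "p \<le> k" "n > 0"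
  shows "block_row n (Suc k) A * embedding (Suc k * n) (Suc p * n) = block_row n (Suc p) A"
proof (rule block_row_eqI[symmetric, OF _ assms(2)])
  show "block_row n (Suc k) A * embedding (Suc k * n) (Suc p * n) \<in> carrier_mat n (Suc p * n)"
    by (rule mult_carrier_mat[OF block_row_carrier embedding_carrier(1)])
  fix a i b assume ib: "a < n" "i < Suc p" "b < n"
  have l: "i * n + b < Suc p * n" "i * n + b < Suc k * n" using ib assms by (auto intro!: block_index_less simp del: mult_Suc)
  have "(block_row n (Suc k) A * embedding (Suc k * n) (Suc p * n)) $$ (a, i * n + b) =
      (\<Sum>c<Suc k * n. if c = i * n + b then block_row n (Suc k) A $$ (a, i * n + b) else 0)"
    unfolding mult_mat_entry[OF block_row_carrier embedding_carrier(1) ib(1) l(1)] using l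
    by (intro sum.cong refl) (auto simp: embedding_def simp del: mult_Suc)
  then show "(block_row n (Suc k) A * embedding (Suc k * n) (Suc p * n)) $$ (a, i * n + b) = A i $$ (a, b)"
    using l ib assms by (simp add: block_row_entry del: mult_Suc)
qed

theorem theorem6p1:
  fixes A :: "nat \<Rightarrow> complex mat" and P :: "complex poly mat"
    and n k r p :: nat and s :: norm_kind
  assumes "\<And>i. i \<le> k \<Longrightarrow> A i \<in> carrier_mat n n"
    and "A k \<noteq> 0\<^sub>m n n"
    and "P = matrix_poly n k A"
    and "0 < r" and "r < k * n"
    and "p = min r k"
  shows "dist_ed s k P 0 (r + 1) =
           (INF X\<in>toeplitz_set n p r. mat_norm s (block_row n (p + 1) A * X * pinv X)) \<and>
         (\<forall>z :: complex. dist_ed s k P z (r + 1) =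
           (INF X\<in>toeplitz_set n p r.
              mat_norm s (block_row n (p + 1) (\<lambda>i. (1 / fact i) \<cdot>\<^sub>m eval_mp (deriv_mp i P) z)
                * X * pinv (M_mat n k p z * X))))"
proof -
  have n: "n > 0" using assms(5) by (auto intro: gr0I)
  have pk: "p \<le> k" using assms(6) by simp
  have gen: "dist_ed s k P z (Suc r) = (INF X\<in>toeplitz_set n p r.
     mat_norm s (block_row n (Suc k) A * M_mat n k p z * X * pinv (M_mat n k p z * X)))" for z
    by (rule dist_ed_eq_projection[OF assms(1,3,5,6)])
  have le: "Suc p * n \<le> Suc k * n" using pk by (intro mult_le_mono1) simp
  have zero: "mat_norm s (block_row n (Suc k) A * M_mat n k p 0 * X * pinv (M_mat n k p 0 * X)) =
      mat_norm s (block_row n (Suc p) A * X * pinv X)" if X: "X \<in> toeplitz_set n p r" for X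
  proof -
    have Xc: "X \<in> carrier_mat (Suc p * n) (Suc r)" by (rule toeplitz_set_carrier[OF X])
    have RX: "block_row n (Suc p) A * X \<in> carrier_mat n (Suc r)" by (rule mult_carrier_mat[OF block_row_carrier Xc])
    have "block_row n (Suc p) A * X * (pinv X * embedding (Suc p * n) (Suc k * n)) =
        block_row n (Suc p) A * X * pinv X * embedding (Suc p * n) (Suc k * n)"
      by (rule assoc_mult_mat[OF RX pinv_carrier[OF Xc] embedding_carrier(1), symmetric])
    moreover have "block_row n (Suc p) A * X * pinv X \<in> carrier_mat n (Suc p * n)"
      by (rule mult_carrier_mat[OF RX pinv_carrier[OF Xc]])
    ultimately show ?thesis
      unfolding M_mat_at_0[OF n] block_row_embedding[OF pk n] pinv_embedding_mult[OF Xc le]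
      by (simp add: mat_norm_mult_embedding[OF _ le] del: mult_Suc)
  qed
  have "(INF X\<in>toeplitz_set n p r. mat_norm s (block_row n (Suc k) A * M_mat n k p 0 * X * pinv (M_mat n k p 0 * X))) =
      (INF X\<in>toeplitz_set n p r. mat_norm s (block_row n (Suc p) A * X * pinv X))"
    by (rule INF_cong[OF refl]) (rule zero)
  then show ?thesis
    using gen block_row_derivatives[OF n, of p k A] by (simp add: assms(3) del: mult_Suc)
qed

end
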